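(* Let $1<p,q<N$ and $\delta,\mu>0$ with $D:=\delta\mu-(p-1)(q-1)>0$. Assume that $\mathcal{A}_p$ is S-$p$-C and $\mathcal{A}_q$ is S-$q$-C on $\mathbb{R}^N$. Then there exist no entire nonnegative solutions $(u,v)$, other than the trivial one $u\equiv v\equiv 0$, with $u\in W^{1,p}_{loc}(\mathbb{R}^N)\cap C(\mathbb{R}^N)$, $v\in W^{1,q}_{loc}(\mathbb{R}^N)\cap C(\mathbb{R}^N)$, of the system $$\mathcal{A}_p u=v^{\delta},\qquad \mathcal{A}_q v=u^{\mu}\qquad\text{in }\mathbb{R}^N,$$ nor of the system $$\mathcal{A}_p u=v^{\delta},\qquad -\mathcal{A}_q v=u^{\mu}\qquad\text{in }\mathbb{R}^N.$$
   Context: With $\Omega=\mathbb{R}^N$: $\mathcal{A}_p u:=\operatorname{div}[\mathrm{A}_p(x,u,\nabla u)]$ and $\mathcal{A}_q v:=\operatorname{div}[\mathrm{A}_q(x,v,\nabla v)]$, where $\mathrm{A}_p,\mathrm{A}_q:\Omega\times\mathbb{R}^+\times\mathbb{R}^N\to\mathbb{R}^N$ are Carathéodory functions ($\mathbb{R}^+=[0,\infty)$). $\mathcal{A}_p$ is S-$p$-C (strongly $p$-coercive) if there are constants $K_{1,p},K_{2,p}>0$ with $$\mathrm{A}_p(x,u,\eta)\cdot\eta\ge K_{1,p}|\eta|^p\ge K_{2,p}|\mathrm{A}_p(x,u,\eta)|^{p'}\qquad\forall (x,u,\eta)\in\Omega\times\mathbb{R}^+\times\mathbb{R}^N,$$ $p'=p/(p-1)$;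 similarly for $\mathcal{A}_q$ being S-$q$-C. For $g\in L^1_{loc}(\Omega)$, a nonnegative $w\in W^{1,p}_{loc}(\Omega)$ satisfies $-\mathcal{A}_p w= g$ in $\Omega$ if $\mathrm{A}_p(x,w,\nabla w)\in L^{p'}_{loc}(\Omega)$ and $\int_\Omega \mathrm{A}_p(x,w,\nabla w)\cdot\nabla\phi=\int_\Omega g\phi$ for all nonnegative $\phi\in W^{1,\infty}(\Omega)$ with compact support in $\Omega$; similarly for $\mathcal{A}_q$. "Entire" means defined in all of $\mathbb{R}^N$. *)

theory Defs
  imports "HOL-Analysis.Analysis"
begin

definition L_loc :: "real \<Rightarrow> ('a::euclidean_space \<Rightarrow> 'b::euclidean_space) \<Rightarrow> bool" where
  "L_loc p f \<longleftrightarrow> f \<in> borel_measurable lebesgue \<and>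
     (\<forall>K. compact K \<longrightarrow> set_integrable lebesgue K (\<lambda>x. norm (f x) powr p))"

definition L_infty :: "('a::euclidean_space \<Rightarrow> 'b::euclidean_space) \<Rightarrow> bool" where
  "L_infty f \<longleftrightarrow> f \<in> borel_measurable lebesgue \<and> (\<exists>C. AE x in lebesgue. norm (f x) \<le> C)"

primrec Ck :: "nat \<Rightarrow> ('a::euclidean_space \<Rightarrow> real) \<Rightarrow> bool" where
  "Ck 0 f \<longleftrightarrow> continuous_on UNIV f"
| "Ck (Suc k) f \<longleftrightarrow> (\<forall>x. f differentiable (at x)) \<and>
     (\<forall>i\<in>Basis. Ck k (\<lambda>x. frechet_derivative f (at x) i))"

definition Cc_infty :: "('a::euclidean_space \<Rightarrow> real) \<Rightarrow> bool" where
  "Cc_infty \<phi> \<longleftrightarrow> (\<forall>k. Ck k \<phi>) \<and> compact (closure {x. \<phi> x \<noteq> 0})"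

text \<open>
  Functions here are representatives of their almost-everywhere classes, so the weak gradient is
  a relation: \<open>G\<close> is determined by \<open>w\<close> only up to null sets.
\<close>

definition has_weak_gradient ::
    "('a::euclidean_space \<Rightarrow> real) \<Rightarrow> ('a \<Rightarrow> 'a) \<Rightarrow> bool" where
  "has_weak_gradient w G \<longleftrightarrow> L_loc 1 w \<and> L_loc 1 G \<and>
     (\<forall>\<phi>. Cc_infty \<phi> \<longrightarrow> (\<forall>i\<in>Basis.
        (LINT x|lebesgue. w x * frechet_derivative \<phi> (at x) i) =
        - (LINT x|lebesgue. (G x \<bullet> i) * \<phi> x)))"

definition W1_loc :: "real \<Rightarrow> ('a::euclidean_space \<Rightarrow> real) \<Rightarrow> bool" where
  "W1_loc p w \<longleftrightarrow> L_loc p w \<and> (\<exists>G. has_weak_gradient w G \<and> L_loc p G)"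

definition caratheodory ::
    "('a::euclidean_space \<Rightarrow> real \<Rightarrow> 'a \<Rightarrow> 'a) \<Rightarrow> bool" where
  "caratheodory A \<longleftrightarrow>
     (\<forall>u\<ge>0. \<forall>\<eta>. (\<lambda>x. A x u \<eta>) \<in> borel_measurable lebesgue) \<and>
     (AE x in lebesgue. continuous_on ({0..} \<times> UNIV) (\<lambda>(u, \<eta>). A x u \<eta>))"

definition strongly_coercive ::
    "real \<Rightarrow> ('a::euclidean_space \<Rightarrow> real \<Rightarrow> 'a \<Rightarrow> 'a) \<Rightarrow> bool" where
  "strongly_coercive p A \<longleftrightarrow> (\<exists>K1>0. \<exists>K2>0. \<forall>x. \<forall>u\<ge>0. \<forall>\<eta>.
     A x u \<eta> \<bullet> \<eta> \<ge> K1 * norm \<eta> powr p \<and>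
     K1 * norm \<eta> powr p \<ge> K2 * norm (A x u \<eta>) powr (p / (p - 1)))"

text \<open>
  Weak form of \<open>- div A(x, w, \<nabla>w) = g\<close> on the whole space. The test functions \<open>\<phi>\<close> range over
  the nonnegative elements of \<open>W\<^sup>1\<^sup>,\<^sup>\<infinity>\<close> with compact (essential) support; \<open>H\<close> is the weak
  gradient of \<open>\<phi>\<close>.
\<close>

definition weak_solution ::
    "real \<Rightarrow> ('a::euclidean_space \<Rightarrow> real \<Rightarrow> 'a \<Rightarrow> 'a) \<Rightarrow> ('a \<Rightarrow> real) \<Rightarrow> ('a \<Rightarrow> real) \<Rightarrow> bool"
  where
  "weak_solution p A w g \<longleftrightarrow>
     L_loc 1 g \<and> W1_loc p w \<and> (AE x in lebesgue. 0 \<le> w x) \<and>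
     (\<exists>G. has_weak_gradient w G \<and> L_loc p G \<and>
        L_loc (p / (p - 1)) (\<lambda>x. A x (w x) (G x)) \<and>
        (\<forall>\<phi> H. L_infty \<phi> \<longrightarrow> has_weak_gradient \<phi> H \<longrightarrow> L_infty H \<longrightarrow>
           (AE x in lebesgue. 0 \<le> \<phi> x) \<longrightarrow>
           (\<exists>K. compact K \<and> (AE x in lebesgue. x \<notin> K \<longrightarrow> \<phi> x = 0)) \<longrightarrow>
           (LINT x|lebesgue. A x (w x) (G x) \<bullet> H x) = (LINT x|lebesgue. g x * \<phi> x)))"

end

(* Both systems reduce to integral estimates on balls. A subsolution u (-A_p u <= 0) satisfies a
   Caccioppoli inequality and, from a Nash-type inequality and iteration over radii, a reverse
   Hoelder inequality between any two of its L^k and L^m means, m > 0 arbitrarily small. Testing the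
   equation for u with a cutoff bounds the mean of v^delta by a power (p-1) of the mean of u, with a
   factor R^(-p). In the second equation, if v is a subsolution, argue symmetrically; if v is a
   supersolution, test with v^(-beta) and use the Hoelder inequality, which controls u^(theta mu) for
   some theta in (0,1), enough because small exponents of u suffice. Combining the two bounds gives
   X(rho) <= C (R/(rho'-rho))^M R^(-gamma) X(rho')^sigma for the normalised L^k norm X of u, with
   gamma > 0 and sigma = (p-1)(q-1)/(delta mu) < 1, so X(R) = O(R^(-gamma/(1-sigma))). For k large
   the integral of u^k over the ball of radius R tends to 0. Functions are kept positive by adding
  a constant epsilon, which changes neither the gradient nor the flux. *)
theory Submission
  imports Defs
begin

section \<open>A smooth mollifier\<close>

text \<open>The weak equation only accepts multipliers that are at least C1 here, whereas the
  estimates test with w^a zeta, where w is merely continuous with an L^p gradient. Mollifications of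
  w bridge this gap: they converge locally uniformly, keep the positive lower bound, so that powers
  of any sign are harmless, and their gradients converge in L^p, dual to the L^(p') integrability of
  the flux. The reverse Hoelder step rests on translations: a gradient bound controls the L^p
  distance between f and its translates, and averaging over translates of length at most r
  interpolates between that bound and a low mean of f. With r a small multiple of the gap between
  two radii, the top-order term carries a small factor and is absorbed. The price is a power of
  R/(rho'-rho). The relation \<open>controls\<close> carries such powers through a chain of
  estimates without tracking them, and sigma < 1 lets the last iteration swallow them. For a
  supersolution v the estimate produces a mean of order theta (q-1). Since u tolerates arbitrarily
  small exponents, theta can be shrunk until Jensen's inequality leads to the mean of order
  delta.\<close>

definition flat :: "nat \<Rightarrow> real \<Rightarrow> real" where
  "flat n t = (if t > 0 then (1 / t) ^ n / exp (1 / t) else 0)"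

lemma flat_nonneg: "0 \<le> flat n t"
  by (simp add: flat_def)

text \<open>The functions t^(-n) exp(-1/t), extended by zero, span a space that is closed under
  differentiation. This one first-order formula therefore yields derivatives of every order.\<close>

lemma flat_deriv:
  "(flat n has_real_derivative flat (n + 2) t - real n * flat (n + 1) t) (at t)"
proof -
  consider "t > 0" | "t < 0" | "t = 0" by linarith
  then show ?thesis
  proof cases
    case 1
    have d: "((\<lambda>t. (1 / t) ^ n / exp (1 / t)) has_real_derivative
        flat (n + 2) t - real n * flat (n + 1) t) (at t)"
    proof -
      define x E where "x = 1 / t" and "E = exp x"
      have x: "- 1 / (t * t) = - (x * x)" "E > 0" by (simp_all add: x_def E_def)
      have *: "((\<lambda>t. (1 / t) ^ n / exp (1 / t)) has_real_derivative
        ((real n * (x ^ (n - Suc 0) * (- (x * x)))) * E - x ^ n * (E * (- (x * x)))) / (E * E)) (at t)"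
        unfolding x(1)[symmetric] unfolding x_def E_def
        using 1 by (intro DERIV_divide DERIV_power[THEN DERIV_cong] DERIV_fun_exp)
          (auto intro!: derivative_eq_intros)
      have "(real n * (x ^ (n - Suc 0) * (- (x * x)))) * E - x ^ n * (E * (- (x * x)))
        = (x ^ (n + 2) - real n * x ^ (n + 1)) * E"
        by (cases n) (simp_all add: algebra_simps)
      then have "((real n * (x ^ (n - Suc 0) * (- (x * x)))) * E - x ^ n * (E * (- (x * x)))) / (E * E)
        = x ^ (n + 2) / E - real n * (x ^ (n + 1) / E)"
        using x(2) by (simp add: diff_divide_distrib)
      moreover have "flat k t = x ^ k / E" for k
        using 1 by (simp only: flat_def x_def E_def if_True)
      ultimately show ?thesis using * by (simp only:)
    qed
    have ev: "\<forall>\<^sub>F s in nhds t. (1 / s) ^ n / exp (1 / s) = flat n s"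
      using eventually_nhds_in_open[of "{0<..}" t] 1
      by (auto simp: flat_def elim!: eventually_mono)
    show ?thesis
      by (rule iffD1[OF DERIV_cong_ev[OF refl ev refl] d])
  next
    case 2
    have d: "((\<lambda>t. 0) has_real_derivative flat (n + 2) t - real n * flat (n + 1) t) (at t)"
      using 2 by (simp add: flat_def)
    have ev: "\<forall>\<^sub>F s in nhds t. 0 = flat n s"
      using eventually_nhds_in_open[of "{..<0}" t] 2
      by (auto simp: flat_def elim!: eventually_mono)
    show ?thesis
      by (rule iffD1[OF DERIV_cong_ev[OF refl ev refl] d])
  next
    case 3
    \<comment> \<open>The right difference quotient at 0 is x^(n+1)/e^x with x = 1/h tending to
      infinity; the left one is identically zero.\<close>
    have "((\<lambda>h. (1 / h) ^ (n + 1) / exp (1 / h)) \<longlongrightarrow> 0) (at_right (0::real))"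
      using filterlim_compose[OF tendsto_power_div_exp_0[of "n + 1"]
          filterlim_inverse_at_top_right]
      by (simp add: inverse_eq_divide)
    then have r: "((\<lambda>h. (flat n (0 + h) - flat n 0) / h) \<longlongrightarrow> 0) (at_right 0)"
      by (rule Lim_transform_eventually)
         (auto simp: flat_def eventually_at_filter intro!: always_eventually)
    have l: "((\<lambda>h. (flat n (0 + h) - flat n 0) / h) \<longlongrightarrow> 0) (at_left 0)"
      by (rule Lim_transform_eventually[OF tendsto_const])
         (auto simp: flat_def eventually_at_filter intro!: always_eventually)
    have "(flat n has_real_derivative 0) (at 0)"
      unfolding DERIV_def using l r by (simp add: filterlim_split_at)
    then show ?thesis using 3 by (simp add: flat_def)
  qed
qed

text \<open>A class closed under the operations that differentiating a radial bump produces. The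
  parameter \<open>e\<close> is the squared radius of the support, so that no square root spoils
  smoothness at the centre \<open>a\<close>.\<close>

inductive bumpy :: "real \<Rightarrow> 'a::euclidean_space \<Rightarrow> ('a \<Rightarrow> real) \<Rightarrow> bool" for e a where
  base: "bumpy e a (\<lambda>x. flat n (e - (x - a) \<bullet> (x - a)))"
| add: "bumpy e a f \<Longrightarrow> bumpy e a g \<Longrightarrow> bumpy e a (\<lambda>x. f x + g x)"
| scale: "bumpy e a f \<Longrightarrow> bumpy e a (\<lambda>x. c * f x)"
| coord: "bumpy e a f \<Longrightarrow> bumpy e a (\<lambda>x. ((x - a) \<bullet> i) * f x)"

lemma bumpy_deriv:
  assumes "bumpy e a f"
  shows "\<exists>D. (\<forall>x. (f has_derivative D x) (at x)) \<and> (\<forall>i. bumpy e a (\<lambda>x. D x i))"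
  using assms
proof induction
  case (base n)
  let ?s = "\<lambda>x. e - (x - a) \<bullet> (x - a)"
  \<comment> \<open>The derivative is arranged as scalings, coordinate factors and sums of base
    functions, so that it matches the introduction rules of \<open>bumpy\<close> literally.\<close>
  let ?D = "\<lambda>x h. (-2) * (((x - a) \<bullet> h) * (flat (n + 2) (?s x) + (- real n) * flat (n + 1) (?s x)))"
  have "((\<lambda>x. flat n (?s x)) has_derivative ?D x) (at x)" for x
  proof -
    have "(?s has_derivative (\<lambda>h. - 2 * ((x - a) \<bullet> h))) (at x)"
      by (auto intro!: derivative_eq_intros simp: inner_commute)
    from has_derivative_compose[OF this has_field_derivative_imp_has_derivative[OF flat_deriv]]
    show ?thesis by (simp add: algebra_simps)
  qed
  moreover have "bumpy e a (\<lambda>x. ?D x i)" for i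
    by (intro bumpy.intros)
  ultimately show ?case by (intro exI[of _ ?D]) blast
next
  case (add f g)
  then obtain D D' where "\<And>x. (f has_derivative D x) (at x)" "\<And>i. bumpy e a (\<lambda>x. D x i)"
    "\<And>x. (g has_derivative D' x) (at x)" "\<And>i. bumpy e a (\<lambda>x. D' x i)" by blast
  then show ?case
    by (intro exI[of _ "\<lambda>x i. D x i + D' x i"]) (auto intro!: bumpy.intros has_derivative_add)
next
  case (scale f c)
  then obtain D where "\<And>x. (f has_derivative D x) (at x)" "\<And>i. bumpy e a (\<lambda>x. D x i)" by blast
  then show ?case
    by (intro exI[of _ "\<lambda>x i. c * D x i"]) (auto intro!: bumpy.intros has_derivative_mult_right)
next
  case (coord f i)
  then obtain D where D: "\<And>x. (f has_derivative D x) (at x)" "\<And>i. bumpy e a (\<lambda>x. D x i)" by blast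
  let ?D = "\<lambda>x h. ((x - a) \<bullet> i) * D x h + (h \<bullet> i) * f x"
  have "((\<lambda>x. ((x - a) \<bullet> i) * f x) has_derivative ?D x) (at x)" for x
    by (auto intro!: derivative_eq_intros D)
  moreover have "bumpy e a (\<lambda>x. ?D x j)" for j
    using coord D by (intro bumpy.intros) auto
  ultimately show ?case by (intro exI[of _ ?D]) blast
qed

lemma bumpy_Ck: "bumpy e a f \<Longrightarrow> Ck k f"
proof (induction k arbitrary: f)
  case 0
  then obtain D where "\<And>x. (f has_derivative D x) (at x)" using bumpy_deriv by blast
  then show ?case
    by (auto intro!: continuous_at_imp_continuous_on has_derivative_continuous)
next
  case (Suc k)
  then obtain D where D: "\<And>x. (f has_derivative D x) (at x)" "\<And>i. bumpy e a (\<lambda>x. D x i)"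
    using bumpy_deriv by blast
  then have "frechet_derivative f (at x) = D x" for x
    using frechet_derivative_at by metis
  with D Suc.IH show ?case by (auto simp: differentiable_def)
qed

section \<open>Functions with a continuous gradient field\<close>

definition C1_grad :: "('a::euclidean_space \<Rightarrow> real) \<Rightarrow> ('a \<Rightarrow> 'a) \<Rightarrow> bool" where
  "C1_grad f D \<longleftrightarrow> continuous_on UNIV D \<and> (\<forall>x. (f has_derivative (\<lambda>h. D x \<bullet> h)) (at x))"

lemma C1_grad_cont: "C1_grad f D \<Longrightarrow> continuous_on UNIV f"
  unfolding C1_grad_def by (auto intro!: continuous_at_imp_continuous_on has_derivative_continuous)

lemma C1_grad_mult:
  assumes "C1_grad f D" "C1_grad g E"
  shows "C1_grad (\<lambda>x. f x * g x) (\<lambda>x. f x *\<^sub>R E x + g x *\<^sub>R D x)"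
  using assms C1_grad_cont[OF assms(1)] C1_grad_cont[OF assms(2)] unfolding C1_grad_def
  by (auto intro!: derivative_eq_intros continuous_intros simp: inner_add_left algebra_simps)

lemma C1_grad_of_Ck:
  assumes "Ck 1 f"
  shows "\<exists>D. C1_grad f D \<and> (\<forall>x i. i \<in> Basis \<longrightarrow> frechet_derivative f (at x) i = D x \<bullet> i)"
proof -
  let ?f = "\<lambda>x. frechet_derivative f (at x)"
  let ?D = "\<lambda>x. \<Sum>i\<in>Basis. ?f x i *\<^sub>R i"
  have 1: "(f has_derivative ?f x) (at x)" for x
    using assms by (simp add: frechet_derivative_works)
  have 2: "continuous_on UNIV (\<lambda>x. ?f x i)" if "i \<in> Basis" for i
    using assms that by simp
  have 3: "?f x h = ?D x \<bullet> h" for x h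
  proof -
    interpret linear "?f x" using 1 has_derivative_linear by blast
    have "?f x h = ?f x (\<Sum>i\<in>Basis. (h \<bullet> i) *\<^sub>R i)" by (simp add: euclidean_representation)
    also have "\<dots> = (\<Sum>i\<in>Basis. (h \<bullet> i) * ?f x i)" by (simp add: sum scaleR)
    also have "\<dots> = ?D x \<bullet> h"
      by (simp add: inner_sum_right inner_commute[of _ h] mult.commute)
    finally show ?thesis .
  qed
  have "C1_grad f ?D"
    unfolding C1_grad_def
  proof (intro conjI allI)
    show "continuous_on UNIV ?D" using 2 by (intro continuous_intros)
    show "(f has_derivative (\<lambda>h. ?D x \<bullet> h)) (at x)" for x
    proof -
      have eq: "(\<lambda>h. ?D x \<bullet> h) = ?f x" by (rule ext) (rule 3[symmetric])
      show ?thesis unfolding eq by (rule 1)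
    qed
  qed
  with 3 show ?thesis by blast
qed

text \<open>The reflected translates \<open>\<rho> (a - y)\<close> are required as test functions
  because, in a convolution evaluated at \<open>a\<close>, the kernel depends on the integration
  variable y in this form.\<close>

lemma mollifier_exists:
  assumes "e > (0::real)"
  shows "\<exists>\<rho> D. C1_grad \<rho> D \<and> (\<forall>x::'a::euclidean_space. 0 \<le> \<rho> x) \<and> (\<forall>x. e \<le> norm x \<longrightarrow> \<rho> x = 0)
    \<and> (\<forall>a. Cc_infty (\<lambda>y. \<rho> (a - y))) \<and> integral\<^sup>L lborel \<rho> = 1"
proof -
  define b where "b = (\<lambda>x::'a. flat 0 (e\<^sup>2 - x \<bullet> x))"
  have b0: "0 \<le> b x" for x by (simp add: b_def flat_nonneg)
  have bz: "b x = 0" if "e \<le> norm x" for x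
    using that assms power_mono[of e "norm x" 2]
    by (auto simp: b_def flat_def power2_norm_eq_inner)
  have bp: "b x > 0" if "norm x < e" for x
    using that assms power_strict_mono[of "norm x" e 2]
    by (auto simp: b_def flat_def power2_norm_eq_inner)
  have bumpy0: "bumpy (e\<^sup>2) 0 b" using bumpy.base[of "e\<^sup>2" "0::'a" 0] by (simp add: b_def)
  then have "\<exists>D. C1_grad b D" using C1_grad_of_Ck bumpy_Ck by blast
  then obtain D where D: "C1_grad b D" ..
  have cont: "continuous_on UNIV b" using C1_grad_cont D .
  have bi: "b x = indicator (cball 0 e) x *\<^sub>R b x" for x
    using bz by (auto simp: indicator_def)
  have int: "integrable lborel b"
  proof -
    have "integrable lborel (\<lambda>x. indicator (cball 0 e) x *\<^sub>R b x)"
      by (intro borel_integrable_compact compact_cball continuous_on_subset[OF cont] subset_UNIV)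
    then show ?thesis using bi by (metis (no_types, lifting) ext)
  qed
  define c where "c = integral\<^sup>L lborel b"
  have "c > 0"
  proof -
    have "c \<ge> 0" unfolding c_def using b0 by (simp add: integral_nonneg_AE)
    moreover have "c \<noteq> 0"
    proof
      assume "c = 0"
      then have "AE x in lborel. b x = 0"
        using integral_nonneg_eq_0_iff_AE[OF int] b0 by (simp add: c_def)
      then have "AE x in lborel. x \<notin> ball (0::'a) e" 
        by (rule AE_mp) (auto intro!: AE_I2 dest: bp)
      then have "emeasure lborel (ball (0::'a) e) = 0"
        by (subst (asm) AE_iff_measurable[of "ball 0 e"]) auto
      then show False using emeasure_lborel_ball_finite[of "0::'a" e] content_ball_pos[OF assms, of "0::'a"]
        by (simp add: measure_def)
    qed
    ultimately show ?thesis by simp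
  qed
  define \<rho> where "\<rho> = (\<lambda>x. b x / c)"
  have "C1_grad \<rho> (\<lambda>x. (1 / c) *\<^sub>R D x)"
    using D \<open>c > 0\<close> unfolding C1_grad_def \<rho>_def
    by (auto intro!: derivative_eq_intros continuous_intros)
  moreover have "Cc_infty (\<lambda>y. \<rho> (a - y))" for a
  proof -
    have eq: "(\<lambda>y. \<rho> (a - y)) = (\<lambda>y. (1 / c) * flat 0 (e\<^sup>2 - (y - a) \<bullet> (y - a)))"
      by (auto simp: \<rho>_def b_def inner_diff_left inner_diff_right inner_commute add.commute)
    have "bumpy (e\<^sup>2) a (\<lambda>y. \<rho> (a - y))" unfolding eq by (intro bumpy.intros)
    moreover have "compact (closure {y. \<rho> (a - y) \<noteq> 0})"
    proof -
      have "{y. \<rho> (a - y) \<noteq> 0} \<subseteq> cball a e"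
        using bz by (force simp: \<rho>_def dist_norm)
      then show ?thesis
        using bounded_subset[OF bounded_cball] by (simp add: compact_closure)
    qed
    ultimately show ?thesis using bumpy_Ck by (auto simp: Cc_infty_def)
  qed
  moreover have "integral\<^sup>L lborel \<rho> = 1"
    using \<open>c > 0\<close> by (simp add: \<rho>_def flip: c_def)
  moreover have "0 \<le> \<rho> x" "e \<le> norm x \<longrightarrow> \<rho> x = 0" for x
    using b0 bz \<open>c > 0\<close> by (auto simp: \<rho>_def)
  ultimately show ?thesis by blast
qed

section \<open>Integration by parts\<close>

lemma lborel_distr_isometry:
  fixes t :: "'a::euclidean_space"
  shows "distr lborel borel (\<lambda>x. t + x) = lborel" "distr lborel borel (\<lambda>x. t - x) = lborel"
proof -
  have *: "distr lborel borel (\<lambda>x. t + c *\<^sub>R x) = lborel" if "\<bar>c\<bar> = 1" for c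
    using lborel_affine[of c t] that by (simp add: density_1)
  show "distr lborel borel (\<lambda>x. t + x) = lborel" using *[of 1] by simp
  show "distr lborel borel (\<lambda>x. t - x) = lborel" using *[of "-1"] by simp
qed

lemma lborel_integral_shift:
  fixes f :: "'a::euclidean_space \<Rightarrow> 'b::{banach, second_countable_topology}"
  assumes [measurable]: "f \<in> borel_measurable borel"
  shows "(\<integral>x. f (t + x) \<partial>lborel) = integral\<^sup>L lborel f" "(\<integral>x. f (t - x) \<partial>lborel) = integral\<^sup>L lborel f"
    "integrable lborel (\<lambda>x. f (t + x)) \<longleftrightarrow> integrable lborel f"
    "integrable lborel (\<lambda>x. f (t - x)) \<longleftrightarrow> integrable lborel f"
proof -
  show "(\<integral>x. f (t + x) \<partial>lborel) = integral\<^sup>L lborel f"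
    by (subst (2) lborel_distr_isometry(1)[of t, symmetric]) (simp add: integral_distr)
  show "(\<integral>x. f (t - x) \<partial>lborel) = integral\<^sup>L lborel f"
    by (subst (2) lborel_distr_isometry(2)[of t, symmetric]) (simp add: integral_distr)
  show "integrable lborel (\<lambda>x. f (t + x)) \<longleftrightarrow> integrable lborel f"
    by (subst (2) lborel_distr_isometry(1)[of t, symmetric]) (simp add: integrable_distr_eq)
  show "integrable lborel (\<lambda>x. f (t - x)) \<longleftrightarrow> integrable lborel f"
    by (subst (2) lborel_distr_isometry(2)[of t, symmetric]) (simp add: integrable_distr_eq)
qed

lemma lborel_nn_integral_shift:
  fixes f :: "'a::euclidean_space \<Rightarrow> ennreal"
  assumes [measurable]: "f \<in> borel_measurable borel"
  shows "(\<integral>\<^sup>+x. f (t + x) \<partial>lborel) = integral\<^sup>N lborel f" "(\<integral>\<^sup>+x. f (t - x) \<partial>lborel) = integral\<^sup>N lborel f"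
proof -
  show "(\<integral>\<^sup>+x. f (t + x) \<partial>lborel) = integral\<^sup>N lborel f"
    by (subst (2) lborel_distr_isometry(1)[of t, symmetric]) (simp add: nn_integral_distr)
  show "(\<integral>\<^sup>+x. f (t - x) \<partial>lborel) = integral\<^sup>N lborel f"
    by (subst (2) lborel_distr_isometry(2)[of t, symmetric]) (simp add: nn_integral_distr)
qed

lemma C1_gradD:
  assumes "C1_grad f D"
  shows "(f has_derivative (\<lambda>h. D x \<bullet> h)) (at x)" "continuous_on S D" "continuous_on S f"
    "f \<in> borel_measurable borel" "D \<in> borel_measurable borel"
  using assms C1_grad_cont[OF assms] unfolding C1_grad_def
  by (auto intro: borel_measurable_continuous_onI continuous_on_subset)

lemma C1_grad_support:
  assumes "C1_grad f D" and f0: "\<And>x. r < norm x \<Longrightarrow> f x = 0" and x: "r < norm x"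
  shows "D x = 0"
proof -
  have o: "open {x::'a. r < norm x}" by (intro open_Collect_less continuous_intros)
  have "(f has_derivative (\<lambda>h. 0)) (at x)"
    by (rule has_derivative_transform_within_open[OF has_derivative_const[of 0] o]) (auto simp: f0 x)
  then have "(\<lambda>h. D x \<bullet> h) = (\<lambda>h. 0)"
    using C1_gradD(1)[OF assms(1)] has_derivative_unique by blast
  then show ?thesis by (metis inner_eq_zero_iff)
qed

lemma C1_grad_Lipschitz:
  assumes "C1_grad f D" "\<And>x. norm (D x) \<le> M"
  shows "\<bar>f (x + h) - f x\<bar> \<le> M * norm h"
proof -
  have "norm (f (x + h) - f x) \<le> M * norm ((x + h) - x)"
  proof (rule differentiable_bound[of UNIV f "\<lambda>x h. D x \<bullet> h"])
    have "M \<ge> 0" using assms(2) norm_ge_zero order_trans by blast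
    then show "onorm (\<lambda>h. D y \<bullet> h) \<le> M" for y
    proof (rule onorm_bound)
      show "norm (D y \<bullet> x) \<le> M * norm x" for x
        using Cauchy_Schwarz_ineq2[of "D y" x] mult_right_mono[OF assms(2)[of y], of "norm x"] by simp
    qed
  qed (use C1_gradD(1)[OF assms(1)] in auto)
  then show ?thesis by simp
qed

lemma continuous_compact_support_bounded:
  fixes f :: "'a::euclidean_space \<Rightarrow> 'b::real_normed_vector"
  assumes "continuous_on UNIV f" "\<And>x. r < norm x \<Longrightarrow> f x = 0"
  obtains M where "M > 0" "\<And>x. norm (f x) \<le> M"
proof -
  have "bounded (f ` cball 0 r)"
    using assms(1) by (intro compact_imp_bounded compact_continuous_image)
      (auto intro: continuous_on_subset)
  then obtain M where M: "M > 0" "\<And>x. x \<in> cball 0 r \<Longrightarrow> norm (f x) \<le> M"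
    unfolding bounded_pos by auto
  have "norm (f x) \<le> M" for x
    using M assms(2)[of x] by (cases "norm x \<le> r") auto
  with M that show ?thesis by blast
qed

lemma integrable_continuous_compact_support:
  fixes f :: "'a::euclidean_space \<Rightarrow> 'b::{banach, second_countable_topology}"
  assumes "continuous_on UNIV f" "\<And>x. r < norm x \<Longrightarrow> f x = 0"
  shows "integrable lborel f"
proof -
  have "integrable lborel (\<lambda>x. indicator (cball 0 r) x *\<^sub>R f x)"
    by (intro borel_integrable_compact compact_cball continuous_on_subset[OF assms(1)] subset_UNIV)
  moreover have "indicator (cball 0 r) x *\<^sub>R f x = f x" for x
    using assms(2)[of x] by (auto simp: indicator_def)
  ultimately show ?thesis by simp
qed

lemma C1_grad_path_deriv:
  assumes "C1_grad f D"
  shows "((\<lambda>s. f (x + s *\<^sub>R z)) has_real_derivative D (x + s *\<^sub>R z) \<bullet> z) (at s)"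
  unfolding has_field_derivative_def
  by (rule has_derivative_eq_rhs, rule has_derivative_compose[of "\<lambda>s. x + s *\<^sub>R z"])
    (auto intro!: derivative_eq_intros C1_gradD(1)[OF assms])

text \<open>By translation invariance every difference quotient of f has integral zero. The
  quotients are bounded by the Lipschitz constant and live in a common ball, so dominated
  convergence passes this to the derivative.\<close>

lemma C1_compact_integral_grad_eq_0:
  fixes f :: "'a::euclidean_space \<Rightarrow> real"
  assumes f: "C1_grad f D" and f0: "\<And>x. r < norm x \<Longrightarrow> f x = 0"
  shows "(\<integral>x. D x \<bullet> i \<partial>lborel) = 0"
proof -
  note D0 = C1_grad_support[OF f f0]
  note [measurable] = C1_gradD(4,5)[OF f]
  obtain M where M: "M > 0" "\<And>x. norm (D x) \<le> M"
    using continuous_compact_support_bounded[of D r] C1_gradD(2)[OF f] D0 by metis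
  \<comment> \<open>Step sizes of at most 1 keep the supports of all shifted functions inside the
    ball of radius \<open>r + norm i\<close>.\<close>
  define t where "t = (\<lambda>n. 1 / real (Suc n))"
  have t: "0 < t n" "t n \<le> 1" for n by (auto simp: t_def)
  have lim: "(\<lambda>n. \<integral>x. (f (x + t n *\<^sub>R i) - f x) / t n \<partial>lborel) \<longlonglongrightarrow> (\<integral>x. D x \<bullet> i \<partial>lborel)"
  proof (rule integral_dominated_convergence)
    show "integrable lborel (\<lambda>x. indicator (cball (0::'a) (r + norm i)) x * (M * norm i))"
      using emeasure_lborel_cball_finite by (intro integrable_mult_left integrable_real_indicator) auto
    show "AE x in lborel. (\<lambda>n. (f (x + t n *\<^sub>R i) - f x) / t n) \<longlonglongrightarrow> D x \<bullet> i"
    proof (rule AE_I2)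
      fix x
      have "((\<lambda>s. f (x + s *\<^sub>R i)) has_real_derivative (D x \<bullet> i)) (at 0)"
        using C1_grad_path_deriv[OF f, of x i 0] by simp
      then have "((\<lambda>s. (f (x + s *\<^sub>R i) - f x) / s) \<longlongrightarrow> D x \<bullet> i) (at 0)"
        by (simp add: DERIV_def)
      moreover have "filterlim t (at 0) sequentially"
        using t LIMSEQ_inverse_real_of_nat
        by (auto simp: filterlim_at t_def inverse_eq_divide less_imp_neq intro!: always_eventually)
      ultimately show "(\<lambda>n. (f (x + t n *\<^sub>R i) - f x) / t n) \<longlonglongrightarrow> D x \<bullet> i"
        by (rule filterlim_compose)
    qed
    show "AE x in lborel. norm ((f (x + t n *\<^sub>R i) - f x) / t n)
        \<le> indicator (cball (0::'a) (r + norm i)) x * (M * norm i)" for n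
    proof (rule AE_I2)
      fix x
      have "\<bar>f (x + t n *\<^sub>R i) - f x\<bar> \<le> M * (t n * norm i)"
        using C1_grad_Lipschitz[OF f M(2), of x "t n *\<^sub>R i"] t(1)[of n] by simp
      moreover have "f (x + t n *\<^sub>R i) = 0" "f x = 0" if "r + norm i < norm x"
      proof -
        have "norm x \<le> norm (x + t n *\<^sub>R i) + norm (t n *\<^sub>R i)" 
          using norm_triangle_ineq4[of "x + t n *\<^sub>R i" "t n *\<^sub>R i"] by simp
        moreover have "norm (t n *\<^sub>R i) \<le> norm i"
          using t[of n] by (simp add: mult_left_le_one_le)
        ultimately show "f (x + t n *\<^sub>R i) = 0" using that by (intro f0) linarith
        show "f x = 0" using that by (intro f0) (smt (verit) norm_ge_zero)
      qed
      ultimately show "norm ((f (x + t n *\<^sub>R i) - f x) / t n) \<le> indicator (cball 0 (r + norm i)) x * (M * norm i)"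
        using t(1)[of n] by (auto simp: indicator_def field_simps)
    qed
  qed simp_all
  have z: "(\<integral>x. (f (x + t n *\<^sub>R i) - f x) / t n \<partial>lborel) = 0" for n
  proof -
    have fi: "integrable lborel f"
      using integrable_continuous_compact_support C1_gradD(3)[OF f] f0 by blast
    then have "integrable lborel (\<lambda>x. f (t n *\<^sub>R i + x))"
      by (simp add: lborel_integral_shift)
    with fi show ?thesis
      by (simp add: add.commute[of _ "t n *\<^sub>R i"] lborel_integral_shift)
  qed
  show ?thesis using lim unfolding z by (simp add: LIMSEQ_const_iff)
qed

lemma borel_measurable_imp_lebesgue: "f \<in> borel_measurable borel \<Longrightarrow> f \<in> borel_measurable lebesgue"
  by (simp add: measurable_completion)

lemma L_loc_continuous:
  fixes f :: "'a::euclidean_space \<Rightarrow> 'b::euclidean_space"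
  assumes "continuous_on UNIV f" "p > 0"
  shows "L_loc p f"
  unfolding L_loc_def
proof (intro conjI allI impI)
  show m: "f \<in> borel_measurable lebesgue"
    using assms(1) borel_measurable_continuous_onI borel_measurable_imp_lebesgue by blast
  fix K :: "'a set" assume K: "compact K"
  have "integrable lborel (\<lambda>x. indicator K x *\<^sub>R (norm (f x) powr p))"
    using assms(2) by (intro borel_integrable_compact K continuous_on_powr' continuous_on_norm
        continuous_on_subset[OF assms(1)] continuous_on_const) auto
  then show "set_integrable lebesgue K (\<lambda>x. norm (f x) powr p)"
    unfolding set_integrable_def
    by (subst integrable_completion) (auto dest: borel_measurable_integrable)
qed

lemma Cc_inftyD:
  fixes f :: "'a::euclidean_space \<Rightarrow> real"
  assumes "Cc_infty f"
  obtains D r where "C1_grad f D" "\<And>x i. i \<in> Basis \<Longrightarrow> frechet_derivative f (at x) i = D x \<bullet> i"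
    "\<And>x. r < norm x \<Longrightarrow> f x = 0" "r > 0"
proof -
  from assms obtain D where D: "C1_grad f D"
    "\<forall>x i. i \<in> Basis \<longrightarrow> frechet_derivative f (at x) i = D x \<bullet> i"
    unfolding Cc_infty_def using C1_grad_of_Ck by blast
  have "bounded (closure {x. f x \<noteq> 0})" using assms by (simp add: Cc_infty_def compact_imp_bounded)
  then obtain r where r: "r > 0" "\<And>x. f x \<noteq> 0 \<Longrightarrow> norm x \<le> r"
    unfolding bounded_pos using closure_subset[of "{x. f x \<noteq> 0}"] by auto
  have "f x = 0" if "r < norm x" for x using r(2)[of x] that by fastforce
  then show ?thesis 
    using D(2) by (intro that[OF D(1) _ _ r(1)]) auto
qed

text \<open>The product with a test function has bounded support, so its gradient integrates to
  zero; the product rule then is the integration by parts. This is what makes C1 functions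
  admissible as multipliers in the weak equation.\<close>

lemma C1_grad_has_weak_gradient:
  assumes f: "C1_grad f D"
  shows "has_weak_gradient f D"
  unfolding has_weak_gradient_def
proof (intro conjI allI impI ballI)
  show "L_loc 1 f" "L_loc 1 D" using C1_gradD[OF f] by (auto intro!: L_loc_continuous)
  fix \<phi> :: "'a \<Rightarrow> real" and i :: 'a
  assume \<phi>: "Cc_infty \<phi>" and i: "i \<in> Basis"
  obtain E r where E: "C1_grad \<phi> E" "\<And>x i. i \<in> Basis \<Longrightarrow> frechet_derivative \<phi> (at x) i = E x \<bullet> i"
    "\<And>x. r < norm x \<Longrightarrow> \<phi> x = 0" using Cc_inftyD[OF \<phi>] by metis
  note E0 = C1_grad_support[OF E(1,3)]
  note [measurable] = C1_gradD(4,5)[OF f] C1_gradD(4,5)[OF E(1)]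
  have int: "integrable lborel (\<lambda>x. f x * (E x \<bullet> i))" "integrable lborel (\<lambda>x. D x \<bullet> i * \<phi> x)"
    using C1_gradD(2,3)[OF f] C1_gradD(2,3)[OF E(1)] E0 E(3)
    by (auto intro!: integrable_continuous_compact_support[of _ r] continuous_intros)
  have "0 = (\<integral>x. (f x *\<^sub>R E x + \<phi> x *\<^sub>R D x) \<bullet> i \<partial>lborel)"
    by (rule C1_compact_integral_grad_eq_0[OF C1_grad_mult[OF f E(1)], of r, symmetric]) (simp add: E(3))
  also have "\<dots> = (\<integral>x. f x * (E x \<bullet> i) + D x \<bullet> i * \<phi> x \<partial>lborel)"
    by (simp add: inner_add_left mult.commute)
  also have "\<dots> = (\<integral>x. f x * (E x \<bullet> i) \<partial>lborel) + (\<integral>x. D x \<bullet> i * \<phi> x \<partial>lborel)"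
    using int by simp
  finally show "(LINT x|lebesgue. f x * frechet_derivative \<phi> (at x) i) =
      - (LINT x|lebesgue. (D x \<bullet> i) * \<phi> x)"
    using i by (simp add: E(2) integral_completion)
qed

section \<open>Approximation in \<open>L\<^sup>p\<close>\<close>

lemma powr_add_le:
  fixes a b p :: real
  assumes "0 \<le> a" "0 \<le> b" "0 < p"
  shows "(a + b) powr p \<le> 2 powr p * (a powr p + b powr p)"
proof -
  have "(a + b) powr p \<le> (2 * max a b) powr p"
    using assms by (intro powr_mono2) auto
  also have "\<dots> = 2 powr p * (max a b) powr p" using assms by (simp add: powr_mult)
  also have "\<dots> \<le> 2 powr p * (a powr p + b powr p)"
    by (intro mult_left_mono) (auto simp: max_def)
  finally show ?thesis .
qed

lemma norm_diff_powr_le: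
  fixes x y z :: "'a::real_normed_vector"
  assumes "0 < p"
  shows "norm (x - z) powr p \<le> 2 powr p * (norm (x - y) powr p + norm (y - z) powr p)"
proof -
  have "norm (x - z) powr p \<le> (norm (x - y) + norm (y - z)) powr p"
    using assms norm_triangle_ineq[of "x - y" "y - z"] by (intro powr_mono2) auto
  also have "\<dots> \<le> 2 powr p * (norm (x - y) powr p + norm (y - z) powr p)"
    using assms by (intro powr_add_le) auto
  finally show ?thesis .
qed

text \<open>Stated with weights \<open>\<theta>\<close> and \<open>1 - \<theta>\<close> on two
  integrable functions, which fits interpolation directly. Young's inequality is applied after
  dividing by the two integrals; if one integral is zero, the product vanishes almost
  everywhere.\<close>

lemma Holder_powr:
  fixes f g :: "'a \<Rightarrow> real"
  assumes f: "integrable M f" "\<And>x. 0 \<le> f x" and g: "integrable M g" "\<And>x. 0 \<le> g x"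
    and \<theta>: "0 < \<theta>" "\<theta> < 1"
  shows "integrable M (\<lambda>x. f x powr \<theta> * g x powr (1 - \<theta>))"
    and "(\<integral>x. f x powr \<theta> * g x powr (1 - \<theta>) \<partial>M) \<le> (\<integral>x. f x \<partial>M) powr \<theta> * (\<integral>x. g x \<partial>M) powr (1 - \<theta>)"
proof -
  have young: "a powr \<theta> * b powr (1 - \<theta>) \<le> \<theta> * a + (1 - \<theta>) * b" if "a \<ge> 0" "b \<ge> 0" for a b :: real
    using Youngs_inequality_0[of \<theta> "1 - \<theta>" a b] that \<theta> by (cases "a = 0 \<or> b = 0") auto
  have [measurable]: "f \<in> borel_measurable M" "g \<in> borel_measurable M" using f g by auto
  show int: "integrable M (\<lambda>x. f x powr \<theta> * g x powr (1 - \<theta>))"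
  proof (rule Bochner_Integration.integrable_bound)
    show "integrable M (\<lambda>x. \<theta> * f x + (1 - \<theta>) * g x)" using f g by auto
    show "AE x in M. norm (f x powr \<theta> * g x powr (1 - \<theta>)) \<le> norm (\<theta> * f x + (1 - \<theta>) * g x)"
      using young f g \<theta> by (intro AE_I2) simp
  qed simp
  define I J where "I = (\<integral>x. f x \<partial>M)" and "J = (\<integral>x. g x \<partial>M)"
  show "(\<integral>x. f x powr \<theta> * g x powr (1 - \<theta>) \<partial>M) \<le> (\<integral>x. f x \<partial>M) powr \<theta> * (\<integral>x. g x \<partial>M) powr (1 - \<theta>)"
  proof (cases "I = 0 \<or> J = 0")
    case True
    then have "AE x in M. f x powr \<theta> * g x powr (1 - \<theta>) = 0"
    proof
      assume "I = 0"
      then have "AE x in M. f x = 0" using integral_nonneg_eq_0_iff_AE[of M f] f by (simp add: I_def)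
      then show ?thesis by eventually_elim simp
    next
      assume "J = 0"
      then have "AE x in M. g x = 0" using integral_nonneg_eq_0_iff_AE[of M g] g by (simp add: J_def)
      then show ?thesis by eventually_elim simp
    qed
    then have "(\<integral>x. f x powr \<theta> * g x powr (1 - \<theta>) \<partial>M) = 0" by (rule integral_eq_zero_AE)
    then show ?thesis by simp
  next
    case False
    then have pos: "I > 0" "J > 0"
      using f g by (auto simp: I_def J_def less_le intro!: integral_nonneg)
    have "(\<integral>x. f x powr \<theta> * g x powr (1 - \<theta>) \<partial>M)
       \<le> (\<integral>x. (I powr \<theta> * J powr (1 - \<theta>)) * (\<theta> * (f x / I) + (1 - \<theta>) * (g x / J)) \<partial>M)"
    proof (rule integral_mono[OF int])
      show "integrable M (\<lambda>x. I powr \<theta> * J powr (1 - \<theta>) * (\<theta> * (f x / I) + (1 - \<theta>) * (g x / J)))"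
        using f g by auto
      fix x
      have "f x powr \<theta> * g x powr (1 - \<theta>)
        = (I powr \<theta> * J powr (1 - \<theta>)) * ((f x / I) powr \<theta> * (g x / J) powr (1 - \<theta>))"
        using pos f g by (simp add: powr_divide)
      also have "\<dots> \<le> (I powr \<theta> * J powr (1 - \<theta>)) * (\<theta> * (f x / I) + (1 - \<theta>) * (g x / J))"
        using pos f g by (intro mult_left_mono young) auto
      finally show "f x powr \<theta> * g x powr (1 - \<theta>)
        \<le> (I powr \<theta> * J powr (1 - \<theta>)) * (\<theta> * (f x / I) + (1 - \<theta>) * (g x / J))" .
    qed
    also have "\<dots> = (I powr \<theta> * J powr (1 - \<theta>)) * (\<theta> * (I / I) + (1 - \<theta>) * (J / J))"
      using f g by (simp add: I_def J_def)
    also have "\<dots> = I powr \<theta> * J powr (1 - \<theta>)" using pos by simp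
    finally show ?thesis by (simp add: I_def J_def)
  qed
qed

text \<open>Translations and Tonelli's theorem are carried out for Borel functions, so a Lebesgue
  measurable gradient is first replaced, coordinate by coordinate, by a Borel version.\<close>

lemma lebesgue_ex_borel:
  fixes f :: "'a::euclidean_space \<Rightarrow> 'b::euclidean_space"
  assumes "f \<in> borel_measurable lebesgue"
  obtains g where "g \<in> borel_measurable borel" "AE x in lebesgue. f x = g x"
proof -
  have "\<exists>g\<in>borel_measurable lborel. AE x in lborel. f x \<bullet> i = g x" for i
    using assms by (intro completion_ex_borel_measurable_real) auto
  then obtain g where g: "\<And>i. g i \<in> borel_measurable lborel" "\<And>i. AE x in lborel. f x \<bullet> i = g i x"
    by metis
  have "AE x in lborel. \<forall>i\<in>Basis. f x \<bullet> i = g i x"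
    using g(2) by (intro AE_finite_allI) auto
  then have "AE x in lborel. f x = (\<Sum>i\<in>Basis. g i x *\<^sub>R i)"
  proof eventually_elim
    fix x assume *: "\<forall>i\<in>Basis. f x \<bullet> i = g i x"
    have "f x = (\<Sum>i\<in>Basis. (f x \<bullet> i) *\<^sub>R i)" by (simp add: euclidean_representation)
    also have "\<dots> = (\<Sum>i\<in>Basis. g i x *\<^sub>R i)" using * by (intro sum.cong) auto
    finally show "f x = (\<Sum>i\<in>Basis. g i x *\<^sub>R i)" .
  qed
  then have "AE x in lebesgue. f x = (\<Sum>i\<in>Basis. g i x *\<^sub>R i)"
    by (rule AE_completion)
  moreover have "(\<lambda>x. \<Sum>i\<in>Basis. g i x *\<^sub>R i) \<in> borel_measurable borel"
    using g(1) by auto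
  ultimately show ?thesis using that by blast
qed

section \<open>Density of continuous functions and continuity of translations in L^p\<close>

text \<open>The nearest-point retraction onto the ball of radius \<open>M\<close> (for
  \<open>M > 0\<close>): a truncation that is continuous and therefore preserves continuity of
  approximants.\<close>

definition radial_clamp :: "real \<Rightarrow> 'a::real_normed_vector \<Rightarrow> 'a" where
  "radial_clamp M y = (M / max M (norm y)) *\<^sub>R y"

lemma radial_clamp:
  assumes "M > 0"
  shows "norm (radial_clamp M y) \<le> M" "norm (radial_clamp M y - y) \<le> norm y"
    "norm y \<le> M \<Longrightarrow> radial_clamp M y = y" "continuous_on S (radial_clamp M)"
proof -
  show "norm (radial_clamp M y) \<le> M" using assms by (auto simp: radial_clamp_def max_def field_simps)
  show "norm y \<le> M \<Longrightarrow> radial_clamp M y = y" using assms by (auto simp: radial_clamp_def max_def)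
  have "radial_clamp M y - y = - ((1 - M / max M (norm y)) *\<^sub>R y)"
    by (simp add: radial_clamp_def algebra_simps)
  moreover have "0 \<le> M / max M (norm y)" "M / max M (norm y) \<le> 1" using assms by auto
  then have "\<bar>1 - M / max M (norm y)\<bar> \<le> 1" by linarith
  ultimately show "norm (radial_clamp M y - y) \<le> norm y"
    by (simp add: mult_left_le_one_le)
  show "continuous_on S (radial_clamp M)"
    unfolding radial_clamp_def using assms by (auto intro!: continuous_intros)
qed

text \<open>Two applications of dominated convergence: truncating G at a high level changes little,
  and the truncated function is an almost everywhere limit of continuous functions with the same
  bound.\<close>

lemma Lp_continuous_approx:
  fixes G :: "'a::euclidean_space \<Rightarrow> 'b::euclidean_space"
  assumes [measurable]: "G \<in> borel_measurable borel" and p: "p > 0"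
    and int: "integrable lborel (\<lambda>x. indicator (cball 0 r) x * norm (G x) powr p)" and "\<epsilon> > 0"
  obtains c where "continuous_on UNIV c"
    "integrable lborel (\<lambda>x. indicator (cball 0 r) x * norm (G x - c x) powr p)"
    "(\<integral>x. indicator (cball 0 r) x * norm (G x - c x) powr p \<partial>lborel) < \<epsilon>"
proof -
  let ?I = "indicator (cball (0::'a) r) :: 'a \<Rightarrow> real"
  have [measurable]: "cball (0::'a) r \<in> sets borel" by simp
  have rc: "radial_clamp M \<in> borel_measurable borel" if "M > 0" for M
    using radial_clamp(4)[OF that, of UNIV] borel_measurable_continuous_onI by blast
  define d where "d = (\<lambda>M c x. ?I x * norm (radial_clamp (real (Suc M)) (G x) - c x) powr p)"
  have "(\<lambda>M. \<integral>x. d M G x \<partial>lborel) \<longlonglongrightarrow> (\<integral>x. 0 \<partial>(lborel::'a measure))"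
  proof (rule integral_dominated_convergence)
    show "integrable lborel (\<lambda>x. ?I x * norm (G x) powr p)" by (rule int)
    show "AE x in lborel. (\<lambda>M. d M G x) \<longlonglongrightarrow> 0"
    proof (rule AE_I2)
      fix x
      obtain M0 :: nat where M0: "norm (G x) \<le> real M0" using real_arch_simple by blast
      have "eventually (\<lambda>M. d M G x = 0) sequentially"
        using eventually_ge_at_top[of M0]
        by eventually_elim (use M0 in \<open>simp add: d_def radial_clamp(3)\<close>)
      then show "(\<lambda>M. d M G x) \<longlonglongrightarrow> 0" by (simp add: tendsto_eventually)
    qed
    show "AE x in lborel. norm (d M G x) \<le> ?I x * norm (G x) powr p" for M
      using p by (auto simp: d_def indicator_def intro!: powr_mono2 radial_clamp)
    fix M
    have [measurable]: "radial_clamp (real (Suc M)) \<in> borel_measurable borel" by (rule rc) simp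
    show "d M G \<in> borel_measurable lborel" unfolding d_def by measurable
  qed simp
  moreover have "0 < \<epsilon> / (2 * 2 powr p)" using \<open>\<epsilon> > 0\<close> by simp
  ultimately have "eventually (\<lambda>M. (\<integral>x. d M G x \<partial>lborel) < \<epsilon> / (2 * 2 powr p)) sequentially"
    by (simp add: order_tendstoD)
  then obtain M where M: "(\<integral>x. d M G x \<partial>lborel) < \<epsilon> / (2 * 2 powr p)"
    by (auto simp: eventually_sequentially)
  have "G measurable_on UNIV"
    by (intro lebesgue_measurable_imp_measurable_on borel_measurable_imp_lebesgue) auto
  then obtain N g where N: "negligible N" and g: "\<And>n. continuous_on UNIV (g n)"
    and lim: "\<And>x. x \<notin> N \<Longrightarrow> (\<lambda>n. g n x) \<longlonglongrightarrow> G x"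
    unfolding measurable_on_def by auto
  define R where "R = real (Suc M)"
  have "R > 0" by (simp add: R_def)
  \<comment> \<open>The continuous functions \<open>g n\<close> converge only pointwise. Clamping
    them at the level used for G keeps the limit and supplies the constant majorant
    \<open>(2 * R) powr p\<close>.\<close>
  define c where "c = (\<lambda>n x. radial_clamp R (g n x))"
  have cc: "continuous_on UNIV (c n)" for n
    unfolding c_def using continuous_on_compose2[OF radial_clamp(4)[OF \<open>R > 0\<close>, of UNIV] g] by simp
  then have [measurable]: "c n \<in> borel_measurable borel" for n
    using borel_measurable_continuous_onI by blast
  have Ii: "integrable lborel ?I"
    using emeasure_lborel_cball_finite by (intro integrable_real_indicator) auto
  have dle: "norm (d M (c n) x) \<le> ?I x * (2 * R) powr p" for n x
  proof -
    have "norm (radial_clamp R (G x) - c n x) \<le> norm (radial_clamp R (G x)) + norm (c n x)"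
      by (rule norm_triangle_ineq4)
    also have "\<dots> \<le> 2 * R"
      unfolding c_def using radial_clamp(1)[OF \<open>R > 0\<close>, of "G x"] radial_clamp(1)[OF \<open>R > 0\<close>, of "g n x"] by linarith
    finally show ?thesis
      using p unfolding d_def R_def[symmetric] by (auto simp: indicator_def intro!: powr_mono2)
  qed
  note [measurable] = rc[OF \<open>R > 0\<close>]
  have dm[measurable]: "d M (c n) \<in> borel_measurable borel" for n
    unfolding d_def R_def[symmetric] by measurable
  have "(\<lambda>n. \<integral>x. d M (c n) x \<partial>lebesgue) \<longlonglongrightarrow> (\<integral>x. 0 \<partial>(lebesgue::'a measure))"
  proof (rule integral_dominated_convergence)
    show "integrable lebesgue (\<lambda>x. ?I x * (2 * R) powr p)"
      using Ii by (simp add: integrable_completion)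
    have "AE x in lebesgue. x \<notin> N"
      using N by (simp add: negligible_iff_null_sets AE_not_in)
    then show "AE x in lebesgue. (\<lambda>n. d M (c n) x) \<longlonglongrightarrow> 0"
    proof eventually_elim
      fix x assume "x \<notin> N"
      have "isCont (radial_clamp R) (G x)"
        using radial_clamp(4)[OF \<open>R > 0\<close>, of "UNIV :: 'b set"] by (simp add: continuous_on_eq_continuous_at)
      then have "(\<lambda>n. c n x) \<longlonglongrightarrow> radial_clamp R (G x)"
        unfolding c_def using lim[OF \<open>x \<notin> N\<close>] by (rule isCont_tendsto_compose)
      then have "(\<lambda>n. norm (radial_clamp R (G x) - c n x) powr p) \<longlonglongrightarrow> norm (radial_clamp R (G x) - radial_clamp R (G x)) powr p"
        using p by (intro tendsto_powr' tendsto_intros) auto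
      then show "(\<lambda>n. d M (c n) x) \<longlonglongrightarrow> 0"
        using p unfolding d_def R_def[symmetric] by (auto intro: tendsto_mult_right_zero)
    qed
    show "AE x in lebesgue. norm (d M (c n) x) \<le> ?I x * (2 * R) powr p" for n
      using dle by simp
  qed (simp_all add: borel_measurable_imp_lebesgue[OF dm])
  moreover have "(\<integral>x. d M (c n) x \<partial>lebesgue) = (\<integral>x. d M (c n) x \<partial>lborel)" for n
    by (simp add: integral_completion)
  moreover have "0 < \<epsilon> / (2 * 2 powr p)" using \<open>\<epsilon> > 0\<close> by simp
  ultimately have "eventually (\<lambda>n. (\<integral>x. d M (c n) x \<partial>lborel) < \<epsilon> / (2 * 2 powr p)) sequentially"
    by (simp add: order_tendstoD)
  then obtain n where n: "(\<integral>x. d M (c n) x \<partial>lborel) < \<epsilon> / (2 * 2 powr p)"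
    by (auto simp: eventually_sequentially)
  have dG: "integrable lborel (d M G)"
    using p unfolding d_def R_def[symmetric]
    by (intro Bochner_Integration.integrable_bound[OF int])
       (auto simp: indicator_def \<open>R > 0\<close> intro!: powr_mono2 radial_clamp)
  have dc: "integrable lborel (d M (c n))"
  proof (rule Bochner_Integration.integrable_bound)
    show "integrable lborel (\<lambda>x. ?I x * (2 * R) powr p)" using Ii by simp
    have "norm (d M (c n) x) \<le> norm (?I x * (2 * R) powr p)" for x
      using dle[of n x] by simp
    then show "AE x in lborel. norm (d M (c n) x) \<le> norm (?I x * (2 * R) powr p)" by simp
  qed simp
  have le: "?I x * norm (G x - c n x) powr p \<le> 2 powr p * (d M G x + d M (c n) x)" for x
    using norm_diff_powr_le[OF p, of "G x" "c n x" "radial_clamp R (G x)"]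
    unfolding d_def R_def[symmetric] by (auto simp: indicator_def norm_minus_commute)
  have i: "integrable lborel (\<lambda>x. ?I x * norm (G x - c n x) powr p)"
  proof (rule Bochner_Integration.integrable_bound)
    show "integrable lborel (\<lambda>x. 2 powr p * (d M G x + d M (c n) x))" using dG dc by simp
    show "AE x in lborel. norm (?I x * norm (G x - c n x) powr p) \<le> norm (2 powr p * (d M G x + d M (c n) x))"
    proof (rule AE_I2)
      fix x
      have "norm (?I x * norm (G x - c n x) powr p) = ?I x * norm (G x - c n x) powr p" by simp
      also note le[of x]
      also have "2 powr p * (d M G x + d M (c n) x) \<le> norm (2 powr p * (d M G x + d M (c n) x))"
        by (metis abs_ge_self real_norm_def)
      finally show "norm (?I x * norm (G x - c n x) powr p) \<le> norm (2 powr p * (d M G x + d M (c n) x))" .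
    qed
  qed measurable
  have "(\<integral>x. ?I x * norm (G x - c n x) powr p \<partial>lborel) \<le> (\<integral>x. 2 powr p * (d M G x + d M (c n) x) \<partial>lborel)"
    using dG dc le by (intro integral_mono[OF i]) auto
  also have "\<dots> = 2 powr p * ((\<integral>x. d M G x \<partial>lborel) + (\<integral>x. d M (c n) x \<partial>lborel))"
    using dG dc by simp
  also have "\<dots> < 2 powr p * (\<epsilon> / (2 * 2 powr p) + \<epsilon> / (2 * 2 powr p))"
    using M n by (intro mult_strict_left_mono add_strict_mono) auto
  also have "\<dots> = \<epsilon>" by (simp add: field_simps)
  finally show ?thesis using that cc i by blast
qed

text \<open>A continuous approximant is uniformly continuous on a ball, and its distance to G is
  unaffected by translation. The radius \<open>r + 1\<close> in the hypothesis accommodates shifts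
  of length below 1.\<close>

lemma Lp_translation_continuous:
  fixes G :: "'a::euclidean_space \<Rightarrow> 'b::euclidean_space"
  assumes G[measurable]: "G \<in> borel_measurable borel" and p: "p > 0"
    and int: "integrable lborel (\<lambda>x. indicator (cball 0 (r + 1)) x * norm (G x) powr p)"
    and "\<epsilon> > 0"
  obtains \<delta> where "\<delta> > 0" "\<delta> \<le> 1"
    "\<And>z. norm z < \<delta> \<Longrightarrow> (\<integral>\<^sup>+x. ennreal (indicator (cball 0 r) x * norm (G (x - z) - G x) powr p) \<partial>lborel) \<le> ennreal \<epsilon>"
proof -
  let ?I = "\<lambda>r x. indicator (cball (0::'a) r) x :: real"
  have [measurable]: "cball (0::'a) r \<in> sets borel" for r by simp
  \<comment> \<open>The two-term power inequality is used twice on the chain G(x-z), c(x-z), c(x),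
    G(x), giving \<open>2 powr p * 2 powr p\<close>.\<close>
  define C where "C = 4 powr p"
  have "C > 0" by (simp add: C_def)
  obtain c where c: "continuous_on UNIV c"
    "integrable lborel (\<lambda>x. ?I (r + 1) x * norm (G x - c x) powr p)"
    "(\<integral>x. ?I (r + 1) x * norm (G x - c x) powr p \<partial>lborel) < \<epsilon> / (3 * C)"
    using Lp_continuous_approx[OF G p int, of "\<epsilon> / (3 * C)"] \<open>\<epsilon> > 0\<close> \<open>C > 0\<close> by (auto simp: divide_simps)
  have cm[measurable]: "c \<in> borel_measurable borel" using c(1) borel_measurable_continuous_onI by blast
  define V where "V = measure lborel (cball (0::'a) r)"
  have "V \<ge> 0" by (simp add: V_def)
  \<comment> \<open>Chosen so that the error of c contributes at most a third of
    \<open>\<epsilon>\<close>; \<open>V + 1\<close> replaces \<open>V\<close> because the ball may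
    have measure zero.\<close>
  define \<eta> where "\<eta> = (\<epsilon> / (3 * C * (V + 1))) powr (1 / p)"
  have "\<eta> > 0" using \<open>\<epsilon> > 0\<close> \<open>C > 0\<close> \<open>V \<ge> 0\<close> by (auto simp: \<eta>_def)
  have \<eta>p: "\<eta> powr p = \<epsilon> / (3 * C * (V + 1))"
    using p \<open>\<epsilon> > 0\<close> \<open>C > 0\<close> \<open>V \<ge> 0\<close> by (simp add: \<eta>_def powr_powr)
  have "uniformly_continuous_on (cball 0 (r + 1)) c"
    using c(1) by (intro compact_uniformly_continuous) (auto intro: continuous_on_subset)
  then obtain \<delta> where \<delta>: "\<delta> > 0" "\<And>x y. x \<in> cball 0 (r + 1) \<Longrightarrow> y \<in> cball 0 (r + 1) \<Longrightarrow> dist y x < \<delta> \<Longrightarrow> dist (c y) (c x) < \<eta>"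
    unfolding uniformly_continuous_on_def using \<open>\<eta> > 0\<close> by metis
  have main: "(\<integral>\<^sup>+x. ennreal (?I r x * norm (G (x - z) - G x) powr p) \<partial>lborel) \<le> ennreal \<epsilon>"
    if z: "norm z < min \<delta> 1" for z
  proof -
    define f where "f = (\<lambda>x. ?I (r + 1) x * norm (G x - c x) powr p)"
    have f0: "f x \<ge> 0" for x by (simp add: f_def)
    have fm[measurable]: "f \<in> borel_measurable borel" unfolding f_def by measurable
    have fint: "(\<integral>\<^sup>+x. ennreal (f x) \<partial>lborel) \<le> ennreal (\<epsilon> / (3 * C))"
      using c(2,3) f0 by (subst nn_integral_eq_integral) (auto simp: f_def intro!: ennreal_leI)
    have le: "?I r x * norm (G (x - z) - G x) powr p \<le> C * (f (x - z) + ?I r x * \<eta> powr p + f x)" for x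
    proof (cases "x \<in> cball 0 r")
      case True
      have xz: "x - z \<in> cball 0 (r + 1)" "x \<in> cball 0 (r + 1)"
        using True z norm_triangle_ineq4[of x z] by auto
      have "dist (c (x - z)) (c x) < \<eta>" using xz z by (intro \<delta>) (auto simp: dist_norm)
      then have cc: "norm (c (x - z) - c x) powr p \<le> \<eta> powr p"
        using p by (intro powr_mono2) (auto simp: dist_norm)
      have "norm (G (x - z) - G x) powr p
        \<le> 2 powr p * (norm (G (x - z) - c (x - z)) powr p + norm (c (x - z) - G x) powr p)"
        using p by (rule norm_diff_powr_le)
      also have "\<dots> \<le> 2 powr p * (norm (G (x - z) - c (x - z)) powr p
          + 2 powr p * (norm (c (x - z) - c x) powr p + norm (c x - G x) powr p))"
        using p by (intro mult_left_mono add_left_mono norm_diff_powr_le) auto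
      also have "\<dots> \<le> 2 powr p * (2 powr p * norm (G (x - z) - c (x - z)) powr p
          + 2 powr p * (\<eta> powr p + norm (c x - G x) powr p))"
      proof -
        have "1 \<le> 2 powr p" using p by (simp add: ge_one_powr_ge_zero)
        from mult_right_mono[OF this, of "norm (G (x - z) - c (x - z)) powr p"]
        show ?thesis using cc by (intro mult_left_mono add_mono mult_left_mono) simp_all
      qed
      also have "\<dots> = C * (norm (G (x - z) - c (x - z)) powr p + \<eta> powr p + norm (c x - G x) powr p)"
        using powr_mult[of 2 2 p] by (simp add: C_def algebra_simps)
      finally show ?thesis using True xz by (simp add: f_def norm_minus_commute)
    next
      case False then show ?thesis using f0 \<open>C > 0\<close> by simp
    qed
    have "(\<integral>\<^sup>+x. ennreal (?I r x * norm (G (x - z) - G x) powr p) \<partial>lborel)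
      \<le> (\<integral>\<^sup>+x. ennreal C * (ennreal (f (x - z)) + ennreal (\<eta> powr p) * indicator (cball 0 r) x + ennreal (f x)) \<partial>lborel)"
    proof (rule nn_integral_mono)
      fix x
      have "ennreal (?I r x * norm (G (x - z) - G x) powr p) \<le> ennreal (C * (f (x - z) + ?I r x * \<eta> powr p + f x))"
        using le by (rule ennreal_leI)
      also have "\<dots> = ennreal C * (ennreal (f (x - z)) + ennreal (\<eta> powr p) * indicator (cball 0 r) x + ennreal (f x))"
        using f0 \<open>C > 0\<close> by (simp add: ennreal_mult' ennreal_plus ennreal_indicator mult.commute)
      finally show "ennreal (?I r x * norm (G (x - z) - G x) powr p) \<le> \<dots>" .
    qed
    also have "\<dots> = ennreal C * ((\<integral>\<^sup>+x. ennreal (f (x - z)) \<partial>lborel) + ennreal (\<eta> powr p) * emeasure lborel (cball (0::'a) r) + (\<integral>\<^sup>+x. ennreal (f x) \<partial>lborel))"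
      by (simp add: nn_integral_cmult nn_integral_add nn_integral_cmult_indicator)
    also have "(\<integral>\<^sup>+x. ennreal (f (x - z)) \<partial>lborel) = (\<integral>\<^sup>+x. ennreal (f x) \<partial>lborel)"
      using lborel_nn_integral_shift(1)[of "\<lambda>x. ennreal (f x)" "-z"] by simp
    also have "emeasure lborel (cball (0::'a) r) = ennreal V"
      unfolding V_def using emeasure_lborel_cball_finite[of "0::'a" r] by (simp add: emeasure_eq_ennreal_measure)
    also have "ennreal C * ((\<integral>\<^sup>+x. ennreal (f x) \<partial>lborel) + ennreal (\<eta> powr p) * ennreal V + (\<integral>\<^sup>+x. ennreal (f x) \<partial>lborel))
      \<le> ennreal C * (ennreal (\<epsilon> / (3 * C)) + ennreal (\<eta> powr p) * ennreal V + ennreal (\<epsilon> / (3 * C)))"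
      using fint by (intro mult_left_mono add_mono) auto
    also have "\<dots> = ennreal (C * (\<epsilon> / (3 * C) + \<eta> powr p * V + \<epsilon> / (3 * C)))"
    proof -
      have *: "ennreal C * (ennreal a + ennreal b * ennreal V + ennreal c) = ennreal (C * (a + b * V + c))"
        if "a \<ge> 0" "b \<ge> 0" "c \<ge> 0" for a b c
        using that \<open>C > 0\<close> \<open>V \<ge> 0\<close> by (simp add: ennreal_mult' ennreal_plus)
      show ?thesis using \<open>\<epsilon> > 0\<close> \<open>C > 0\<close> by (intro *) auto
    qed
    also have "\<dots> \<le> ennreal \<epsilon>"
    proof (rule ennreal_leI)
      have "\<eta> powr p * V \<le> \<eta> powr p * (V + 1)" by (intro mult_left_mono) auto
      also have "\<dots> = \<epsilon> / (3 * C)"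
      proof -
        have "V + 1 \<noteq> 0" using \<open>V \<ge> 0\<close> by simp
        then show ?thesis unfolding \<eta>p divide_divide_eq_left[symmetric] by simp
      qed
      finally have "\<eta> powr p * V \<le> \<epsilon> / (3 * C)" .
      then have "C * (\<epsilon> / (3 * C) + \<eta> powr p * V + \<epsilon> / (3 * C)) \<le> C * (\<epsilon> / (3 * C) + \<epsilon> / (3 * C) + \<epsilon> / (3 * C))"
        using \<open>C > 0\<close> by (intro mult_left_mono add_mono) auto
      also have "\<dots> = \<epsilon>" using \<open>C > 0\<close> by (simp add: field_simps)
      finally show "C * (\<epsilon> / (3 * C) + \<eta> powr p * V + \<epsilon> / (3 * C)) \<le> \<epsilon>" .
    qed
    finally show ?thesis .
  qed
  show ?thesis by (rule that[of "min \<delta> 1"]) (use \<delta> main in auto)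
qed

section \<open>Averages against a probability density\<close>

text \<open>Jensen's inequality for the p-th power, derived from the Hoelder inequality.
  Integrability of g need not be known in advance: either the right side is infinite, or its
  finiteness yields the integrability.\<close>

lemma norm_average_diff_powr_le:
  fixes g :: "'a \<Rightarrow> 'b::{banach, second_countable_topology}"
  assumes [measurable]: "g \<in> borel_measurable M" and \<rho>: "integrable M \<rho>" "\<And>z. 0 \<le> \<rho> z" "integral\<^sup>L M \<rho> = (1::real)"
    and p: "p > 1"
  shows "ennreal (norm ((\<integral>z. \<rho> z *\<^sub>R g z \<partial>M) - a) powr p) \<le> (\<integral>\<^sup>+z. ennreal (\<rho> z * norm (g z - a) powr p) \<partial>M)"
proof (cases "(\<integral>\<^sup>+z. ennreal (\<rho> z * norm (g z - a) powr p) \<partial>M) = \<infinity>")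
  case False
  have [measurable]: "\<rho> \<in> borel_measurable M" using \<rho> by auto
  define f where "f = (\<lambda>z. \<rho> z * norm (g z - a) powr p)"
  have f0: "f z \<ge> 0" for z using \<rho> by (simp add: f_def)
  have fm[measurable]: "f \<in> borel_measurable M" unfolding f_def by measurable
  have fi: "integrable M f"
    using False f0 by (intro integrableI_nonneg) (auto simp: f_def top.not_eq_extremum)
  \<comment> \<open>Splitting one factor of the density as rho^(1/p) rho^(1-1/p) lets the Hoelder
    inequality leave the total mass 1 as its second factor.\<close>
  have eq: "f z powr (1 / p) * \<rho> z powr (1 - 1 / p) = \<rho> z * norm (g z - a)" for z
  proof (cases "\<rho> z = 0")
    case False
    then have "\<rho> z > 0" using \<rho>(2)[of z] by simp
    then have "\<rho> z powr (1 / p) * \<rho> z powr (1 - 1 / p) = \<rho> z" by (simp flip: powr_add)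
    then show ?thesis using p \<open>\<rho> z > 0\<close>
      by (simp add: f_def powr_mult powr_powr mult.assoc mult.left_commute)
  qed (simp add: f_def)
  have \<theta>: "0 < 1 / p" "1 / p < 1" using p by auto
  note H = Holder_powr[OF fi f0 \<rho>(1,2) \<theta>, unfolded eq]
  have di: "integrable M (\<lambda>z. \<rho> z *\<^sub>R (g z - a))"
    by (rule Bochner_Integration.integrable_bound[OF H(1)]) (auto simp: \<rho>)
  have "integrable M (\<lambda>z. \<rho> z *\<^sub>R (g z - a) + \<rho> z *\<^sub>R a)"
    using di \<rho>(1) by (intro Bochner_Integration.integrable_add integrable_scaleR_left) auto
  then have gi: "integrable M (\<lambda>z. \<rho> z *\<^sub>R g z)" by (simp add: algebra_simps)
  have "(\<integral>z. \<rho> z *\<^sub>R g z \<partial>M) - a = (\<integral>z. \<rho> z *\<^sub>R (g z - a) \<partial>M)"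
    using gi \<rho> by (simp add: scaleR_diff_right)
  then have "norm ((\<integral>z. \<rho> z *\<^sub>R g z \<partial>M) - a) \<le> (\<integral>z. \<rho> z * norm (g z - a) \<partial>M)"
    using integral_norm_bound[of M "\<lambda>z. \<rho> z *\<^sub>R (g z - a)"] \<rho> by simp
  also have "\<dots> \<le> (\<integral>z. f z \<partial>M) powr (1 / p)" using H(2) \<rho> by simp
  finally have "norm ((\<integral>z. \<rho> z *\<^sub>R g z \<partial>M) - a) powr p \<le> ((\<integral>z. f z \<partial>M) powr (1 / p)) powr p"
    using p by (intro powr_mono2) auto
  also have "\<dots> = (\<integral>z. f z \<partial>M)"
    using p f0 by (simp add: powr_powr integral_nonneg)
  finally have "ennreal (norm ((\<integral>z. \<rho> z *\<^sub>R g z \<partial>M) - a) powr p) \<le> ennreal (\<integral>z. f z \<partial>M)"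
    by (rule ennreal_leI)
  also have "\<dots> = (\<integral>\<^sup>+z. ennreal (f z) \<partial>M)"
    using fi f0 by (subst nn_integral_eq_integral) auto
  finally show ?thesis by (simp add: f_def)
qed simp

text \<open>A mollification is an average of translates, so Jensen's inequality and Tonelli's
  theorem reduce its L^p error to that of a single small translation.\<close>

lemma Lp_mollify_bound:
  fixes G :: "'a::euclidean_space \<Rightarrow> 'b::euclidean_space"
  assumes G[measurable]: "G \<in> borel_measurable borel" and p: "p > 1"
    and \<rho>: "\<rho> \<in> borel_measurable borel" "integrable lborel \<rho>" "\<And>z. 0 \<le> \<rho> z" "integral\<^sup>L lborel \<rho> = (1::real)"
      "\<And>z. \<delta> \<le> norm z \<Longrightarrow> \<rho> z = 0"
    and bd: "\<And>z. norm z < \<delta> \<Longrightarrow> (\<integral>\<^sup>+x. ennreal (indicator (cball 0 r) x * norm (G (x - z) - G x) powr p) \<partial>lborel) \<le> ennreal \<epsilon>"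
  shows "(\<integral>\<^sup>+x. ennreal (indicator (cball 0 r) x * norm ((\<integral>z. \<rho> z *\<^sub>R G (x - z) \<partial>lborel) - G x) powr p) \<partial>lborel) \<le> ennreal \<epsilon>"
proof -
  note [measurable] = \<rho>(1)
  have [measurable]: "cball (0::'a) r \<in> sets borel" by simp
  have "(\<integral>\<^sup>+x. ennreal (indicator (cball 0 r) x * norm ((\<integral>z. \<rho> z *\<^sub>R G (x - z) \<partial>lborel) - G x) powr p) \<partial>lborel)
    \<le> (\<integral>\<^sup>+x. (\<integral>\<^sup>+z. ennreal (\<rho> z * (indicator (cball 0 r) x * norm (G (x - z) - G x) powr p)) \<partial>lborel) \<partial>lborel)"
  proof (rule nn_integral_mono)
    fix x
    have "ennreal (norm ((\<integral>z. \<rho> z *\<^sub>R G (x - z) \<partial>lborel) - G x) powr p)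
      \<le> (\<integral>\<^sup>+z. ennreal (\<rho> z * norm (G (x - z) - G x) powr p) \<partial>lborel)"
      using \<rho> p by (intro norm_average_diff_powr_le) auto
    then show "ennreal (indicator (cball 0 r) x * norm ((\<integral>z. \<rho> z *\<^sub>R G (x - z) \<partial>lborel) - G x) powr p)
      \<le> (\<integral>\<^sup>+z. ennreal (\<rho> z * (indicator (cball 0 r) x * norm (G (x - z) - G x) powr p)) \<partial>lborel)"
      by (auto simp: indicator_def)
  qed
  also have "\<dots> = (\<integral>\<^sup>+z. (\<integral>\<^sup>+x. ennreal (\<rho> z * (indicator (cball 0 r) x * norm (G (x - z) - G x) powr p)) \<partial>lborel) \<partial>lborel)"
    by (rule lborel_pair.Fubini') measurable
  also have "\<dots> = (\<integral>\<^sup>+z. ennreal (\<rho> z) * (\<integral>\<^sup>+x. ennreal (indicator (cball 0 r) x * norm (G (x - z) - G x) powr p) \<partial>lborel) \<partial>lborel)"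
    using \<rho>(3) by (simp add: ennreal_mult' nn_integral_cmult)
  also have "\<dots> \<le> (\<integral>\<^sup>+z. ennreal (\<rho> z) * ennreal \<epsilon> \<partial>lborel)"
  proof (rule nn_integral_mono)
    fix z show "ennreal (\<rho> z) * (\<integral>\<^sup>+x. ennreal (indicator (cball 0 r) x * norm (G (x - z) - G x) powr p) \<partial>lborel) \<le> ennreal (\<rho> z) * ennreal \<epsilon>"
      using bd[of z] \<rho>(5)[of z] by (cases "norm z < \<delta>") (auto intro: mult_left_mono)
  qed
  also have "\<dots> = (\<integral>\<^sup>+z. ennreal (\<rho> z) \<partial>lborel) * ennreal \<epsilon>"
    by (simp add: nn_integral_multc)
  also have "(\<integral>\<^sup>+z. ennreal (\<rho> z) \<partial>lborel) = 1"
    using \<rho> by (subst nn_integral_eq_integral) auto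
  finally show ?thesis by simp
qed

section \<open>Mollification of weak gradients\<close>

lemma C1_grad_mvt:
  assumes "C1_grad f D"
  obtains s where "0 < s" "s < 1" "f (x + h) - f x = D (x + s *\<^sub>R h) \<bullet> h"
proof -
  from MVT2[OF zero_less_one C1_grad_path_deriv[OF assms, of x h]] show ?thesis using that by auto
qed

text \<open>The linearisation error is uniform in x and supported in one fixed ball, since |h| < 1
  moves the support by less than 1. This turns differentiation under the convolution integral into
  one estimate.\<close>

lemma C1_grad_uniform_linearization:
  fixes \<rho> :: "'a::euclidean_space \<Rightarrow> real"
  assumes \<rho>: "C1_grad \<rho> D" and z: "\<And>x. e \<le> norm x \<Longrightarrow> \<rho> x = 0" and "\<eta> > 0" "e > 0"
  obtains \<delta> where "\<delta> > 0" "\<And>x h. norm h < \<delta> \<Longrightarrow>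
    \<bar>\<rho> (x + h) - \<rho> x - D x \<bullet> h\<bar> \<le> indicator (cball 0 (e + 1)) x * (\<eta> * norm h)"
proof -
  have Dz: "D x = 0" if "e < norm x" for x
    using C1_grad_support[OF \<rho> _ that] z by simp
  have "uniformly_continuous_on (cball 0 (e + 2)) D"
    using C1_gradD(2)[OF \<rho>] by (intro compact_uniformly_continuous) auto
  then obtain \<delta> where \<delta>: "\<delta> > 0" "\<And>x y. x \<in> cball 0 (e + 2) \<Longrightarrow> y \<in> cball 0 (e + 2) \<Longrightarrow> dist y x < \<delta> \<Longrightarrow> dist (D y) (D x) < \<eta>"
    unfolding uniformly_continuous_on_def using \<open>\<eta> > 0\<close> by metis
  have "\<bar>\<rho> (x + h) - \<rho> x - D x \<bullet> h\<bar> \<le> indicator (cball 0 (e + 1)) x * (\<eta> * norm h)"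
    if h: "norm h < min \<delta> 1" for x h
  proof (cases "x \<in> cball 0 (e + 1)")
    case True
    obtain s where s: "0 < s" "s < 1" "\<rho> (x + h) - \<rho> x = D (x + s *\<^sub>R h) \<bullet> h"
      using C1_grad_mvt[OF \<rho>] by metis
    have sh: "norm (s *\<^sub>R h) \<le> norm h" using s by (simp add: mult_left_le_one_le)
    have "x + s *\<^sub>R h \<in> cball 0 (e + 2)" "x \<in> cball 0 (e + 2)"
      using True h sh norm_triangle_ineq[of x "s *\<^sub>R h"] by auto
    then have "dist (D (x + s *\<^sub>R h)) (D x) < \<eta>"
      using h sh by (intro \<delta>) (auto simp: dist_norm)
    then have "norm (D (x + s *\<^sub>R h) - D x) * norm h \<le> \<eta> * norm h"
      by (intro mult_right_mono) (auto simp: dist_norm)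
    moreover have "\<rho> (x + h) - \<rho> x - D x \<bullet> h = (D (x + s *\<^sub>R h) - D x) \<bullet> h"
      by (simp add: s(3) inner_diff_left)
    ultimately show ?thesis
      using True Cauchy_Schwarz_ineq2[of "D (x + s *\<^sub>R h) - D x" h] by simp
  next
    case False
    then have x: "e + 1 < norm x" by simp
    have "norm x \<le> norm (x + h) + norm h"
      using norm_triangle_ineq4[of "x + h" h] by simp
    then have "e \<le> norm (x + h)" using x h by auto
    then show ?thesis using x False by (simp add: z Dz)
  qed
  then show ?thesis using \<delta>(1) by (intro that[of "min \<delta> 1"]) auto
qed

lemma continuous_on_convolution:
  fixes w :: "'a::euclidean_space \<Rightarrow> real" and K :: "'a \<Rightarrow> 'b::euclidean_space"
  assumes w: "continuous_on UNIV w" and K: "continuous_on UNIV K" "\<And>z. e < norm z \<Longrightarrow> K z = 0"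
  shows "continuous_on UNIV (\<lambda>x. \<integral>z. w (x - z) *\<^sub>R K z \<partial>lborel)"
proof -
  have [measurable]: "w \<in> borel_measurable borel" "K \<in> borel_measurable borel"
    using w K borel_measurable_continuous_onI by auto
  have "(\<lambda>n. \<integral>z. w (X n - z) *\<^sub>R K z \<partial>lborel) \<longlonglongrightarrow> (\<integral>z. w (a - z) *\<^sub>R K z \<partial>lborel)"
    if X: "X \<longlonglongrightarrow> a" for X and a :: 'a
  proof -
    have "bounded (range X)" using X by (simp add: convergent_imp_bounded)
    then obtain B where B: "\<And>n. norm (X n) \<le> B" by (auto simp: bounded_iff)
    have "bounded (w ` cball 0 (B + e))"
      using w by (intro compact_imp_bounded compact_continuous_image) (auto intro: continuous_on_subset)
    then obtain M where "\<forall>y\<in>w ` cball 0 (B + e). norm y \<le> M" unfolding bounded_iff by blast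
    then have M: "\<bar>w x\<bar> \<le> M" if "norm x \<le> B + e" for x using that by simp
    show ?thesis
    proof (rule integral_dominated_convergence)
      show "integrable lborel (\<lambda>z. M * norm (K z))"
        using integrable_continuous_compact_support[OF K] by simp
      show "AE z in lborel. (\<lambda>n. w (X n - z) *\<^sub>R K z) \<longlonglongrightarrow> w (a - z) *\<^sub>R K z"
        using w X by (intro AE_I2 tendsto_intros isCont_tendsto_compose[of _ w])
          (auto simp: continuous_on_eq_continuous_at)
      show "AE z in lborel. norm (w (X n - z) *\<^sub>R K z) \<le> M * norm (K z)" for n
      proof (rule AE_I2)
        fix z
        have "norm (X n - z) \<le> B + e" if "norm z \<le> e"
          using B[of n] that norm_triangle_ineq4[of "X n" z] by auto
        then show "norm (w (X n - z) *\<^sub>R K z) \<le> M * norm (K z)"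
          using M[of "X n - z"] K(2)[of z] by (cases "norm z \<le> e") (auto intro: mult_right_mono)
      qed
    qed measurable
  qed
  then show ?thesis by (auto simp: continuous_on_sequentially comp_def)
qed

lemma lebesgue_borel_version:
  fixes f g :: "'a::euclidean_space \<Rightarrow> 'b::euclidean_space"
  assumes "f \<in> borel_measurable lebesgue" "g \<in> borel_measurable borel" "AE x in lebesgue. f x = g x"
  shows "integrable lebesgue f \<longleftrightarrow> integrable lborel g" "integral\<^sup>L lebesgue f = integral\<^sup>L lborel g"
proof -
  have g: "g \<in> borel_measurable lebesgue" using assms(2) by (rule borel_measurable_imp_lebesgue)
  have "integrable lebesgue f \<longleftrightarrow> integrable lebesgue g"
    using assms g by (intro integrable_cong_AE) auto
  then show "integrable lebesgue f \<longleftrightarrow> integrable lborel g"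
    using assms(2) by (simp add: integrable_completion)
  have "integral\<^sup>L lebesgue f = integral\<^sup>L lebesgue g"
    using assms g by (intro integral_cong_AE) auto
  then show "integral\<^sup>L lebesgue f = integral\<^sup>L lborel g"
    using assms(2) by (simp add: integral_completion)
qed

text \<open>The derivative first falls on the kernel, where it exists classically. Inserting the
  kernel, as a function of y, into the weak gradient identity then moves it onto w, so the classical
  gradient is the mollified weak one.\<close>

lemma convolution_C1_grad:
  fixes w :: "'a::euclidean_space \<Rightarrow> real"
  assumes w: "continuous_on UNIV w" and wg: "has_weak_gradient w G"
    and g: "g \<in> borel_measurable borel" "AE x in lebesgue. G x = g x"
    and \<rho>: "C1_grad \<rho> D" "\<And>x. e \<le> norm x \<Longrightarrow> \<rho> x = 0" "\<And>a. Cc_infty (\<lambda>y. \<rho> (a - y))" and "e > 0"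
  shows "C1_grad (\<lambda>x. \<integral>z. \<rho> z * w (x - z) \<partial>lborel) (\<lambda>x. \<integral>z. \<rho> z *\<^sub>R g (x - z) \<partial>lborel)"
proof -
  note [measurable] = C1_gradD(4,5)[OF \<rho>(1)] g(1)
  have [measurable]: "cball (0::'a) r \<in> sets borel" "cball (x::'a) r \<in> sets borel" "cball (x::'a) r \<in> sets lebesgue" for x r by simp_all
  have [measurable]: "w \<in> borel_measurable borel" using w by (rule borel_measurable_continuous_onI)
  have [measurable]: "G \<in> borel_measurable lebesgue" using wg by (simp add: has_weak_gradient_def L_loc_def)
  have Dz: "D x = 0" if "e < norm x" for x
    using C1_grad_support[OF \<rho>(1) _ that] \<rho>(2) by simp
  define K where "K = (\<lambda>x. \<integral>z. w (x - z) *\<^sub>R D z \<partial>lborel)"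
  have Kcont: "continuous_on UNIV K"
    unfolding K_def using w C1_gradD(2)[OF \<rho>(1)] Dz by (rule continuous_on_convolution)
  have Keq: "K x = (\<integral>y. w y *\<^sub>R D (x - y) \<partial>lborel)" for x
    unfolding K_def using lborel_integral_shift(2)[of "\<lambda>y. w y *\<^sub>R D (x - y)" x] by simp
  have weq: "(\<integral>z. \<rho> z * w (x - z) \<partial>lborel) = (\<integral>y. w y * \<rho> (x - y) \<partial>lborel)" for x
    using lborel_integral_shift(2)[of "\<lambda>y. w y * \<rho> (x - y)" x] by (simp add: mult.commute)
  have yx: "norm x + r < norm y \<Longrightarrow> r < norm (x - y)" for x y :: 'a and r
    using norm_triangle_ineq2[of y x] by (auto simp: norm_minus_commute)
  have i1: "integrable lborel (\<lambda>y. w y * \<rho> (x - y))" for x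
    using w C1_gradD(3)[OF \<rho>(1), of UNIV] yx[of x e] \<rho>(2)
    by (intro integrable_continuous_compact_support[of _ "norm x + e"])
      (auto intro!: continuous_intros continuous_on_compose2[of UNIV \<rho>] simp: less_imp_le)
  have i2: "integrable lborel (\<lambda>y. w y *\<^sub>R D (x - y))" for x
    using w C1_gradD(2)[OF \<rho>(1), of UNIV] yx[of x e] Dz
    by (intro integrable_continuous_compact_support[of _ "norm x + e"])
      (auto intro!: continuous_intros continuous_on_compose2[of UNIV D])
  have deriv: "((\<lambda>x. \<integral>y. w y * \<rho> (x - y) \<partial>lborel) has_derivative (\<lambda>h. K x \<bullet> h)) (at x)" for x
    unfolding has_derivative_at_alt
  proof (intro conjI allI impI bounded_linear_inner_right)
    fix \<epsilon> :: real assume "\<epsilon> > 0"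
    let ?I = "\<lambda>y. indicator (cball 0 (e + 1)) (x - y) * \<bar>w y\<bar>"
    define W where "W = (\<integral>y. ?I y \<partial>lborel)"
    have Ii: "integrable lborel ?I"
    proof -
      have "integrable lborel (\<lambda>y. indicator (cball x (e + 1)) y *\<^sub>R \<bar>w y\<bar>)"
        using w by (intro borel_integrable_compact) (auto intro!: continuous_intros continuous_on_subset[OF w])
      moreover have "indicator (cball x (e + 1)) y = (indicator (cball 0 (e + 1)) (x - y) :: real)" for y
        by (auto simp: indicator_def dist_norm norm_minus_commute)
      ultimately show ?thesis by simp
    qed
    have "W \<ge> 0" unfolding W_def by (intro Bochner_Integration.integral_nonneg) auto
    define \<eta> where "\<eta> = \<epsilon> / (W + 1)"
    have "\<eta> > 0" "\<eta> * W \<le> \<epsilon>" using \<open>\<epsilon> > 0\<close> \<open>W \<ge> 0\<close> by (auto simp: \<eta>_def field_simps)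
    obtain \<delta> where \<delta>: "\<delta> > 0" "\<And>x h. norm h < \<delta> \<Longrightarrow>
        \<bar>\<rho> (x + h) - \<rho> x - D x \<bullet> h\<bar> \<le> indicator (cball 0 (e + 1)) x * (\<eta> * norm h)"
      using C1_grad_uniform_linearization[OF \<rho>(1,2) \<open>\<eta> > 0\<close> \<open>e > 0\<close>] by metis
    have "norm ((\<integral>y. w y * \<rho> (x' - y) \<partial>lborel) - (\<integral>y. w y * \<rho> (x - y) \<partial>lborel) - K x \<bullet> (x' - x)) \<le> \<epsilon> * norm (x' - x)"
      if "norm (x' - x) < \<delta>" for x'
    proof -
      let ?h = "x' - x"
      have "(\<integral>y. w y * \<rho> (x' - y) \<partial>lborel) - (\<integral>y. w y * \<rho> (x - y) \<partial>lborel) - K x \<bullet> ?h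
        = (\<integral>y. w y * \<rho> (x' - y) - w y * \<rho> (x - y) - (w y *\<^sub>R D (x - y)) \<bullet> ?h \<partial>lborel)"
        using i1 i2 by (simp add: Keq del: inner_scaleR_left)
      also have "norm \<dots> \<le> (\<integral>y. ?I y * (\<eta> * norm ?h) \<partial>lborel)"
      proof (rule Bochner_Integration.integral_norm_bound_integral)
        show "integrable lborel (\<lambda>y. w y * \<rho> (x' - y) - w y * \<rho> (x - y) - (w y *\<^sub>R D (x - y)) \<bullet> ?h)"
          using i1 i2 by (intro Bochner_Integration.integrable_diff integrable_inner_left) auto
        show "integrable lborel (\<lambda>y. ?I y * (\<eta> * norm ?h))" using Ii by simp
        fix y
        have "w y * \<rho> (x' - y) - w y * \<rho> (x - y) - (w y *\<^sub>R D (x - y)) \<bullet> ?h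
          = w y * (\<rho> ((x - y) + ?h) - \<rho> (x - y) - D (x - y) \<bullet> ?h)"
          by (simp add: algebra_simps)
        then have "norm (w y * \<rho> (x' - y) - w y * \<rho> (x - y) - (w y *\<^sub>R D (x - y)) \<bullet> ?h)
          = \<bar>w y\<bar> * \<bar>\<rho> ((x - y) + ?h) - \<rho> (x - y) - D (x - y) \<bullet> ?h\<bar>"
          by (simp add: abs_mult)
        also have "\<dots> \<le> \<bar>w y\<bar> * (indicator (cball 0 (e + 1)) (x - y) * (\<eta> * norm ?h))"
          using \<delta>(2)[OF that, of "x - y"] by (intro mult_left_mono) auto
        finally show "norm (w y * \<rho> (x' - y) - w y * \<rho> (x - y) - (w y *\<^sub>R D (x - y)) \<bullet> ?h) \<le> ?I y * (\<eta> * norm ?h)"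
          by (simp add: mult_ac)
      qed
      also have "\<dots> = \<eta> * W * norm ?h" using Ii by (simp add: W_def)
      also have "\<dots> \<le> \<epsilon> * norm ?h" using \<open>\<eta> * W \<le> \<epsilon>\<close> by (intro mult_right_mono) auto
      finally show ?thesis .
    qed
    then show "\<exists>d>0. \<forall>y. norm (y - x) < d \<longrightarrow> norm ((\<integral>ya. w ya * \<rho> (y - ya) \<partial>lborel) - (\<integral>y. w y * \<rho> (x - y) \<partial>lborel) - K x \<bullet> (y - x)) \<le> \<epsilon> * norm (y - x)"
      using \<delta>(1) by blast
  qed
  have KG: "K x = (\<integral>z. \<rho> z *\<^sub>R g (x - z) \<partial>lborel)" for x
  proof (rule euclidean_eqI)
    fix i :: 'a assume i: "i \<in> Basis"
    have "((\<lambda>y. \<rho> (x - y)) has_derivative (\<lambda>h. - (D (x - y) \<bullet> h))) (at y)" for y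
    proof -
      have "((\<lambda>y. x - y) has_derivative (\<lambda>h. - h)) (at y)" by (auto intro!: derivative_eq_intros)
      from has_derivative_compose[OF this C1_gradD(1)[OF \<rho>(1)]] show ?thesis by simp
    qed
    then have fd: "frechet_derivative (\<lambda>y. \<rho> (x - y)) (at y) i = - (D (x - y) \<bullet> i)" for y
      using frechet_derivative_at by metis
    have gi: "integrable lborel (\<lambda>y. \<rho> (x - y) *\<^sub>R g y)"
    proof -
      obtain M where M: "M > 0" "\<And>y. norm (\<rho> y) \<le> M"
        using continuous_compact_support_bounded[of \<rho> e] C1_gradD(3)[OF \<rho>(1)] \<rho>(2) by (metis less_imp_le)
      have "set_integrable lebesgue (cball x e) (\<lambda>x. norm (G x) powr 1)"
        using wg by (simp add: has_weak_gradient_def L_loc_def)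
      then have "integrable lebesgue (\<lambda>y. indicator (cball x e) y * norm (G y))"
        by (simp add: set_integrable_def)
      then have "integrable lborel (\<lambda>y. indicator (cball x e) y * norm (g y))"
      proof (subst (asm) lebesgue_borel_version(1))
        show "AE y in lebesgue. indicator (cball x e) y * norm (G y) = indicator (cball x e) y * norm (g y)"
          using g(2) by eventually_elim simp
      qed measurable
      then have "integrable lborel (\<lambda>y. M * (indicator (cball x e) y * norm (g y)))" by simp
      then show ?thesis
      proof (rule Bochner_Integration.integrable_bound)
        have "norm (\<rho> (x - y) *\<^sub>R g y) \<le> norm (M * (indicator (cball x e) y * norm (g y)))" for y
          using M(2)[of "x - y"] M(1) \<rho>(2)[of "x - y"]
          by (auto simp: indicator_def dist_norm abs_mult intro!: mult_right_mono)
        then show "AE y in lborel. norm (\<rho> (x - y) *\<^sub>R g y) \<le> norm (M * (indicator (cball x e) y * norm (g y)))"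
          by simp
      qed measurable
    qed
    have "K x \<bullet> i = (\<integral>y. w y * (D (x - y) \<bullet> i) \<partial>lborel)"
      using i2[of x] by (simp add: Keq flip: integral_inner_left)
    \<comment> \<open>The derivative of the kernel in y is minus \<open>D (x - y)\<close>; the
      double minus produces exactly the left side of the weak gradient identity.\<close>
    also have "\<dots> = - (\<integral>y. w y * - (D (x - y) \<bullet> i) \<partial>lebesgue)"
      by (simp add: integral_completion)
    also have "\<dots> = (LINT y|lebesgue. (G y \<bullet> i) * \<rho> (x - y))"
    proof -
      have "(LINT y|lebesgue. w y * frechet_derivative (\<lambda>y. \<rho> (x - y)) (at y) i)
          = - (LINT y|lebesgue. (G y \<bullet> i) * \<rho> (x - y))"
        using wg i \<rho>(3)[of x] unfolding has_weak_gradient_def by blast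
      then show ?thesis unfolding fd by simp
    qed
    also have "\<dots> = (\<integral>y. (g y \<bullet> i) * \<rho> (x - y) \<partial>lborel)"
    proof (rule lebesgue_borel_version(2))
      show "AE y in lebesgue. (G y \<bullet> i) * \<rho> (x - y) = (g y \<bullet> i) * \<rho> (x - y)"
        using g(2) by eventually_elim simp
      have "(\<lambda>y. \<rho> (x - y)) \<in> borel_measurable lebesgue"
        by (rule borel_measurable_imp_lebesgue) measurable
      then show "(\<lambda>y. (G y \<bullet> i) * \<rho> (x - y)) \<in> borel_measurable lebesgue"
        by (intro borel_measurable_times borel_measurable_inner) simp_all
    qed measurable
    also have "\<dots> = (\<integral>y. \<rho> (x - y) *\<^sub>R g y \<partial>lborel) \<bullet> i"
      using gi by (simp add: mult.commute flip: integral_inner_left)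
    also have "(\<integral>y. \<rho> (x - y) *\<^sub>R g y \<partial>lborel) = (\<integral>z. \<rho> z *\<^sub>R g (x - z) \<partial>lborel)"
      using lborel_integral_shift(2)[of "\<lambda>y. \<rho> (x - y) *\<^sub>R g y" x] by simp
    finally show "K x \<bullet> i = (\<integral>z. \<rho> z *\<^sub>R g (x - z) \<partial>lborel) \<bullet> i" .
  qed
  show ?thesis
    unfolding C1_grad_def weq using deriv Kcont by (simp add: KG)
qed

text \<open>One small kernel serves both errors: uniform continuity of w on a ball, and L^p
  continuity of translations for G. The lower bound \<open>c\<close> survives because the kernel is
  nonnegative with mass 1; it later keeps compositions with powers away from the singularity at
  0.\<close>

lemma weak_gradient_mollify:
  fixes w :: "'a::euclidean_space \<Rightarrow> real"
  assumes w: "continuous_on UNIV w" and wg: "has_weak_gradient w G" and G: "L_loc p G" and p: "p > 1"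
    and c: "\<And>x. c \<le> w x" and "\<epsilon> > 0"
  obtains w' D where "C1_grad w' D" "\<And>x. norm x \<le> r \<Longrightarrow> \<bar>w' x - w x\<bar> < \<epsilon>" "\<And>x. c \<le> w' x"
    "(\<integral>x. indicator (cball 0 r) x * norm (D x - G x) powr p \<partial>lebesgue) < \<epsilon>"
proof -
  have Gm: "G \<in> borel_measurable lebesgue" using G by (simp add: L_loc_def)
  then obtain g where g: "g \<in> borel_measurable borel" "AE x in lebesgue. G x = g x"
    by (rule lebesgue_ex_borel)
  note [measurable] = g(1) Gm
  have [measurable]: "cball (0::'a) r \<in> sets borel" "cball (0::'a) r \<in> sets lebesgue" for r by simp_all
  have wm[measurable]: "w \<in> borel_measurable borel" using w by (rule borel_measurable_continuous_onI)
  have "set_integrable lebesgue (cball 0 (r + 1)) (\<lambda>x. norm (G x) powr p)"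
    using G by (simp add: L_loc_def)
  then have "integrable lebesgue (\<lambda>x. indicator (cball 0 (r + 1)) x * norm (G x) powr p)"
    by (simp add: set_integrable_def)
  then have int: "integrable lborel (\<lambda>x. indicator (cball 0 (r + 1)) x * norm (g x) powr p)"
  proof (subst (asm) lebesgue_borel_version(1))
    show "AE x in lebesgue. indicator (cball 0 (r + 1)) x * norm (G x) powr p = indicator (cball 0 (r + 1)) x * norm (g x) powr p"
      using g(2) by eventually_elim simp
  qed measurable
  have "\<epsilon> / 2 > 0" "p > 0" using \<open>\<epsilon> > 0\<close> p by auto
  obtain \<delta> where \<delta>: "\<delta> > 0" "\<delta> \<le> 1"
    "\<And>z. norm z < \<delta> \<Longrightarrow> (\<integral>\<^sup>+x. ennreal (indicator (cball 0 r) x * norm (g (x - z) - g x) powr p) \<partial>lborel) \<le> ennreal (\<epsilon> / 2)"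
    by (rule Lp_translation_continuous[OF g(1) \<open>p > 0\<close> int \<open>\<epsilon> / 2 > 0\<close>]) blast
  have "uniformly_continuous_on (cball 0 (r + 1)) w"
    using w by (intro compact_uniformly_continuous) (auto intro: continuous_on_subset)
  then obtain \<eta> where \<eta>: "\<eta> > 0" "\<And>x y. x \<in> cball 0 (r + 1) \<Longrightarrow> y \<in> cball 0 (r + 1) \<Longrightarrow> dist y x < \<eta> \<Longrightarrow> dist (w y) (w x) < \<epsilon> / 2"
    unfolding uniformly_continuous_on_def using \<open>\<epsilon> / 2 > 0\<close> by blast
  \<comment> \<open>\<open>\<delta>\<close> handles the gradient and \<open>\<eta>\<close> the
    function values; both errors come out at most \<open>\<epsilon> / 2\<close>, hence strictly
    below \<open>\<epsilon>\<close>.\<close>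
  define e where "e = min \<delta> \<eta>"
  have e: "e > 0" "e \<le> \<delta>" "e \<le> \<eta>" "e \<le> 1" using \<delta> \<eta> by (auto simp: e_def)
  obtain \<rho> D where \<rho>: "C1_grad \<rho> D" "\<And>x::'a. 0 \<le> \<rho> x" "\<And>x. e \<le> norm x \<Longrightarrow> \<rho> x = 0"
    "\<And>a. Cc_infty (\<lambda>y. \<rho> (a - y))" "integral\<^sup>L lborel \<rho> = 1"
    using mollifier_exists[OF e(1), where 'a = 'a] by blast
  note [measurable] = C1_gradD(4)[OF \<rho>(1)]
  have \<rho>i: "integrable lborel \<rho>"
    using C1_gradD(3)[OF \<rho>(1)] \<rho>(3) by (intro integrable_continuous_compact_support[of _ e]) auto
  define w' where "w' = (\<lambda>x. \<integral>z. \<rho> z * w (x - z) \<partial>lborel)"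
  define D' where "D' = (\<lambda>x. \<integral>z. \<rho> z *\<^sub>R g (x - z) \<partial>lborel)"
  have C1: "C1_grad w' D'"
    unfolding w'_def D'_def using w wg g \<rho>(1,3,4) e(1) by (rule convolution_C1_grad)
  have wi: "integrable lborel (\<lambda>z. \<rho> z * w (x - z))" for x
    using C1_gradD(3)[OF \<rho>(1), of UNIV] \<rho>(3) w
    by (intro integrable_continuous_compact_support[of _ e])
      (auto intro!: continuous_intros continuous_on_compose2[of UNIV w])
  have "\<bar>w' x - w x\<bar> < \<epsilon>" if "norm x \<le> r" for x
  proof -
    have "w' x - w x = (\<integral>z. \<rho> z * w (x - z) - \<rho> z * w x \<partial>lborel)"
      using wi \<rho>i \<rho>(5) by (simp add: w'_def)
    also have "norm \<dots> \<le> (\<integral>z. \<rho> z * (\<epsilon> / 2) \<partial>lborel)"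
    proof (rule Bochner_Integration.integral_norm_bound_integral)
      fix z
      show "norm (\<rho> z * w (x - z) - \<rho> z * w x) \<le> \<rho> z * (\<epsilon> / 2)"
      proof (cases "norm z < e")
        case True
        then have "norm (x - z) \<le> r + 1"
          using that e norm_triangle_ineq4[of x z] by linarith
        then have "dist (w (x - z)) (w x) < \<epsilon> / 2"
          using that e True by (intro \<eta>(2)) (auto simp: dist_norm norm_minus_commute[of z x])
        then have "\<rho> z * \<bar>w (x - z) - w x\<bar> \<le> \<rho> z * (\<epsilon> / 2)"
          using \<rho>(2) by (intro mult_left_mono) (auto simp: dist_real_def)
        then show ?thesis using \<rho>(2)[of z] by (simp add: abs_mult flip: right_diff_distrib)
      qed (simp add: \<rho>(3))
    qed (use wi \<rho>i in auto)
    also have "\<dots> = \<epsilon> / 2" using \<rho>(5) by simp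
    finally show ?thesis using \<open>\<epsilon> > 0\<close> by simp
  qed
  moreover have "c \<le> w' x" for x
  proof -
    have "(\<integral>z. \<rho> z * c \<partial>lborel) \<le> w' x"
      unfolding w'_def using wi \<rho>i \<rho>(2) c by (intro integral_mono) (auto intro: mult_left_mono)
    then show ?thesis using \<rho>(5) by simp
  qed
  moreover have "(\<integral>x. indicator (cball 0 r) x * norm (D' x - G x) powr p \<partial>lebesgue) < \<epsilon>"
  proof -
    have [measurable]: "D' \<in> borel_measurable borel" using C1_gradD(5)[OF C1] .
    have [measurable]: "D' \<in> borel_measurable lebesgue" by (rule borel_measurable_imp_lebesgue) simp
    have "(\<integral>x. indicator (cball 0 r) x * norm (D' x - G x) powr p \<partial>lebesgue)
      = (\<integral>x. indicator (cball 0 r) x * norm (D' x - g x) powr p \<partial>lborel)"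
    proof (rule lebesgue_borel_version(2))
      show "AE x in lebesgue. indicator (cball 0 r) x * norm (D' x - G x) powr p = indicator (cball 0 r) x * norm (D' x - g x) powr p"
        using g(2) by eventually_elim simp
    qed measurable
    also have "\<dots> = enn2real (\<integral>\<^sup>+x. ennreal (indicator (cball 0 r) x * norm (D' x - g x) powr p) \<partial>lborel)"
      by (rule integral_eq_nn_integral) auto
    also have "\<dots> \<le> \<epsilon> / 2"
      unfolding D'_def
      by (intro enn2real_leI Lp_mollify_bound[where \<delta> = e] g(1) p \<rho>(2,3,5) \<rho>i \<delta>(3))
        (use e \<open>\<epsilon> > 0\<close> in auto)
    finally show ?thesis using \<open>\<epsilon> > 0\<close> by simp
  qed
  ultimately show ?thesis using that C1 by blast
qed

section \<open>Composite test functions\<close>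

text \<open>The flux is an abstract field \<open>F\<close>, known only through two pointwise bounds
  and the weak equation -div F = g. It is not tied to the values of w, so w may be a shifted
  solution while the flux is evaluated at the unshifted one. A subsolution corresponds to
  \<open>g \<le> 0\<close>, a supersolution to \<open>g \<ge> 0\<close>.\<close>

locale weak_sol =
  fixes p K1 K2 \<epsilon> :: real and w :: "'a::euclidean_space \<Rightarrow> real" and G F :: "'a \<Rightarrow> 'a" and g :: "'a \<Rightarrow> real"
  assumes p: "1 < p" and K1: "0 < K1" and K2: "0 < K2" and eps: "0 < \<epsilon>"
    and w_ge: "\<And>x. \<epsilon> \<le> w x"
    and w_cont: "continuous_on UNIV w" and g_cont: "continuous_on UNIV g"
    and w_grad: "has_weak_gradient w G" and G_loc: "L_loc p G" and F_loc: "L_loc (p / (p - 1)) F"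
    and coercive: "\<And>x. K1 * norm (G x) powr p \<le> F x \<bullet> G x"
    and growth: "\<And>x. K2 * norm (F x) powr (p / (p - 1)) \<le> K1 * norm (G x) powr p"
    and weak_eq: "\<And>\<phi> H r. C1_grad \<phi> H \<Longrightarrow> (\<And>x. 0 \<le> \<phi> x) \<Longrightarrow> (\<And>x. r < norm x \<Longrightarrow> \<phi> x = 0) \<Longrightarrow>
      (LINT x|lebesgue. F x \<bullet> H x) = (LINT x|lebesgue. g x * \<phi> x)"
begin

definition "c\<^sub>F = (K1 / K2) powr ((p - 1) / p)"

lemma c\<^sub>F_pos: "0 < c\<^sub>F"
  using K1 K2 by (simp add: c\<^sub>F_def)

text \<open>The growth bound raised to the power (p-1)/p gives the usual flux growth of order p - 1
  in the gradient, which is the form every later estimate of F uses.\<close>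

lemma F_le: "norm (F x) \<le> c\<^sub>F * norm (G x) powr (p - 1)"
proof -
  have "norm (F x) powr (p / (p - 1)) \<le> (K1 / K2) * norm (G x) powr p"
    using growth[of x] K2 by (simp add: field_simps)
  then have "(norm (F x) powr (p / (p - 1))) powr ((p - 1) / p) \<le> ((K1 / K2) * norm (G x) powr p) powr ((p - 1) / p)"
    using p by (intro powr_mono2) auto
  also have "((K1 / K2) * norm (G x) powr p) powr ((p - 1) / p) = c\<^sub>F * (norm (G x) powr p) powr ((p - 1) / p)"
    unfolding c\<^sub>F_def using K1 K2 by (intro powr_mult)
  finally show ?thesis
    using p by (simp add: powr_powr)
qed

lemma G_meas[measurable]: "G \<in> borel_measurable lebesgue"
  and F_meas[measurable]: "F \<in> borel_measurable lebesgue"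
  using G_loc F_loc by (auto simp: L_loc_def)

lemma w_pos: "0 < w x"
  using w_ge[of x] eps by simp

lemma w_meas: "w \<in> borel_measurable borel"
  using w_cont by (rule borel_measurable_continuous_onI)

lemma G_powr_integrable: "integrable lebesgue (\<lambda>x. indicator (cball 0 r) x * norm (G x) powr p)"
proof -
  have "set_integrable lebesgue (cball 0 r) (\<lambda>x. norm (G x) powr p)"
    using G_loc by (simp add: L_loc_def)
  then show ?thesis by (simp add: set_integrable_def)
qed

lemma F_powr_integrable: "integrable lebesgue (\<lambda>x. indicator (cball 0 r) x * norm (F x) powr (p / (p - 1)))"
proof -
  have "set_integrable lebesgue (cball 0 r) (\<lambda>x. norm (F x) powr (p / (p - 1)))"
    using F_loc by (simp add: L_loc_def)
  then show ?thesis by (simp add: set_integrable_def)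
qed

lemma integrable_dominated:
  fixes f :: "'a \<Rightarrow> real"
  assumes f: "f \<in> borel_measurable lebesgue" and le: "\<And>x. \<bar>f x\<bar> \<le> C * (1 + norm (G x) powr p)"
    and z: "\<And>x. r < norm x \<Longrightarrow> f x = 0"
  shows "integrable lebesgue f"
proof (rule Bochner_Integration.integrable_bound)
  have "integrable lebesgue (\<lambda>x::'a. indicator (cball 0 r) x :: real)"
    using emeasure_lborel_cball_finite[of "0::'a" r] by (intro integrable_real_indicator) auto
  then show "integrable lebesgue (\<lambda>x. C * (indicator (cball 0 r) x + indicator (cball 0 r) x * norm (G x) powr p))"
    using G_powr_integrable by simp
  have "norm (f x) \<le> norm (C * (indicator (cball 0 r) x + indicator (cball 0 r) x * norm (G x) powr p))" for x
  proof (cases "norm x \<le> r")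
    case True
    then have "C * (indicator (cball 0 r) x + indicator (cball 0 r) x * norm (G x) powr p) = C * (1 + norm (G x) powr p)"
      by simp
    then show ?thesis using le[of x] by (metis abs_ge_self order_trans real_norm_def)
  qed (simp add: z)
  then show "AE x in lebesgue. norm (f x) \<le> norm (C * (indicator (cball 0 r) x + indicator (cball 0 r) x * norm (G x) powr p))"
    by simp
qed (rule f)

lemma powr_le_one_plus:
  fixes t :: real
  assumes "0 \<le> t" "0 \<le> a" "a \<le> b"
  shows "t powr a \<le> 1 + t powr b"
proof (cases "t \<le> 1")
  case True
  then have "t powr a \<le> 1" using assms by (simp add: powr_le1)
  then show ?thesis by (smt (verit) powr_ge_zero)
next
  case False
  then have "t powr a \<le> t powr b" using assms by (intro powr_mono) auto
  then show ?thesis by simp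
qed

lemma norm_F_le: "norm (F x) \<le> c\<^sub>F * (1 + norm (G x) powr p)"
proof -
  have "c\<^sub>F * norm (G x) powr (p - 1) \<le> c\<^sub>F * (1 + norm (G x) powr p)"
    using p c\<^sub>F_pos by (intro mult_left_mono powr_le_one_plus) auto
  then show ?thesis using F_le[of x] by simp
qed

lemma norm_F_G_le: "norm (F x) * norm (G x) \<le> c\<^sub>F * (1 + norm (G x) powr p)"
proof -
  have "norm (F x) * norm (G x) \<le> c\<^sub>F * norm (G x) powr (p - 1) * norm (G x)"
    by (intro mult_right_mono F_le) auto
  also have "\<dots> = c\<^sub>F * norm (G x) powr p"
    using powr_mult_base[of "norm (G x)" "p - 1"] by (simp add: mult_ac)
  also have "\<dots> \<le> c\<^sub>F * (1 + norm (G x) powr p)" using c\<^sub>F_pos by simp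
  finally show ?thesis .
qed

text \<open>The lower bound is imposed on the whole space, not only on the ball, so that
  compositions of \<open>W n\<close> with functions on (0,\<infinity>) are C1 everywhere.\<close>

definition "approx_seq r W D \<longleftrightarrow> (\<forall>n. C1_grad (W n) (D n) \<and> (\<forall>x. \<epsilon> \<le> W n x) \<and>
  (\<forall>x. norm x \<le> r \<longrightarrow> \<bar>W n x - w x\<bar> < 1 / real (Suc n)) \<and>
  (\<integral>x. indicator (cball 0 r) x * norm (D n x - G x) powr p \<partial>lebesgue) < 1 / real (Suc n))"

lemma approx_seq_exists: "\<exists>W D. approx_seq r W D"
proof -
  define Q where "Q = (\<lambda>n w' D. C1_grad w' D \<and> (\<forall>x. \<epsilon> \<le> w' x) \<and> (\<forall>x. norm x \<le> r \<longrightarrow> \<bar>w' x - w x\<bar> < 1 / real (Suc n)) \<and>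
    (\<integral>x. indicator (cball 0 r) x * norm (D x - G x) powr p \<partial>lebesgue) < 1 / real (Suc n))"
  have "\<exists>w' D. Q n w' D" for n
  proof -
    have "0 < 1 / real (Suc n)" by simp
    obtain w' D where "C1_grad w' D" "\<And>x. norm x \<le> r \<Longrightarrow> \<bar>w' x - w x\<bar> < 1 / real (Suc n)" "\<And>x. \<epsilon> \<le> w' x"
      "(\<integral>x. indicator (cball 0 r) x * norm (D x - G x) powr p \<partial>lebesgue) < 1 / real (Suc n)"
      by (rule weak_gradient_mollify[OF w_cont w_grad G_loc p w_ge \<open>0 < 1 / real (Suc n)\<close>]) blast
    then have "Q n w' D" by (simp add: Q_def)
    then show ?thesis by blast
  qed
  then obtain W D where "\<And>n. Q n (W n) (D n)" by metis
  then have "approx_seq r W D" unfolding approx_seq_def Q_def by blast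
  then show ?thesis by blast
qed

lemma w_bounded:
  obtains M where "M > 0" "\<And>x. norm x \<le> r \<Longrightarrow> w x \<le> M"
proof -
  have "bounded (w ` cball 0 r)"
    using w_cont by (intro compact_imp_bounded compact_continuous_image) (auto intro: continuous_on_subset)
  then obtain M where "M > 0" "\<forall>y\<in>w ` cball 0 r. norm y \<le> M" unfolding bounded_pos by blast
  then have "w x \<le> M" if "norm x \<le> r" for x using that by force
  with \<open>M > 0\<close> that show ?thesis by blast
qed

text \<open>On the ball all values of \<open>W n\<close> and w lie in one compact interval inside
  (0,\<infinity>), so even negative powers are bounded uniformly in n.\<close>

lemma approx_seq_comp_bounded:
  fixes k :: "real \<Rightarrow> real"
  assumes A: "approx_seq r W D" and k: "continuous_on {0<..} k"
  obtains M where "M > 0" "\<And>n x. norm x \<le> r \<Longrightarrow> \<bar>k (W n x)\<bar> \<le> M" "\<And>x. norm x \<le> r \<Longrightarrow> \<bar>k (w x)\<bar> \<le> M"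
proof -
  obtain B where B: "\<And>x. norm x \<le> r \<Longrightarrow> w x \<le> B" using w_bounded by metis
  have "bounded (k ` {\<epsilon>..B + 1})"
    using k eps by (intro compact_imp_bounded compact_continuous_image) (auto intro: continuous_on_subset)
  then obtain M where M: "M > 0" "\<forall>y\<in>k ` {\<epsilon>..B + 1}. norm y \<le> M" unfolding bounded_pos by blast
  show ?thesis
  proof (rule that[OF M(1)])
    fix n x assume x: "norm (x::'a) \<le> r"
    have "1 / real (Suc n) \<le> 1" by simp
    moreover have "\<bar>W n x - w x\<bar> < 1 / real (Suc n)" "\<epsilon> \<le> W n x" using A x by (auto simp: approx_seq_def)
    ultimately have "\<epsilon> \<le> W n x" "W n x \<le> B + 1" using B[OF x] by linarith+
    then have "W n x \<in> {\<epsilon>..B + 1}" by simp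
    then show "\<bar>k (W n x)\<bar> \<le> M" using M by auto
  next
    fix x assume x: "norm (x::'a) \<le> r"
    then have "w x \<in> {\<epsilon>..B + 1}" using B[OF x] w_ge[of x] by auto
    then show "\<bar>k (w x)\<bar> \<le> M" using M by auto
  qed
qed

lemma approx_seq_D:
  assumes "approx_seq r W D"
  shows "C1_grad (W n) (D n)" "0 < W n x" "norm x \<le> r \<Longrightarrow> (\<lambda>n. W n x) \<longlonglongrightarrow> w x"
proof -
  show "C1_grad (W n) (D n)" using assms by (simp add: approx_seq_def)
  show "0 < W n x" using assms eps by (auto simp: approx_seq_def intro: less_le_trans)
  assume x: "norm x \<le> r"
  have "(\<lambda>n. W n x - w x) \<longlonglongrightarrow> 0"
  proof (rule Lim_null_comparison)
    show "\<forall>\<^sub>F n in sequentially. norm (W n x - w x) \<le> 1 / real (Suc n)"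
      using assms x by (auto simp: approx_seq_def less_imp_le)
    show "(\<lambda>n. 1 / real (Suc n)) \<longlonglongrightarrow> 0"
      using LIMSEQ_inverse_real_of_nat by (simp add: inverse_eq_divide)
  qed
  then show "(\<lambda>n. W n x) \<longlonglongrightarrow> w x" by (simp add: LIM_zero_iff)
qed

lemma comp_cont:
  fixes k :: "real \<Rightarrow> real"
  assumes "continuous_on {0<..} k" "continuous_on UNIV v" "\<And>x. 0 < v x"
  shows "continuous_on UNIV (\<lambda>x::'a. k (v x))" "(\<lambda>x. k (v x)) \<in> borel_measurable lebesgue"
proof -
  show c: "continuous_on UNIV (\<lambda>x. k (v x))"
    using assms by (intro continuous_on_compose2[of "{0<..}" k UNIV v]) auto
  show "(\<lambda>x. k (v x)) \<in> borel_measurable lebesgue"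
    by (intro borel_measurable_imp_lebesgue borel_measurable_continuous_onI c)
qed

text \<open>The gradient information sits in the fixed integrable weight q; only the bounded factor
  \<open>k (W n x)\<close> varies, and it converges pointwise.\<close>

lemma approx_seq_comp_limit:
  fixes k :: "real \<Rightarrow> real" and q :: "'a \<Rightarrow> real"
  assumes A: "approx_seq r W D" and k: "continuous_on {0<..} k"
    and q: "integrable lebesgue q" "\<And>x. r < norm x \<Longrightarrow> q x = 0"
  shows "(\<lambda>n. \<integral>x. k (W n x) * q x \<partial>lebesgue) \<longlonglongrightarrow> (\<integral>x. k (w x) * q x \<partial>lebesgue)"
    and "integrable lebesgue (\<lambda>x. k (w x) * q x)" and "integrable lebesgue (\<lambda>x. k (W n x) * q x)"
proof -
  obtain M where M: "M > 0" "\<And>n x. norm x \<le> r \<Longrightarrow> \<bar>k (W n x)\<bar> \<le> M" "\<And>x. norm x \<le> r \<Longrightarrow> \<bar>k (w x)\<bar> \<le> M"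
    by (rule approx_seq_comp_bounded[OF A k]) blast
  have m: "(\<lambda>x. k (w x)) \<in> borel_measurable lebesgue" "(\<lambda>x. k (W n x)) \<in> borel_measurable lebesgue" for n
    using comp_cont(2)[OF k w_cont w_pos] comp_cont(2)[OF k C1_gradD(3)[OF approx_seq_D(1)[OF A]] approx_seq_D(2)[OF A]] by auto
  have qm: "q \<in> borel_measurable lebesgue" using q(1) by auto
  have i: "integrable lebesgue (\<lambda>x. M * \<bar>q x\<bar>)" using q(1) by simp
  have le: "norm (k (W n x) * q x) \<le> M * \<bar>q x\<bar>" "norm (k (w x) * q x) \<le> M * \<bar>q x\<bar>" for n x
    using M(2)[of x n] M(3)[of x] q(2)[of x] by (cases "norm x \<le> r"; auto simp: abs_mult intro: mult_right_mono)+
  have le': "norm (k (W n x) * q x) \<le> norm (M * \<bar>q x\<bar>)" "norm (k (w x) * q x) \<le> norm (M * \<bar>q x\<bar>)" for n x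
    using le(1)[of n x] le(2)[of x] by auto
  show "integrable lebesgue (\<lambda>x. k (w x) * q x)"
    by (rule Bochner_Integration.integrable_bound[OF i]) (intro borel_measurable_times m qm, intro AE_I2 le')
  show "integrable lebesgue (\<lambda>x. k (W n x) * q x)"
    by (rule Bochner_Integration.integrable_bound[OF i]) (intro borel_measurable_times m qm, intro AE_I2 le')
  show "(\<lambda>n. \<integral>x. k (W n x) * q x \<partial>lebesgue) \<longlonglongrightarrow> (\<integral>x. k (w x) * q x \<partial>lebesgue)"
  proof (rule integral_dominated_convergence[OF _ _ i])
    show "AE x in lebesgue. (\<lambda>n. k (W n x) * q x) \<longlonglongrightarrow> k (w x) * q x"
    proof (rule AE_I2)
      fix x
      show "(\<lambda>n. k (W n x) * q x) \<longlonglongrightarrow> k (w x) * q x"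
      proof (cases "norm x \<le> r")
        case True
        have "isCont k (w x)" using k w_pos[of x] by (simp add: continuous_on_eq_continuous_at)
        then have "(\<lambda>n. k (W n x)) \<longlonglongrightarrow> k (w x)"
          using approx_seq_D(3)[OF A True] by (rule isCont_tendsto_compose)
        then show ?thesis by (intro tendsto_intros)
      qed (simp add: q(2))
    qed
    show "AE x in lebesgue. norm (k (W n x) * q x) \<le> M * \<bar>q x\<bar>" for n by (intro AE_I2 le)
  qed (intro borel_measurable_times m qm)+
qed

lemma approx_seq_diff_integrable:
  assumes A: "approx_seq r W D"
  shows "integrable lebesgue (\<lambda>x. indicator (cball 0 r) x * norm (D n x - G x) powr p)"
proof -
  have [measurable]: "D n \<in> borel_measurable lebesgue" for n
    using C1_gradD(5)[OF approx_seq_D(1)[OF A]] by (rule borel_measurable_imp_lebesgue)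
  have [measurable]: "cball (0::'a) r \<in> sets lebesgue" by simp
    obtain MD where MD: "\<And>x. norm x \<le> r \<Longrightarrow> norm (D n x) \<le> MD"
    proof -
      have "bounded (D n ` cball 0 r)"
        using C1_gradD(2)[OF approx_seq_D(1)[OF A]] by (intro compact_imp_bounded compact_continuous_image) auto
      then obtain M where "\<forall>y\<in>D n ` cball 0 r. norm y \<le> M" unfolding bounded_iff by blast
      then show ?thesis using that[of M] by simp
    qed
    show ?thesis
    proof (rule integrable_dominated[where C = "2 powr p * (MD powr p + 1)" and r = r])
      fix x
      show "\<bar>indicator (cball 0 r) x * norm (D n x - G x) powr p\<bar> \<le> 2 powr p * (MD powr p + 1) * (1 + norm (G x) powr p)"
      proof (cases "norm x \<le> r")
        case True
        have "norm (D n x - G x) powr p \<le> 2 powr p * (norm (D n x - 0) powr p + norm (0 - G x) powr p)"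
          using p by (intro norm_diff_powr_le) auto
        also have "\<dots> \<le> 2 powr p * (MD powr p + norm (G x) powr p)"
          using p MD[OF True] by (auto intro!: powr_mono2)
        also have "\<dots> \<le> 2 powr p * ((MD powr p + 1) * (1 + norm (G x) powr p))"
          by (intro mult_left_mono) (auto simp: algebra_simps)
        finally show ?thesis using True by (simp add: mult_ac)
      qed simp
    qed (simp_all)
qed

lemma C1_grad_comp_mult:
  assumes h: "\<And>s. 0 < s \<Longrightarrow> (h has_real_derivative h' s) (at s)" "continuous_on {0<..} h'"
    and v: "C1_grad v D" "\<And>x. 0 < v x" and \<zeta>: "C1_grad \<zeta> Z"
  shows "C1_grad (\<lambda>x. h (v x) * \<zeta> x) (\<lambda>x. (h' (v x) * \<zeta> x) *\<^sub>R D x + h (v x) *\<^sub>R Z x)"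
proof -
  have "C1_grad (\<lambda>x. h (v x)) (\<lambda>x. h' (v x) *\<^sub>R D x)"
    unfolding C1_grad_def
  proof (intro conjI allI)
    show "continuous_on UNIV (\<lambda>x. h' (v x) *\<^sub>R D x)"
      by (intro continuous_on_scaleR C1_gradD(2)[OF v(1)] continuous_on_compose2[OF h(2) C1_gradD(3)[OF v(1)]])
        (use v(2) in \<open>auto simp: image_subset_iff\<close>)
    show "((\<lambda>x. h (v x)) has_derivative (\<bullet>) (h' (v x) *\<^sub>R D x)) (at x)" for x
    proof -
      have "((\<lambda>x. h (v x)) has_derivative (\<lambda>a. h' (v x) * (D x \<bullet> a))) (at x)"
        by (rule has_derivative_compose[OF C1_gradD(1)[OF v(1)] h(1)[OF v(2), unfolded has_field_derivative_def]])
      then show ?thesis by (rule has_derivative_eq_rhs) (auto simp: fun_eq_iff)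
    qed
  qed
  from C1_grad_mult[OF this \<zeta>] show ?thesis by (simp add: add.commute mult.commute)
qed

lemma cont_of_deriv:
  assumes "\<And>s. 0 < s \<Longrightarrow> (h has_real_derivative h' s) (at s)"
  shows "continuous_on {0<..} h"
  using assms by (auto intro!: continuous_at_imp_continuous_on DERIV_isCont)

text \<open>Testing with h(w) zeta is justified by testing with h(W_n) zeta, which is C1. The
  gradients of W_n converge only in L^p on a ball, and this is enough because F is in L^(p')
  there.\<close>

lemma test_comp:
  assumes h: "\<And>s. 0 < s \<Longrightarrow> (h has_real_derivative h' s) (at s)" "continuous_on {0<..} h'" "\<And>s. 0 < s \<Longrightarrow> 0 \<le> h s"
    and \<zeta>: "C1_grad \<zeta> Z" "\<And>x. 0 \<le> \<zeta> x" "\<And>x. r < norm x \<Longrightarrow> \<zeta> x = 0"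
  shows "(\<integral>x. h' (w x) * (\<zeta> x * (F x \<bullet> G x)) \<partial>lebesgue) + (\<integral>x. h (w x) * (F x \<bullet> Z x) \<partial>lebesgue)
      = (\<integral>x. h (w x) * (g x * \<zeta> x) \<partial>lebesgue)"
    and "integrable lebesgue (\<lambda>x. h' (w x) * (\<zeta> x * (F x \<bullet> G x)))"
    and "integrable lebesgue (\<lambda>x. h (w x) * (F x \<bullet> Z x))"
    and "integrable lebesgue (\<lambda>x. h (w x) * (g x * \<zeta> x))"
proof -
  obtain W D where A: "approx_seq r W D" using approx_seq_exists by blast
  have Z0: "Z x = 0" if "r < norm x" for x using C1_grad_support[OF \<zeta>(1) _ that] \<zeta>(3) by simp
  note hc = cont_of_deriv[OF h(1)]
  obtain M\<zeta> where M\<zeta>: "M\<zeta> > 0" "\<And>x. norm (\<zeta> x) \<le> M\<zeta>"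
    using continuous_compact_support_bounded[OF C1_gradD(3)[OF \<zeta>(1)] \<zeta>(3)] by metis
  obtain MZ where MZ: "MZ > 0" "\<And>x. norm (Z x) \<le> MZ"
    using continuous_compact_support_bounded[OF C1_gradD(2)[OF \<zeta>(1)] Z0] by metis
  have [measurable]: "\<zeta> \<in> borel_measurable lebesgue" "Z \<in> borel_measurable lebesgue" "g \<in> borel_measurable lebesgue"
    using C1_gradD(4,5)[OF \<zeta>(1)] g_cont
    by (auto intro!: borel_measurable_imp_lebesgue borel_measurable_continuous_onI)
  have Dm[measurable]: "D n \<in> borel_measurable lebesgue" for n
    using C1_gradD(5)[OF approx_seq_D(1)[OF A]] by (rule borel_measurable_imp_lebesgue)
  have [measurable]: "cball (0::'a) r \<in> sets lebesgue" by simp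
  have q1: "integrable lebesgue (\<lambda>x. \<zeta> x * (F x \<bullet> G x))"
  proof (rule integrable_dominated[where C = "M\<zeta> * c\<^sub>F" and r = r])
    fix x
    have "\<bar>\<zeta> x * (F x \<bullet> G x)\<bar> \<le> M\<zeta> * (norm (F x) * norm (G x))"
      unfolding abs_mult using M\<zeta> Cauchy_Schwarz_ineq2[of "F x" "G x"] by (intro mult_mono) auto
    also have "\<dots> \<le> M\<zeta> * (c\<^sub>F * (1 + norm (G x) powr p))"
      using M\<zeta> norm_F_G_le by (intro mult_left_mono) auto
    finally show "\<bar>\<zeta> x * (F x \<bullet> G x)\<bar> \<le> M\<zeta> * c\<^sub>F * (1 + norm (G x) powr p)" by (simp add: mult_ac)
  qed (simp_all add: \<zeta>(3))
  have q2: "integrable lebesgue (\<lambda>x. F x \<bullet> Z x)"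
  proof (rule integrable_dominated[where C = "MZ * c\<^sub>F" and r = r])
    fix x
    have "\<bar>F x \<bullet> Z x\<bar> \<le> norm (F x) * norm (Z x)" by (rule Cauchy_Schwarz_ineq2)
    also have "\<dots> \<le> (c\<^sub>F * (1 + norm (G x) powr p)) * MZ"
      using MZ norm_F_le[of x] c\<^sub>F_pos by (intro mult_mono) auto
    finally show "\<bar>F x \<bullet> Z x\<bar> \<le> MZ * c\<^sub>F * (1 + norm (G x) powr p)" by (simp add: mult_ac)
  qed (simp_all add: Z0)
  have q3: "integrable lebesgue (\<lambda>x. g x * \<zeta> x)"
  proof -
    have "integrable lborel (\<lambda>x. g x * \<zeta> x)"
      using g_cont C1_gradD(3)[OF \<zeta>(1)] \<zeta>(3)
      by (intro integrable_continuous_compact_support[of _ r]) (auto intro!: continuous_intros)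
    then show ?thesis by (subst integrable_completion) auto
  qed
  note L1 = approx_seq_comp_limit[OF A h(2) q1] and L2 = approx_seq_comp_limit[OF A hc q2] and L3 = approx_seq_comp_limit[OF A hc q3]
  show I: "integrable lebesgue (\<lambda>x. h' (w x) * (\<zeta> x * (F x \<bullet> G x)))"
    "integrable lebesgue (\<lambda>x. h (w x) * (F x \<bullet> Z x))" "integrable lebesgue (\<lambda>x. h (w x) * (g x * \<zeta> x))"
    using L1(2) L2(2) L3(2) \<zeta>(3) Z0 by auto
  obtain M' where M': "M' > 0" "\<And>n x. norm x \<le> r \<Longrightarrow> \<bar>h' (W n x)\<bar> \<le> M'"
    by (rule approx_seq_comp_bounded[OF A h(2)]) blast
  \<comment> \<open>The exact cost of replacing the gradient \<open>D n\<close> by G in the tested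
    equation. All other terms contain G alone and converge by \<open>approx_seq_comp_limit\<close>,
    while the Hoelder inequality sends this one to zero.\<close>
  define e where "e = (\<lambda>n. \<integral>x. (h' (W n x) * \<zeta> x) * (F x \<bullet> (D n x - G x)) \<partial>lebesgue)"
  define P where "P = (\<integral>x. indicator (cball 0 r) x * norm (F x) powr (p / (p - 1)) \<partial>lebesgue)"
  note fD = approx_seq_diff_integrable[OF A]
  have eH: "integrable lebesgue (\<lambda>x. indicator (cball 0 r) x * (norm (D n x - G x) * norm (F x)))"
    "(\<integral>x. indicator (cball 0 r) x * (norm (D n x - G x) * norm (F x)) \<partial>lebesgue) \<le>
      (1 / real (Suc n)) powr (1 / p) * P powr (1 - 1 / p)" for n
  proof -
    have \<theta>: "0 < 1 / p" "1 / p < 1" using p by auto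
    have eq: "(indicator (cball 0 r) x * norm (D n x - G x) powr p) powr (1 / p) *
      (indicator (cball 0 r) x * norm (F x) powr (p / (p - 1))) powr (1 - 1 / p) = indicator (cball 0 r) x * (norm (D n x - G x) * norm (F x))" for x
    proof -
      have "p / (p - 1) * (1 - 1 / p) = 1" using p by (simp add: field_simps)
      then show ?thesis using p by (auto simp: indicator_def powr_powr)
    qed
    note H = Holder_powr[OF fD[of n] _ F_powr_integrable[of r] _ \<theta>, unfolded eq]
    show "integrable lebesgue (\<lambda>x. indicator (cball 0 r) x * (norm (D n x - G x) * norm (F x)))"
      using H(1) by simp
    have "(\<integral>x. indicator (cball 0 r) x * (norm (D n x - G x) * norm (F x)) \<partial>lebesgue) \<le>
       (\<integral>x. indicator (cball 0 r) x * norm (D n x - G x) powr p \<partial>lebesgue) powr (1 / p) * P powr (1 - 1 / p)"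
      using H(2) by (simp add: P_def)
    also have "\<dots> \<le> (1 / real (Suc n)) powr (1 / p) * P powr (1 - 1 / p)"
      using A p by (intro mult_right_mono powr_mono2) (auto simp: approx_seq_def less_imp_le intro!: Bochner_Integration.integral_nonneg)
    finally show "(\<integral>x. indicator (cball 0 r) x * (norm (D n x - G x) * norm (F x)) \<partial>lebesgue) \<le>
      (1 / real (Suc n)) powr (1 / p) * P powr (1 - 1 / p)" .
  qed
  have hWm: "(\<lambda>x. h' (W n x)) \<in> borel_measurable lebesgue" for n
    using comp_cont(2)[OF h(2) C1_gradD(3)[OF approx_seq_D(1)[OF A]] approx_seq_D(2)[OF A]] .
  have ebd: "norm ((h' (W n x) * \<zeta> x) * (F x \<bullet> (D n x - G x))) \<le>
      (M' * M\<zeta>) * (indicator (cball 0 r) x * (norm (D n x - G x) * norm (F x)))" for n x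
  proof (cases "norm x \<le> r")
    case True
    have "norm ((h' (W n x) * \<zeta> x) * (F x \<bullet> (D n x - G x))) = (\<bar>h' (W n x)\<bar> * \<bar>\<zeta> x\<bar>) * \<bar>F x \<bullet> (D n x - G x)\<bar>"
      by (simp add: abs_mult)
    also have "\<dots> \<le> (M' * M\<zeta>) * (norm (F x) * norm (D n x - G x))"
      using M'(2)[OF True] M\<zeta>(2)[of x] M'(1) M\<zeta>(1) by (intro mult_mono Cauchy_Schwarz_ineq2) auto
    finally show ?thesis using True by (simp add: mult_ac)
  qed (simp add: \<zeta>(3))
  have ei: "integrable lebesgue (\<lambda>x. (h' (W n x) * \<zeta> x) * (F x \<bullet> (D n x - G x)))" for n
  proof (rule Bochner_Integration.integrable_bound)
    show "integrable lebesgue (\<lambda>x. (M' * M\<zeta>) * (indicator (cball 0 r) x * (norm (D n x - G x) * norm (F x))))"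
      using eH(1) by simp
    show "AE x in lebesgue. norm ((h' (W n x) * \<zeta> x) * (F x \<bullet> (D n x - G x))) \<le> norm ((M' * M\<zeta>) * (indicator (cball 0 r) x * (norm (D n x - G x) * norm (F x))))"
      by (intro AE_I2 order_trans[OF ebd]) simp
    show "(\<lambda>x. (h' (W n x) * \<zeta> x) * (F x \<bullet> (D n x - G x))) \<in> borel_measurable lebesgue"
      using hWm[of n] by (intro borel_measurable_times borel_measurable_inner borel_measurable_diff) simp_all
  qed
  have e0: "e \<longlonglongrightarrow> 0"
  proof (rule Lim_null_comparison)
    show "\<forall>\<^sub>F n in sequentially. norm (e n) \<le> (M' * M\<zeta>) * ((1 / real (Suc n)) powr (1 / p) * P powr (1 - 1 / p))"
    proof (rule always_eventually, rule allI)
      fix n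
      have "norm (e n) \<le> (\<integral>x. (M' * M\<zeta>) * (indicator (cball 0 r) x * (norm (D n x - G x) * norm (F x))) \<partial>lebesgue)"
        unfolding e_def using ei eH(1) ebd by (intro Bochner_Integration.integral_norm_bound_integral) auto
      also have "\<dots> \<le> (M' * M\<zeta>) * ((1 / real (Suc n)) powr (1 / p) * P powr (1 - 1 / p))"
        using eH(2)[of n] M' M\<zeta> by (simp add: mult_left_mono)
      finally show "norm (e n) \<le> (M' * M\<zeta>) * ((1 / real (Suc n)) powr (1 / p) * P powr (1 - 1 / p))" .
    qed
    have "(\<lambda>n. 1 / real (Suc n)) \<longlonglongrightarrow> 0"
      using LIMSEQ_inverse_real_of_nat by (simp add: inverse_eq_divide)
    then have "(\<lambda>n. (1 / real (Suc n)) powr (1 / p)) \<longlonglongrightarrow> 0 powr (1 / p)"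
      using p by (intro tendsto_powr') auto
    then show "(\<lambda>n. (M' * M\<zeta>) * ((1 / real (Suc n)) powr (1 / p) * P powr (1 - 1 / p))) \<longlonglongrightarrow> 0"
      by (auto intro!: tendsto_mult_right_zero tendsto_mult_left_zero)
  qed
  have eqn: "e n + (\<integral>x. h' (W n x) * (\<zeta> x * (F x \<bullet> G x)) \<partial>lebesgue) + (\<integral>x. h (W n x) * (F x \<bullet> Z x) \<partial>lebesgue)
    = (\<integral>x. h (W n x) * (g x * \<zeta> x) \<partial>lebesgue)" for n
  proof -
    note C = C1_grad_comp_mult[OF h(1,2) approx_seq_D(1,2)[OF A] \<zeta>(1)]
    have "(LINT x|lebesgue. F x \<bullet> ((h' (W n x) * \<zeta> x) *\<^sub>R D n x + h (W n x) *\<^sub>R Z x)) = (LINT x|lebesgue. g x * (h (W n x) * \<zeta> x))"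
      using h(3)[OF approx_seq_D(2)[OF A]] \<zeta>(2,3) by (intro weak_eq[OF C, where r = r]) auto
    also have "(LINT x|lebesgue. F x \<bullet> ((h' (W n x) * \<zeta> x) *\<^sub>R D n x + h (W n x) *\<^sub>R Z x))
      = (LINT x|lebesgue. (h' (W n x) * \<zeta> x) * (F x \<bullet> (D n x - G x)) + h' (W n x) * (\<zeta> x * (F x \<bullet> G x)) + h (W n x) * (F x \<bullet> Z x))"
      by (intro Bochner_Integration.integral_cong) (auto simp: inner_add_right inner_diff_right algebra_simps)
    also have "\<dots> = e n + (\<integral>x. h' (W n x) * (\<zeta> x * (F x \<bullet> G x)) \<partial>lebesgue) + (\<integral>x. h (W n x) * (F x \<bullet> Z x) \<partial>lebesgue)"
      unfolding e_def using ei L1(3) L2(3) \<zeta>(3) Z0 by (simp add: Bochner_Integration.integral_add)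
    finally show ?thesis by (simp add: mult_ac)
  qed
  have "(\<lambda>n. e n + (\<integral>x. h' (W n x) * (\<zeta> x * (F x \<bullet> G x)) \<partial>lebesgue) + (\<integral>x. h (W n x) * (F x \<bullet> Z x) \<partial>lebesgue))
    \<longlonglongrightarrow> 0 + (\<integral>x. h' (w x) * (\<zeta> x * (F x \<bullet> G x)) \<partial>lebesgue) + (\<integral>x. h (w x) * (F x \<bullet> Z x) \<partial>lebesgue)"
    using L1(1) L2(1) e0 \<zeta>(3) Z0 by (intro tendsto_add) auto
  then have "(\<lambda>n. (\<integral>x. h (W n x) * (g x * \<zeta> x) \<partial>lebesgue))
    \<longlonglongrightarrow> 0 + (\<integral>x. h' (w x) * (\<zeta> x * (F x \<bullet> G x)) \<partial>lebesgue) + (\<integral>x. h (w x) * (F x \<bullet> Z x) \<partial>lebesgue)"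
    unfolding eqn .
  moreover have "(\<lambda>n. (\<integral>x. h (W n x) * (g x * \<zeta> x) \<partial>lebesgue)) \<longlonglongrightarrow> (\<integral>x. h (w x) * (g x * \<zeta> x) \<partial>lebesgue)"
    using L3(1) \<zeta>(3) by auto
  ultimately show "(\<integral>x. h' (w x) * (\<zeta> x * (F x \<bullet> G x)) \<partial>lebesgue) + (\<integral>x. h (w x) * (F x \<bullet> Z x) \<partial>lebesgue)
      = (\<integral>x. h (w x) * (g x * \<zeta> x) \<partial>lebesgue)"
    using LIMSEQ_unique by fastforce
qed

end

section \<open>Translation differences and a Nash-type inequality\<close>

text \<open>The increment is the average of D . z along a segment; Jensen's inequality in the
  segment parameter, Tonelli's theorem and translation invariance give the bound with constant
  1.\<close>

lemma C1_difference_Lp: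
  fixes f :: "'a::euclidean_space \<Rightarrow> real"
  assumes f: "C1_grad f D" and p: "p > 1"
  shows "(\<integral>\<^sup>+x. ennreal (\<bar>f (x + z) - f x\<bar> powr p) \<partial>lborel)
    \<le> ennreal (norm z powr p) * (\<integral>\<^sup>+x. ennreal (norm (D x) powr p) \<partial>lborel)"
proof -
  note [measurable] = C1_gradD(4,5)[OF f]
  let ?I = "indicator {0..1} :: real \<Rightarrow> real"
  have pt: "ennreal (\<bar>f (x + z) - f x\<bar> powr p)
    \<le> (\<integral>\<^sup>+s. ennreal (norm z powr p) * (ennreal (?I s) * ennreal (norm (D (x + s *\<^sub>R z)) powr p)) \<partial>lborel)" for x
  proof -
    have cont: "continuous_on UNIV (\<lambda>s. D (x + s *\<^sub>R z) \<bullet> z)"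
      by (intro continuous_on_inner continuous_on_compose2[OF C1_gradD(2)[OF f, of UNIV]]
          continuous_on_add continuous_on_scaleR continuous_on_const continuous_on_id) auto
    have "(\<integral>s. ?I s *\<^sub>R (D (x + s *\<^sub>R z) \<bullet> z) \<partial>lborel) = f (x + 1 *\<^sub>R z) - f (x + 0 *\<^sub>R z)"
    proof (rule integral_FTC_Icc)
      show "((\<lambda>s. f (x + s *\<^sub>R z)) has_vector_derivative D (x + s *\<^sub>R z) \<bullet> z) (at s within {0..1})" for s
        unfolding has_real_derivative_iff_has_vector_derivative[symmetric]
        by (rule DERIV_subset[OF C1_grad_path_deriv[OF f]]) simp
      show "continuous_on {0..1} (\<lambda>s. D (x + s *\<^sub>R z) \<bullet> z)"
        by (rule continuous_on_subset[OF cont]) simp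
    qed simp
    moreover have "ennreal (norm ((\<integral>s. ?I s *\<^sub>R (D (x + s *\<^sub>R z) \<bullet> z) \<partial>lborel) - 0) powr p)
      \<le> (\<integral>\<^sup>+s. ennreal (?I s * norm ((D (x + s *\<^sub>R z) \<bullet> z) - 0) powr p) \<partial>lborel)"
      by (rule norm_average_diff_powr_le) (use p in auto)
    moreover have "(\<integral>\<^sup>+s. ennreal (?I s * norm ((D (x + s *\<^sub>R z) \<bullet> z) - 0) powr p) \<partial>lborel)
      \<le> (\<integral>\<^sup>+s. ennreal (norm z powr p) * (ennreal (?I s) * ennreal (norm (D (x + s *\<^sub>R z)) powr p)) \<partial>lborel)"
    proof (rule nn_integral_mono)
      fix s :: real
      have "\<bar>D (x + s *\<^sub>R z) \<bullet> z\<bar> powr p \<le> (norm (D (x + s *\<^sub>R z)) * norm z) powr p"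
        using p by (intro powr_mono2 Cauchy_Schwarz_ineq2) auto
      then have "?I s * norm ((D (x + s *\<^sub>R z) \<bullet> z) - 0) powr p \<le> norm z powr p * (?I s * norm (D (x + s *\<^sub>R z)) powr p)"
        by (auto simp: indicator_def powr_mult mult_ac)
      then show "ennreal (?I s * norm ((D (x + s *\<^sub>R z) \<bullet> z) - 0) powr p)
        \<le> ennreal (norm z powr p) * (ennreal (?I s) * ennreal (norm (D (x + s *\<^sub>R z)) powr p))"
        by (simp flip: ennreal_mult' add: ennreal_leI)
    qed
    ultimately show ?thesis by simp
  qed
  have "(\<integral>\<^sup>+x. ennreal (\<bar>f (x + z) - f x\<bar> powr p) \<partial>lborel)
    \<le> (\<integral>\<^sup>+x. (\<integral>\<^sup>+s. ennreal (norm z powr p) * (ennreal (?I s) * ennreal (norm (D (x + s *\<^sub>R z)) powr p)) \<partial>lborel) \<partial>lborel)"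
    using pt by (intro nn_integral_mono) auto
  also have "\<dots> = (\<integral>\<^sup>+s. (\<integral>\<^sup>+x. ennreal (norm z powr p) * (ennreal (?I s) * ennreal (norm (D (x + s *\<^sub>R z)) powr p)) \<partial>lborel) \<partial>lborel)"
    by (rule lborel_pair.Fubini') measurable
  also have "\<dots> = (\<integral>\<^sup>+s. ennreal (norm z powr p) * (ennreal (?I s) * (\<integral>\<^sup>+x. ennreal (norm (D x) powr p) \<partial>lborel)) \<partial>lborel)"
  proof (rule nn_integral_cong)
    fix s :: real
    have "(\<integral>\<^sup>+x. ennreal (norm (D (x + s *\<^sub>R z)) powr p) \<partial>lborel) = (\<integral>\<^sup>+x. ennreal (norm (D x) powr p) \<partial>lborel)"
      using lborel_nn_integral_shift(1)[of "\<lambda>x. ennreal (norm (D x) powr p)" "s *\<^sub>R z"] by (simp add: add.commute)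
    then show "(\<integral>\<^sup>+x. ennreal (norm z powr p) * (ennreal (?I s) * ennreal (norm (D (x + s *\<^sub>R z)) powr p)) \<partial>lborel)
      = ennreal (norm z powr p) * (ennreal (?I s) * (\<integral>\<^sup>+x. ennreal (norm (D x) powr p) \<partial>lborel))"
      by (simp add: nn_integral_cmult)
  qed
  also have "\<dots> = ennreal (norm z powr p) * ((\<integral>\<^sup>+s. ennreal (?I s) \<partial>lborel) * (\<integral>\<^sup>+x. ennreal (norm (D x) powr p) \<partial>lborel))"
    by (simp add: nn_integral_cmult nn_integral_multc)
  also have "(\<integral>\<^sup>+s. ennreal (?I s) \<partial>lborel) = 1" by (simp add: ennreal_indicator)
  finally show ?thesis by simp
qed

lemma integrable_powr_compact_support:
  fixes f :: "'a::euclidean_space \<Rightarrow> 'b::euclidean_space"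
  assumes "continuous_on UNIV f" "\<And>x. r < norm x \<Longrightarrow> f x = 0" "p > 0"
  shows "integrable lborel (\<lambda>x. norm (f x) powr p)"
  using assms by (intro integrable_continuous_compact_support[of _ r] continuous_on_powr' continuous_on_norm continuous_on_const) auto

lemma C1_difference_Lp_real:
  fixes f :: "'a::euclidean_space \<Rightarrow> real"
  assumes f: "C1_grad f D" and p: "p > 1" and z: "\<And>x. r < norm x \<Longrightarrow> f x = 0"
  shows "(\<integral>x. \<bar>f (x + z) - f x\<bar> powr p \<partial>lborel) \<le> norm z powr p * (\<integral>x. norm (D x) powr p \<partial>lborel)"
proof -
  have Dz: "D x = 0" if "r < norm x" for x using C1_grad_support[OF f _ that] z by simp
  have fz: "f (x + z) - f x = 0" if "r + norm z < norm x" for x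
  proof -
    have "norm x \<le> norm (x + z) + norm z" using norm_triangle_ineq4[of "x + z" z] by simp
    then show ?thesis using that z[of x] z[of "x + z"] norm_ge_zero[of z] by auto
  qed
  have i1: "integrable lborel (\<lambda>x. norm (f (x + z) - f x) powr p)"
    using p fz C1_gradD(3)[OF f, of UNIV]
    by (intro integrable_powr_compact_support[of _ "r + norm z"])
      (auto intro!: continuous_intros continuous_on_compose2[of UNIV f])
  have i2: "integrable lborel (\<lambda>x. norm (D x) powr p)"
    using p Dz C1_gradD(2)[OF f] by (intro integrable_powr_compact_support[of _ r]) auto
  have "ennreal (\<integral>x. \<bar>f (x + z) - f x\<bar> powr p \<partial>lborel) \<le> ennreal (norm z powr p) * ennreal (\<integral>x. norm (D x) powr p \<partial>lborel)"
    using C1_difference_Lp[OF f p, of z] i1 i2 by (simp add: nn_integral_eq_integral)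
  then show ?thesis
    by (simp flip: ennreal_mult' add: Bochner_Integration.integral_nonneg)
qed

context weak_sol
begin

text \<open>The translation bound is proved for the C1 functions h(W_n) zeta and only the resulting
  inequality is passed to the limit. Thus the weak gradient of h(w) zeta never has to be
  identified.\<close>

lemma comp_difference:
  assumes h: "\<And>s. 0 < s \<Longrightarrow> (h has_real_derivative h' s) (at s)" "continuous_on {0<..} h'"
    and \<zeta>: "C1_grad \<zeta> Z" "\<And>x. r < norm x \<Longrightarrow> \<zeta> x = 0"
  defines "f \<equiv> \<lambda>x. h (w x) * \<zeta> x"
  defines "E \<equiv> 4 powr p * (\<integral>x. \<bar>h' (w x)\<bar> powr p * (\<bar>\<zeta> x\<bar> powr p * norm (G x) powr p) \<partial>lebesgue)
      + 2 powr p * (\<integral>x. \<bar>h (w x)\<bar> powr p * norm (Z x) powr p \<partial>lebesgue)"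
  shows "(\<integral>x. \<bar>f (x + z) - f x\<bar> powr p \<partial>lborel) \<le> norm z powr p * E"
proof -
  obtain W D where A: "approx_seq r W D" using approx_seq_exists by blast
  have Z0: "Z x = 0" if "r < norm x" for x using C1_grad_support[OF \<zeta>(1) _ that] \<zeta>(2) by simp
  note hc = cont_of_deriv[OF h(1)]
  obtain M\<zeta> where M\<zeta>: "M\<zeta> > 0" "\<And>x. norm (\<zeta> x) \<le> M\<zeta>"
    using continuous_compact_support_bounded[OF C1_gradD(3)[OF \<zeta>(1)] \<zeta>(2)] by metis
  have \<zeta>m[measurable]: "\<zeta> \<in> borel_measurable lebesgue" "Z \<in> borel_measurable lebesgue"
    using C1_gradD(4,5)[OF \<zeta>(1)] by (auto intro!: borel_measurable_imp_lebesgue)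
  define q1 where "q1 = (\<lambda>x. \<bar>\<zeta> x\<bar> powr p * norm (G x) powr p)"
  define q2 where "q2 = (\<lambda>x. norm (Z x) powr p)"
  have q1i: "integrable lebesgue q1"
    unfolding q1_def
  proof (rule integrable_dominated[where C = "M\<zeta> powr p" and r = r])
    fix x
    have "\<bar>\<zeta> x\<bar> powr p \<le> M\<zeta> powr p" using M\<zeta>(2)[of x] p by (intro powr_mono2) auto
    then have "\<bar>\<zeta> x\<bar> powr p * norm (G x) powr p \<le> M\<zeta> powr p * (1 + norm (G x) powr p)"
      by (intro mult_mono) auto
    then show "\<bar>\<bar>\<zeta> x\<bar> powr p * norm (G x) powr p\<bar> \<le> M\<zeta> powr p * (1 + norm (G x) powr p)" by simp
  qed (use \<zeta>(2) in auto)
  have q10: "q1 x = 0" if "r < norm x" for x using \<zeta>(2)[OF that] by (simp add: q1_def)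
  have q2i: "integrable lebesgue q2"
  proof -
    have "integrable lborel q2"
      unfolding q2_def using p C1_gradD(2)[OF \<zeta>(1)] Z0 by (intro integrable_powr_compact_support[of _ r]) auto
    then show ?thesis by (subst integrable_completion) auto
  qed
  have q20: "q2 x = 0" if "r < norm x" for x using Z0[OF that] by (simp add: q2_def)
  have k1: "continuous_on {0<..} (\<lambda>s. \<bar>h' s\<bar> powr p)" and k2: "continuous_on {0<..} (\<lambda>s. \<bar>h s\<bar> powr p)"
    using p h(2) hc by (auto intro!: continuous_on_powr' continuous_on_rabs continuous_on_const)
  note L1 = approx_seq_comp_limit[OF A k1 q1i q10] and L2 = approx_seq_comp_limit[OF A k2 q2i q20]
  obtain M1 where M1: "M1 > 0" "\<And>n x. norm x \<le> r \<Longrightarrow> \<bar>h' (W n x)\<bar> \<le> M1"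
    by (rule approx_seq_comp_bounded[OF A h(2)]) blast
  obtain M2 where M2: "M2 > 0" "\<And>n x. norm x \<le> r \<Longrightarrow> \<bar>h (W n x)\<bar> \<le> M2"
    using approx_seq_comp_bounded[OF A hc] by metis
  define fn where "fn = (\<lambda>n x. h (W n x) * \<zeta> x)"
  define Dn where "Dn = (\<lambda>n x. (h' (W n x) * \<zeta> x) *\<^sub>R D n x + h (W n x) *\<^sub>R Z x)"
  have C: "C1_grad (fn n) (Dn n)" for n
    unfolding fn_def Dn_def using C1_grad_comp_mult[OF h approx_seq_D(1,2)[OF A] \<zeta>(1)] .
  have fn0: "fn n x = 0" if "r < norm x" for n x using \<zeta>(2)[OF that] by (simp add: fn_def)
  have Dn0: "Dn n x = 0" if "r < norm x" for n x using \<zeta>(2)[OF that] Z0[OF that] by (simp add: Dn_def)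
  \<comment> \<open>Weight of the gradient error |D_n - G|^p. The factor \<open>4 powr p\<close>
    comes from splitting first by the product rule and then by D_n = (D_n - G) + G.\<close>
  define B where "B = 4 powr p * (M1 * M\<zeta>) powr p"
  define En where "En = (\<lambda>n. B * (1 / real (Suc n)) + 4 powr p * (\<integral>x. \<bar>h' (W n x)\<bar> powr p * q1 x \<partial>lebesgue)
      + 2 powr p * (\<integral>x. \<bar>h (W n x)\<bar> powr p * q2 x \<partial>lebesgue))"
  have grad: "(\<integral>x. norm (Dn n x) powr p \<partial>lborel) \<le> En n" for n
  proof -
    have i: "integrable lborel (\<lambda>x. norm (Dn n x) powr p)"
      using p C1_gradD(2)[OF C] Dn0 by (intro integrable_powr_compact_support[of _ r]) auto
    have le: "norm (Dn n x) powr p \<le> B * (indicator (cball 0 r) x * norm (D n x - G x) powr p)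
        + 4 powr p * (\<bar>h' (W n x)\<bar> powr p * q1 x) + 2 powr p * (\<bar>h (W n x)\<bar> powr p * q2 x)" for x
    proof (cases "norm x \<le> r")
      case True
      let ?t = "\<bar>h' (W n x)\<bar> * \<bar>\<zeta> x\<bar>"
      have t: "?t powr p \<le> (M1 * M\<zeta>) powr p"
        using p M1(1) M1(2)[OF True] M\<zeta>(2)[of x] by (intro powr_mono2 mult_mono) auto
      have "norm (Dn n x) \<le> ?t * norm (D n x) + \<bar>h (W n x)\<bar> * norm (Z x)"
        unfolding Dn_def by (rule order_trans[OF norm_triangle_ineq]) (simp add: abs_mult)
      then have "norm (Dn n x) powr p \<le> (?t * norm (D n x) + \<bar>h (W n x)\<bar> * norm (Z x)) powr p"
        using p by (intro powr_mono2) auto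
      also have "\<dots> \<le> 2 powr p * ((?t * norm (D n x)) powr p + (\<bar>h (W n x)\<bar> * norm (Z x)) powr p)"
        using p by (intro powr_add_le) auto
      also have "\<dots> = 2 powr p * (?t powr p * norm (D n x) powr p) + 2 powr p * (\<bar>h (W n x)\<bar> powr p * q2 x)"
        by (simp add: powr_mult q2_def algebra_simps)
      also have "2 powr p * (?t powr p * norm (D n x) powr p)
        \<le> 2 powr p * (?t powr p * (2 powr p * (norm (D n x - G x) powr p + norm (G x - 0) powr p)))"
        using p norm_diff_powr_le[of p "D n x" 0 "G x"] by (intro mult_left_mono) auto
      also have "\<dots> = (2 powr p * 2 powr p) * (?t powr p * norm (D n x - G x) powr p) + (2 powr p * 2 powr p) * (\<bar>h' (W n x)\<bar> powr p * q1 x)"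
        by (simp add: powr_mult q1_def algebra_simps)
      also have "2 powr p * 2 powr p = 4 powr p" using powr_mult[of 2 2 p] by simp
      also have "4 powr p * (?t powr p * norm (D n x - G x) powr p) \<le> 4 powr p * ((M1 * M\<zeta>) powr p * norm (D n x - G x) powr p)"
        using t by (intro mult_left_mono mult_right_mono) auto
      finally show ?thesis using True by (simp add: B_def mult_ac)
    qed (use p q10 q20 Dn0 in auto)
    have "(\<integral>x. norm (Dn n x) powr p \<partial>lborel) = (\<integral>x. norm (Dn n x) powr p \<partial>lebesgue)"
      using i by (subst integral_completion) auto
    also have "\<dots> \<le> (\<integral>x. B * (indicator (cball 0 r) x * norm (D n x - G x) powr p)
        + 4 powr p * (\<bar>h' (W n x)\<bar> powr p * q1 x) + 2 powr p * (\<bar>h (W n x)\<bar> powr p * q2 x) \<partial>lebesgue)"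
    proof (rule integral_mono)
      show "integrable lebesgue (\<lambda>x. norm (Dn n x) powr p)"
        using i by (subst integrable_completion) auto
    qed (use le L1(3) L2(3) approx_seq_diff_integrable[OF A] in auto)
    also have "\<dots> = B * (\<integral>x. indicator (cball 0 r) x * norm (D n x - G x) powr p \<partial>lebesgue)
        + 4 powr p * (\<integral>x. \<bar>h' (W n x)\<bar> powr p * q1 x \<partial>lebesgue)
        + 2 powr p * (\<integral>x. \<bar>h (W n x)\<bar> powr p * q2 x \<partial>lebesgue)"
      using L1(3) L2(3) approx_seq_diff_integrable[OF A] by simp
    also have "\<dots> \<le> En n"
      unfolding En_def using A by (intro add_right_mono mult_left_mono) (auto simp: approx_seq_def less_imp_le B_def)
    finally show ?thesis .
  qed
  have bound: "(\<integral>x. \<bar>fn n (x + z) - fn n x\<bar> powr p \<partial>lborel) \<le> norm z powr p * En n" for n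
    using C1_difference_Lp_real[OF C[of n] p, where r = r and z = z, OF fn0] grad[of n] by (meson mult_left_mono order_trans powr_ge_zero)
  have "En \<longlonglongrightarrow> B * 0 + 4 powr p * (\<integral>x. \<bar>h' (w x)\<bar> powr p * q1 x \<partial>lebesgue) + 2 powr p * (\<integral>x. \<bar>h (w x)\<bar> powr p * q2 x \<partial>lebesgue)"
    unfolding En_def using L1(1) L2(1) LIMSEQ_inverse_real_of_nat
    by (intro tendsto_intros) (auto simp: inverse_eq_divide)
  then have EnE: "En \<longlonglongrightarrow> E" by (simp add: E_def q1_def q2_def)
  have flim: "(\<lambda>n. fn n x) \<longlonglongrightarrow> f x" for x
  proof (cases "norm x \<le> r")
    case True
    have "isCont h (w x)" using h(1)[OF w_pos] DERIV_isCont by blast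
    then have "(\<lambda>n. h (W n x)) \<longlonglongrightarrow> h (w x)"
      using approx_seq_D(3)[OF A True] by (rule isCont_tendsto_compose)
    then show ?thesis unfolding fn_def f_def by (intro tendsto_intros)
  qed (simp add: fn_def f_def \<zeta>(2))
  have fcont: "continuous_on UNIV f"
    unfolding f_def using comp_cont(1)[OF hc w_cont w_pos] C1_gradD(3)[OF \<zeta>(1)] by (intro continuous_intros)
  have [measurable]: "f \<in> borel_measurable borel" "fn n \<in> borel_measurable borel" for n
    using fcont C1_gradD(4)[OF C] by (auto intro: borel_measurable_continuous_onI)
  define V where "V = 2 * (M2 * M\<zeta>)"
  have "(\<lambda>n. \<integral>x. \<bar>fn n (x + z) - fn n x\<bar> powr p \<partial>lborel) \<longlonglongrightarrow> (\<integral>x. \<bar>f (x + z) - f x\<bar> powr p \<partial>lborel)"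
  proof (rule integral_dominated_convergence)
    show "integrable lborel (\<lambda>x. indicator (cball (0::'a) (r + norm z)) x * V powr p)"
      using emeasure_lborel_cball_finite by (intro integrable_mult_left integrable_real_indicator) auto
    show "AE x in lborel. (\<lambda>n. \<bar>fn n (x + z) - fn n x\<bar> powr p) \<longlonglongrightarrow> \<bar>f (x + z) - f x\<bar> powr p"
      using p by (intro AE_I2 tendsto_powr' tendsto_rabs tendsto_diff flim tendsto_const) auto
    show "AE x in lborel. norm (\<bar>fn n (x + z) - fn n x\<bar> powr p) \<le> indicator (cball (0::'a) (r + norm z)) x * V powr p" for n
    proof (rule AE_I2)
      fix x
      have fb: "\<bar>fn n y\<bar> \<le> M2 * M\<zeta>" for y
        using M2(1) M2(2)[of y n] M\<zeta>(1) M\<zeta>(2)[of y] \<zeta>(2)[of y] by (cases "norm y \<le> r") (auto simp: fn_def abs_mult intro: mult_mono)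
      show "norm (\<bar>fn n (x + z) - fn n x\<bar> powr p) \<le> indicator (cball (0::'a) (r + norm z)) x * V powr p"
      proof (cases "norm x \<le> r + norm z")
        case True
        have "\<bar>fn n (x + z) - fn n x\<bar> \<le> V"
          unfolding V_def using fb[of x] fb[of "x + z"] by linarith
        then show ?thesis using True p by (auto intro!: powr_mono2)
      next
        case False
        have "norm x \<le> norm (x + z) + norm z" using norm_triangle_ineq4[of "x + z" z] by simp
        then have "r < norm (x + z)" "r < norm x" using False norm_ge_zero[of z] by linarith+
        then show ?thesis using fn0 p by simp
      qed
    qed
  qed measurable
  then show ?thesis
    using bound EnE by (intro LIMSEQ_le[OF _ tendsto_mult_left[OF EnE]]) auto
qed

end

text \<open>A substitute for the Sobolev inequality in the reverse Hoelder estimate.\<close>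

lemma Nash_type_inequality:
  fixes f :: "'a::euclidean_space \<Rightarrow> real"
  assumes f: "continuous_on UNIV f" "\<And>x. 0 \<le> f x" "\<And>x. R < norm x \<Longrightarrow> f x = 0"
    and p: "p > 0" and m: "m > 0" and r: "r > 0" and E: "E \<ge> 0"
    and diff: "\<And>z. norm z \<le> r \<Longrightarrow> (\<integral>x. \<bar>f (x + z) - f x\<bar> powr p \<partial>lborel) \<le> norm z powr p * E"
  defines "b \<equiv> measure lborel (cball (0::'a) r)" and "V \<equiv> measure lborel (cball (0::'a) R)"
    and "S \<equiv> (\<integral>x. f x powr m \<partial>lborel)"
  assumes S: "S > 0"
  shows "(\<integral>x. f x powr p \<partial>lborel) \<le> 2 powr (p + 1) * (r powr p * E + V * (2 * S / b) powr (p / m))"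
proof -
  have b: "b > 0" using content_cball_pos[OF r, of "0::'a"] by (simp add: b_def)
  \<comment> \<open>The level at which Chebyshev's inequality leaves at most half of the ball of
    shifts: the shifts z with f(x+z) > T have measure at most S/T^m = b/2.\<close>
  define T where "T = (2 * S / b) powr (1 / m)"
  have T: "T > 0" "T powr m = 2 * S / b" "T powr p = (2 * S / b) powr (p / m)"
    using S b m by (auto simp: T_def powr_powr)
  have [measurable]: "f \<in> borel_measurable borel" using f(1) by (rule borel_measurable_continuous_onI)
  have [measurable]: "cball (0::'a) r \<in> sets borel" "cball (0::'a) R \<in> sets borel" by auto
  have fp: "integrable lborel (\<lambda>x. f x powr q)" if "q > 0" for q
    using integrable_powr_compact_support[OF f(1,3) that] f(2) by simp
  have fz: "f (x + z) - f x = 0" if "R + norm z < norm x" for x z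
  proof -
    have "norm x \<le> norm (x + z) + norm z" using norm_triangle_ineq4[of "x + z" z] by simp
    then show ?thesis using that f(3)[of x] f(3)[of "x + z"] norm_ge_zero[of z] by auto
  qed
  have di: "integrable lborel (\<lambda>x. \<bar>f (x + z) - f x\<bar> powr p)" for z
  proof -
    have "continuous_on UNIV (\<lambda>x. f (x + z) - f x)"
      by (intro continuous_on_diff f(1) continuous_on_compose2[OF f(1)] continuous_on_add continuous_on_id continuous_on_const) auto
    from integrable_powr_compact_support[OF this fz p] show ?thesis by simp
  qed
  let ?Ir = "\<lambda>z. indicator (cball (0::'a) r) z :: real"
  \<comment> \<open>Where f(x+z) is at most T, the value f(x) is bounded by the increment plus T;
    elsewhere f(x+z)^m/T^m is at least 1 and the last term alone suffices.\<close>
  have pt: "f x powr p \<le> 2 powr p * \<bar>f (x + z) - f x\<bar> powr p + 2 powr p * T powr p + (f x powr p / T powr m) * f (x + z) powr m" for x z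
  proof (cases "f (x + z) \<le> T")
    case True
    have "f x powr p \<le> (\<bar>f (x + z) - f x\<bar> + T) powr p"
      using p f True by (intro powr_mono2) auto
    also have "\<dots> \<le> 2 powr p * (\<bar>f (x + z) - f x\<bar> powr p + T powr p)"
      using p T by (intro powr_add_le) auto
    also have "\<dots> \<le> 2 powr p * (\<bar>f (x + z) - f x\<bar> powr p + T powr p) + (f x powr p / T powr m) * f (x + z) powr m"
      by simp
    finally show ?thesis by (simp add: distrib_left)
  next
    case False
    then have "T powr m \<le> f (x + z) powr m" using T m by (intro powr_mono2) auto
    then have "f x powr p * 1 \<le> f x powr p * (f (x + z) powr m / T powr m)"
      using T(1) by (intro mult_left_mono) (auto simp: pos_le_divide_eq)
    then show ?thesis by (simp add: add_increasing)
  qed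
  have Ii: "integrable lborel ?Ir"
    using emeasure_lborel_cball_finite by (intro integrable_real_indicator) auto
  have half: "f x powr p * (b / 2) \<le> 2 powr p * ((\<integral>z. ?Ir z * \<bar>f (x + z) - f x\<bar> powr p \<partial>lborel) + T powr p * b)"
    and ix: "integrable lborel (\<lambda>z. ?Ir z * \<bar>f (x + z) - f x\<bar> powr p)" for x
  proof -
    have i1: "integrable lborel (\<lambda>z. ?Ir z * \<bar>f (x + z) - f x\<bar> powr p)"
    proof -
      have "integrable lborel (\<lambda>z. indicator (cball (0::'a) r) z *\<^sub>R (\<bar>f (x + z) - f x\<bar> powr p))"
        using p by (intro borel_integrable_compact continuous_on_powr' continuous_on_rabs continuous_on_diff
            continuous_on_const continuous_on_compose2[OF f(1)] continuous_on_add continuous_on_id) auto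
      then show ?thesis by simp
    qed
    have i2: "integrable lborel (\<lambda>z. f (x + z) powr m)"
      using fp[OF m] lborel_integral_shift(3)[of "\<lambda>z. f z powr m" x] by simp
    have i2': "integrable lborel (\<lambda>z. ?Ir z * f (x + z) powr m)"
      by (rule Bochner_Integration.integrable_bound[OF i2]) (auto simp: indicator_def)
    have "(\<integral>z. ?Ir z * f (x + z) powr m \<partial>lborel) \<le> (\<integral>z. f (x + z) powr m \<partial>lborel)"
      by (intro integral_mono i2 i2') (auto simp: indicator_def)
    also have "\<dots> = S" using lborel_integral_shift(1)[of "\<lambda>z. f z powr m" x] by (simp add: S_def)
    finally have S': "(\<integral>z. ?Ir z * f (x + z) powr m \<partial>lborel) \<le> S" .
    have "(\<integral>z. ?Ir z * f x powr p \<partial>lborel) \<le> (\<integral>z. 2 powr p * (?Ir z * \<bar>f (x + z) - f x\<bar> powr p) + (2 powr p * T powr p) * ?Ir z + (f x powr p / T powr m) * (?Ir z * f (x + z) powr m) \<partial>lborel)"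
    proof (rule integral_mono)
      fix z show "?Ir z * f x powr p \<le> 2 powr p * (?Ir z * \<bar>f (x + z) - f x\<bar> powr p) + (2 powr p * T powr p) * ?Ir z + (f x powr p / T powr m) * (?Ir z * f (x + z) powr m)"
        using pt[of x z] by (auto simp: indicator_def)
    qed (use i1 i2' Ii in auto)
    also have "\<dots> = 2 powr p * (\<integral>z. ?Ir z * \<bar>f (x + z) - f x\<bar> powr p \<partial>lborel) + (2 powr p * T powr p) * b + (f x powr p / T powr m) * (\<integral>z. ?Ir z * f (x + z) powr m \<partial>lborel)"
      using i1 i2' Ii by (simp add: b_def)
    also have "\<dots> \<le> 2 powr p * (\<integral>z. ?Ir z * \<bar>f (x + z) - f x\<bar> powr p \<partial>lborel) + (2 powr p * T powr p) * b + (f x powr p / T powr m) * S"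
      using S' by (intro add_left_mono mult_left_mono) auto
    \<comment> \<open>By the choice of T the bad shifts contribute exactly half of the left side,
      which can then be subtracted.\<close>
    also have "(f x powr p / T powr m) * S = f x powr p * (b / 2)"
      using S b by (simp add: T(2))
    finally have "f x powr p * b \<le> 2 powr p * (\<integral>z. ?Ir z * \<bar>f (x + z) - f x\<bar> powr p \<partial>lborel) + (2 powr p * T powr p) * b + f x powr p * (b / 2)"
      by (simp add: b_def mult.commute)
    then show "f x powr p * (b / 2) \<le> 2 powr p * ((\<integral>z. ?Ir z * \<bar>f (x + z) - f x\<bar> powr p \<partial>lborel) + T powr p * b)"
      by (simp add: algebra_simps)
    show "integrable lborel (\<lambda>z. ?Ir z * \<bar>f (x + z) - f x\<bar> powr p)" by (rule i1)
  qed
  \<comment> \<open>After interchanging the integrals, the increments are integrated over x for each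
    fixed shift, where the hypothesis \<open>diff\<close> applies.\<close>
  have dE: "(\<integral>\<^sup>+z. ennreal (?Ir z) * (\<integral>\<^sup>+x. ennreal (\<bar>f (x + z) - f x\<bar> powr p) \<partial>lborel) \<partial>lborel) \<le> ennreal (b * (r powr p * E))"
  proof -
    have "(\<integral>\<^sup>+z. ennreal (?Ir z) * (\<integral>\<^sup>+x. ennreal (\<bar>f (x + z) - f x\<bar> powr p) \<partial>lborel) \<partial>lborel)
      \<le> (\<integral>\<^sup>+z. ennreal (r powr p * E) * indicator (cball (0::'a) r) z \<partial>lborel)"
    proof (rule nn_integral_mono)
      fix z :: 'a
      show "ennreal (?Ir z) * (\<integral>\<^sup>+x. ennreal (\<bar>f (x + z) - f x\<bar> powr p) \<partial>lborel) \<le> ennreal (r powr p * E) * indicator (cball (0::'a) r) z"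
      proof (cases "norm z \<le> r")
        case True
        have "(\<integral>\<^sup>+x. ennreal (\<bar>f (x + z) - f x\<bar> powr p) \<partial>lborel) = ennreal (\<integral>x. \<bar>f (x + z) - f x\<bar> powr p \<partial>lborel)"
          using di by (intro nn_integral_eq_integral) auto
        also have "\<dots> \<le> ennreal (norm z powr p * E)" using diff[OF True] by (rule ennreal_leI)
        also have "\<dots> \<le> ennreal (r powr p * E)"
          using p True E by (intro ennreal_leI mult_right_mono powr_mono2) auto
        finally show ?thesis using True by simp
      qed simp
    qed
    also have "\<dots> = ennreal (r powr p * E) * emeasure lborel (cball (0::'a) r)"
      by (simp add: nn_integral_cmult_indicator)
    also have "emeasure lborel (cball (0::'a) r) = ennreal b"
      unfolding b_def using emeasure_lborel_cball_finite[of "0::'a" r] by (simp add: emeasure_eq_ennreal_measure)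
    finally show ?thesis using E b by (simp add: mult.commute flip: ennreal_mult')
  qed
  have "ennreal ((\<integral>x. f x powr p \<partial>lborel) * (b / 2)) = (\<integral>\<^sup>+x. ennreal (f x powr p * (b / 2)) \<partial>lborel)"
    using fp[OF p] b by (subst nn_integral_eq_integral) auto
  also have "\<dots> \<le> (\<integral>\<^sup>+x. ennreal (2 powr p) * ((\<integral>\<^sup>+z. ennreal (?Ir z) * ennreal (\<bar>f (x + z) - f x\<bar> powr p) \<partial>lborel) + ennreal (T powr p * b) * indicator (cball 0 R) x) \<partial>lborel)"
  proof (rule nn_integral_mono)
    fix x
    show "ennreal (f x powr p * (b / 2)) \<le> ennreal (2 powr p) * ((\<integral>\<^sup>+z. ennreal (?Ir z) * ennreal (\<bar>f (x + z) - f x\<bar> powr p) \<partial>lborel) + ennreal (T powr p * b) * indicator (cball 0 R) x)"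
    proof (cases "norm x \<le> R")
      case True
      have "(\<integral>\<^sup>+z. ennreal (?Ir z) * ennreal (\<bar>f (x + z) - f x\<bar> powr p) \<partial>lborel) = ennreal (\<integral>z. ?Ir z * \<bar>f (x + z) - f x\<bar> powr p \<partial>lborel)"
        using ix[of x] by (subst nn_integral_eq_integral[symmetric]) (auto simp flip: ennreal_mult')
      then have "ennreal (2 powr p) * ((\<integral>\<^sup>+z. ennreal (?Ir z) * ennreal (\<bar>f (x + z) - f x\<bar> powr p) \<partial>lborel) + ennreal (T powr p * b) * indicator (cball 0 R) x)
        = ennreal (2 powr p * ((\<integral>z. ?Ir z * \<bar>f (x + z) - f x\<bar> powr p \<partial>lborel) + T powr p * b))"
        using True b by (simp add: Bochner_Integration.integral_nonneg flip: ennreal_mult' ennreal_plus)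
      then show ?thesis using half[of x] by (simp add: ennreal_leI)
    qed (use f(3) p in simp)
  qed
  also have "\<dots> = ennreal (2 powr p) * ((\<integral>\<^sup>+x. (\<integral>\<^sup>+z. ennreal (?Ir z) * ennreal (\<bar>f (x + z) - f x\<bar> powr p) \<partial>lborel) \<partial>lborel) + ennreal (T powr p * b) * emeasure lborel (cball (0::'a) R))"
    by (simp add: nn_integral_cmult nn_integral_add nn_integral_cmult_indicator)
  also have "(\<integral>\<^sup>+x. (\<integral>\<^sup>+z. ennreal (?Ir z) * ennreal (\<bar>f (x + z) - f x\<bar> powr p) \<partial>lborel) \<partial>lborel)
     = (\<integral>\<^sup>+z. (\<integral>\<^sup>+x. ennreal (?Ir z) * ennreal (\<bar>f (x + z) - f x\<bar> powr p) \<partial>lborel) \<partial>lborel)"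
    by (rule lborel_pair.Fubini') measurable
  also have "\<dots> = (\<integral>\<^sup>+z. ennreal (?Ir z) * (\<integral>\<^sup>+x. ennreal (\<bar>f (x + z) - f x\<bar> powr p) \<partial>lborel) \<partial>lborel)"
    by (simp add: nn_integral_cmult)
  also have "emeasure lborel (cball (0::'a) R) = ennreal V"
    unfolding V_def using emeasure_lborel_cball_finite[of "0::'a" R] by (simp add: emeasure_eq_ennreal_measure)
  also have "ennreal (2 powr p) * ((\<integral>\<^sup>+z. ennreal (?Ir z) * (\<integral>\<^sup>+x. ennreal (\<bar>f (x + z) - f x\<bar> powr p) \<partial>lborel) \<partial>lborel) + ennreal (T powr p * b) * ennreal V)
     \<le> ennreal (2 powr p) * (ennreal (b * (r powr p * E)) + ennreal (T powr p * b) * ennreal V)"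
    using dE by (intro mult_left_mono add_right_mono) auto
  also have "\<dots> = ennreal (2 powr p * (b * (r powr p * E) + T powr p * b * V))"
    using b E by (simp add: V_def flip: ennreal_mult' ennreal_plus)
  finally have "(\<integral>x. f x powr p \<partial>lborel) * (b / 2) \<le> 2 powr p * (b * (r powr p * E) + T powr p * b * V)"
    by (rule ennreal_le_iff[THEN iffD1, rotated]) (use b E in \<open>auto simp: V_def\<close>)
  also have "\<dots> = (2 powr (p + 1) * (r powr p * E + V * T powr p)) * (b / 2)"
    by (simp add: powr_add algebra_simps)
  finally show ?thesis using b by (simp add: T(3))
qed

section \<open>Energy estimates\<close>

lemma max_0_square_deriv:
  "((\<lambda>s::real. (max 0 s)\<^sup>2) has_real_derivative 2 * max 0 s) (at s)"
proof -
  consider "s > 0" | "s < 0" | "s = 0" by linarith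
  then show ?thesis
  proof cases
    case 1
    have d: "((\<lambda>s. s\<^sup>2) has_real_derivative 2 * max 0 s) (at s)"
      using 1 by (auto intro!: derivative_eq_intros)
    have ev: "\<forall>\<^sub>F t in nhds s. t\<^sup>2 = (max 0 t)\<^sup>2"
      using eventually_nhds_in_open[of "{0<..}" s] 1 by (auto elim!: eventually_mono)
    show ?thesis by (rule iffD1[OF DERIV_cong_ev[OF refl ev refl] d])
  next
    case 2
    have d: "((\<lambda>s. 0) has_real_derivative 2 * max 0 s) (at s)" using 2 by simp
    have ev: "\<forall>\<^sub>F t in nhds s. 0 = (max 0 t)\<^sup>2"
      using eventually_nhds_in_open[of "{..<0}" s] 2 by (auto elim!: eventually_mono)
    show ?thesis by (rule iffD1[OF DERIV_cong_ev[OF refl ev refl] d])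
  next
    case 3
    have "((\<lambda>h. (max 0 h)\<^sup>2 / h) \<longlongrightarrow> 0) (at (0::real))"
    proof (rule Lim_null_comparison)
      have "norm ((max 0 h)\<^sup>2 / h) \<le> \<bar>h\<bar>" for h :: real
        by (auto simp: max_def power2_eq_square)
      then show "\<forall>\<^sub>F h in at 0. norm ((max 0 h)\<^sup>2 / h) \<le> \<bar>h\<bar>" for h :: real by (simp add: always_eventually)
      show "((\<lambda>h. \<bar>h\<bar>) \<longlongrightarrow> 0) (at (0::real))" by (intro tendsto_eq_intros) auto
    qed
    then show ?thesis using 3 by (simp add: DERIV_def)
  qed
qed

text \<open>Two nested squared positive parts: the inner one flattens the profile at 0, the outer
  one at 1, so the transition is C1 with an explicit derivative.\<close>

definition smoothstep :: "real \<Rightarrow> real" where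
  "smoothstep s = 1 - (max 0 (1 - (max 0 s)\<^sup>2))\<^sup>2"

definition smoothstep' :: "real \<Rightarrow> real" where
  "smoothstep' s = 2 * max 0 (1 - (max 0 s)\<^sup>2) * (2 * max 0 s)"

lemma smoothstep_deriv: "(smoothstep has_real_derivative smoothstep' s) (at s)"
proof -
  have "((\<lambda>s. 1 - (max 0 s)\<^sup>2) has_real_derivative - (2 * max 0 s)) (at s)"
    using DERIV_diff[OF DERIV_const max_0_square_deriv, of 1] by simp
  from DERIV_chain2[OF max_0_square_deriv this]
  have "((\<lambda>s. 1 - (max 0 (1 - (max 0 s)\<^sup>2))\<^sup>2) has_real_derivative 0 - 2 * max 0 (1 - (max 0 s)\<^sup>2) * - (2 * max 0 s)) (at s)"
    by (intro DERIV_diff DERIV_const)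
  then show ?thesis by (simp add: smoothstep_def[abs_def] smoothstep'_def)
qed

lemma smoothstep_bounds:
  "0 \<le> smoothstep s" "smoothstep s \<le> 1" "s \<le> 0 \<Longrightarrow> smoothstep s = 0" "1 \<le> s \<Longrightarrow> smoothstep s = 1"
  "0 \<le> smoothstep' s" "smoothstep' s \<le> 4" "s \<le> 0 \<Longrightarrow> smoothstep' s = 0"
proof -
  let ?t = "max 0 (1 - (max 0 s)\<^sup>2)"
  have t: "0 \<le> ?t" "?t \<le> 1" by auto
  then have "?t\<^sup>2 \<le> 1" by (simp add: power_le_one)
  then show "0 \<le> smoothstep s" by (simp add: smoothstep_def)
  show "smoothstep s \<le> 1" by (simp add: smoothstep_def)
  show "s \<le> 0 \<Longrightarrow> smoothstep s = 0" by (simp add: smoothstep_def max_def)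
  show "smoothstep s = 1" if "1 \<le> s"
  proof -
    have "1 \<le> s\<^sup>2" using that by (simp add: one_le_power)
    then have "max 0 s = s" "max 0 (1 - s\<^sup>2) = 0" using that by auto
    then show ?thesis by (simp add: smoothstep_def)
  qed
  show "0 \<le> smoothstep' s" by (simp add: smoothstep'_def)
  show "s \<le> 0 \<Longrightarrow> smoothstep' s = 0" by (simp add: smoothstep'_def)
  show "smoothstep' s \<le> 4"
  proof (cases "s \<le> 1")
    case True
    then have "?t * max 0 s \<le> 1 * 1" using t by (intro mult_mono) auto
    then show ?thesis by (simp add: smoothstep'_def)
  next
    case False
    then have "1 \<le> s\<^sup>2" by (simp add: one_le_power)
    then have "max 0 (1 - (max 0 s)\<^sup>2) = 0" using False by auto
    then show ?thesis by (simp add: smoothstep'_def)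
  qed
qed

text \<open>The last factor is the power to which the step is raised in the cutoff; 8 is the product
  of the bound 4 for \<open>smoothstep'\<close> and the factor 2 from differentiating |x|^2.\<close>

definition cutoff_const :: "real \<Rightarrow> real" where
  "cutoff_const p = 8 * real (nat \<lceil>p\<rceil> + 1)"

text \<open>Raising a step to a power m of at least p makes the gradient vanish along with the
  cutoff, at the rate zeta^(1-1/m), which is at most zeta^(1-1/p). This is the rate at which the
  flux term can be absorbed with the weight zeta itself.\<close>

lemma cutoff_exists:
  assumes p: "p > 1" and \<rho>: "0 < \<rho>" "\<rho> < \<rho>'"
  obtains \<zeta> :: "'a::euclidean_space \<Rightarrow> real" and Z where "C1_grad \<zeta> Z" "\<And>x. 0 \<le> \<zeta> x" "\<And>x. \<zeta> x \<le> 1"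
    "\<And>x. norm x \<le> \<rho> \<Longrightarrow> \<zeta> x = 1" "\<And>x. \<rho>' < norm x \<Longrightarrow> \<zeta> x = 0"
    "\<And>x. norm (Z x) \<le> cutoff_const p / (\<rho>' - \<rho>) * \<zeta> x powr ((p - 1) / p)"
proof -
  define m where "m = nat \<lceil>p\<rceil> + 1"
  have m: "real m \<ge> p" "m \<ge> 2" using p by (auto simp: m_def) linarith+
  define d where "d = \<rho>'\<^sup>2 - \<rho>\<^sup>2"
  have d: "d = (\<rho>' - \<rho>) * (\<rho>' + \<rho>)" "d > 0"
    using \<rho> by (auto simp: d_def power2_eq_square algebra_simps intro: mult_strict_mono)
  \<comment> \<open>An affine function of |x|^2 rather than of |x|, hence smooth at the origin as
    well.\<close>
  define s where "s = (\<lambda>x::'a. (\<rho>'\<^sup>2 - x \<bullet> x) / d)"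
  define \<zeta> where "\<zeta> = (\<lambda>x. smoothstep (s x) ^ m)"
  define Z where "Z = (\<lambda>x. (real m * smoothstep (s x) ^ (m - 1) * smoothstep' (s x) * (- 2 / d)) *\<^sub>R x)"
  have scont: "continuous_on UNIV s" unfolding s_def by (intro continuous_intros) (use d in auto)
  have c1: "continuous_on UNIV smoothstep"
    using smoothstep_deriv by (auto intro!: continuous_at_imp_continuous_on DERIV_isCont)
  have c2: "continuous_on UNIV smoothstep'"
    unfolding smoothstep'_def by (intro continuous_intros)
  have "C1_grad \<zeta> Z"
    unfolding C1_grad_def
  proof (intro conjI allI)
    show "continuous_on UNIV Z"
      unfolding Z_def by (intro continuous_intros continuous_on_compose2[OF c1 scont] continuous_on_compose2[OF c2 scont]) auto
    fix x
    have ds: "(s has_derivative (\<lambda>h. (- 2 / d) * (x \<bullet> h))) (at x)"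
      unfolding s_def using d by (auto intro!: derivative_eq_intros simp: inner_commute field_simps)
    have "((\<lambda>s. smoothstep s ^ m) has_real_derivative real m * (smoothstep' t * smoothstep t ^ (m - Suc 0))) (at t)" for t
      by (rule DERIV_power[OF smoothstep_deriv])
    from has_derivative_compose[OF ds this[unfolded has_field_derivative_def]]
    show "(\<zeta> has_derivative (\<bullet>) (Z x)) (at x)"
      unfolding \<zeta>_def Z_def by (rule has_derivative_eq_rhs) (auto simp: fun_eq_iff)
  qed
  moreover have "0 \<le> \<zeta> x" "\<zeta> x \<le> 1" for x
    using smoothstep_bounds(1,2)[of "s x"] by (auto simp: \<zeta>_def power_le_one)
  moreover have "\<zeta> x = 1" if "norm x \<le> \<rho>" for x
  proof -
    have "x \<bullet> x \<le> \<rho>\<^sup>2" using that \<rho> by (metis norm_ge_zero power_mono power2_norm_eq_inner)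
    then have "1 \<le> s x" using d(2) by (simp add: s_def d_def)
    then show ?thesis by (simp add: \<zeta>_def smoothstep_bounds)
  qed
  moreover have s0: "s x \<le> 0" if "\<rho>' \<le> norm x" for x
  proof -
    have "\<rho>'\<^sup>2 \<le> x \<bullet> x" using that \<rho> by (metis power_mono power2_norm_eq_inner less_imp_le order_trans)
    then show ?thesis using d(2) by (simp add: s_def divide_le_0_iff)
  qed
  moreover have "\<zeta> x = 0" if "\<rho>' < norm x" for x
    using s0[of x] that m by (simp add: \<zeta>_def smoothstep_bounds)
  moreover have "norm (Z x) \<le> cutoff_const p / (\<rho>' - \<rho>) * \<zeta> x powr ((p - 1) / p)" for x
  proof (cases "norm x < \<rho>'")
    case False
    then show ?thesis using s0[of x] p \<rho> by (simp add: Z_def smoothstep_bounds cutoff_const_def)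
  next
    case True
    let ?\<sigma> = "smoothstep (s x)"
    have 1: "?\<sigma> ^ (m - 1) \<le> \<zeta> x powr ((p - 1) / p)"
    proof (cases "?\<sigma> = 0")
      case True then show ?thesis using m by (simp add: \<zeta>_def zero_power)
    next
      case False
      then have \<sigma>: "?\<sigma> > 0" "?\<sigma> \<le> 1" using smoothstep_bounds(1,2)[of "s x"] by auto
      \<comment> \<open>Equivalent to p \<le> m; since the base is at most 1, the larger exponent
        gives the smaller power.\<close>
      have "real m * ((p - 1) / p) \<le> real (m - 1)"
        using m p by (simp add: of_nat_diff field_simps)
      then have "?\<sigma> powr real (m - 1) \<le> ?\<sigma> powr (real m * ((p - 1) / p))"
        using \<sigma> by (intro powr_mono') auto
      moreover have "?\<sigma> ^ (m - 1) = ?\<sigma> powr real (m - 1)" using \<sigma> by (simp add: powr_realpow)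
      moreover have "\<zeta> x powr ((p - 1) / p) = ?\<sigma> powr (real m * ((p - 1) / p))"
        using \<sigma> by (simp add: \<zeta>_def powr_powr flip: powr_realpow)
      ultimately show ?thesis by (simp only:)
    qed
    \<comment> \<open>Because \<open>d\<close> factors as (rho'-rho)(rho'+rho), the size of x is
      compensated by rho'+rho and only the gap remains.\<close>
    have 2: "smoothstep' (s x) * (2 / d) * norm x \<le> 8 / (\<rho>' - \<rho>)"
    proof -
      have "smoothstep' (s x) * (2 / d) * norm x \<le> 4 * (2 / d) * \<rho>'"
        using smoothstep_bounds(5,6)[of "s x"] d True \<rho> by (intro mult_mono) auto
      also have "\<dots> = 8 / (\<rho>' - \<rho>) * (\<rho>' / (\<rho>' + \<rho>))" by (simp add: d(1))
      also have "\<dots> \<le> 8 / (\<rho>' - \<rho>) * 1" using \<rho> by (intro mult_left_mono) auto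
      finally show ?thesis by simp
    qed
    have "norm (Z x) = real m * (?\<sigma> ^ (m - 1) * (smoothstep' (s x) * (2 / d) * norm x))"
      using smoothstep_bounds(1,5)[of "s x"] d(2) by (simp add: Z_def abs_mult)
    also have "\<dots> \<le> real m * (\<zeta> x powr ((p - 1) / p) * (8 / (\<rho>' - \<rho>)))"
      using 1 2 smoothstep_bounds(1,5)[of "s x"] d by (intro mult_left_mono mult_mono) auto
    finally show ?thesis unfolding cutoff_const_def m_def[symmetric] by (simp add: mult_ac)
  qed
  ultimately show ?thesis using that by blast
qed

text \<open>Young's inequality for tau X and c^p tau^(1-p) Y: the powers of tau cancel on the left,
  and tau remains free for absorbing the X term.\<close>

lemma young_weighted:
  fixes X Y c \<tau> p :: real
  assumes "0 \<le> X" "0 \<le> Y" "0 < \<tau>" "0 < c" "1 < p"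
  shows "c * X powr ((p - 1) / p) * Y powr (1 / p) \<le> \<tau> * X + c powr p * \<tau> powr (1 - p) * Y"
proof (cases "X = 0 \<or> Y = 0")
  case False
  then have X: "X > 0" "Y > 0" using assms by auto
  let ?b = "c powr p * \<tau> powr (1 - p) * Y"
  have b: "?b > 0" using X assms by simp
  have "(\<tau> * X) powr ((p - 1) / p) * ?b powr (1 / p) \<le> (p - 1) / p * (\<tau> * X) + 1 / p * ?b"
    using X assms b by (intro Youngs_inequality_0) (auto simp: field_simps)
  also have "\<dots> \<le> 1 * (\<tau> * X) + 1 * ?b"
    using X assms b by (intro add_mono mult_right_mono) auto
  also have "(\<tau> * X) powr ((p - 1) / p) * ?b powr (1 / p)
    = (\<tau> powr ((p - 1) / p) * \<tau> powr ((1 - p) / p)) * (c * X powr ((p - 1) / p) * Y powr (1 / p))"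
    using X assms by (simp add: powr_mult powr_powr mult_ac)
  also have "\<tau> powr ((p - 1) / p) * \<tau> powr ((1 - p) / p) = 1"
    using assms by (simp flip: powr_add add_divide_distrib)
  finally show ?thesis by simp
qed (use assms in auto)

section \<open>The energy inequality for powers of a solution\<close>

definition ball_int :: "('a::euclidean_space \<Rightarrow> real) \<Rightarrow> real \<Rightarrow> real \<Rightarrow> real" where
  "ball_int w k \<rho> = (\<integral>x. indicator (cball 0 \<rho>) x * w x powr k \<partial>lebesgue)"

lemma ball_int_nonneg: "0 \<le> ball_int w k \<rho>"
  unfolding ball_int_def by (intro Bochner_Integration.integral_nonneg) auto

context weak_sol
begin

lemma w_powr_cont: "continuous_on UNIV (\<lambda>x. w x powr k)"
  using w_pos w_cont by (intro continuous_on_powr continuous_on_const) (auto simp: less_imp_neq[symmetric])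

lemma w_powr_meas[measurable]: "(\<lambda>x. w x powr k) \<in> borel_measurable lebesgue"
  using w_powr_cont by (intro borel_measurable_imp_lebesgue borel_measurable_continuous_onI)

lemma ball_integrable: "integrable lebesgue (\<lambda>x. indicator (cball 0 \<rho>) x * w x powr k)"
proof -
  have "integrable lborel (\<lambda>x. indicator (cball 0 \<rho>) x *\<^sub>R (w x powr k))"
    using w_powr_cont by (intro borel_integrable_compact) (auto intro: continuous_on_subset)
  then show ?thesis by (subst integrable_completion) auto
qed

text \<open>The constant that \<open>young_weighted\<close> yields for c = \<open>c\<^sub>F\<close>
  and tau = |a| K1 / 2, half of the coercive coefficient.\<close>

definition "C\<^sub>E a = c\<^sub>F powr p * (\<bar>a\<bar> * K1 / 2) powr (1 - p)"

lemma C\<^sub>E_nonneg: "0 \<le> C\<^sub>E a"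
  by (simp add: C\<^sub>E_def)

text \<open>The condition \<open>a * g x \<le> 0\<close> treats both kinds of solution at once: in
  the equation tested with w^a zeta, the source and the gradient term then add up with the same
  sign, and the flux against the cutoff gradient is the only competitor. Half of the gradient term
  absorbs its share of it. Positive \<open>a\<close> serves subsolutions, negative \<open>a\<close>
  supersolutions.\<close>

lemma energy_estimate:
  assumes a: "a \<noteq> 0" "\<And>x. a * g x \<le> 0"
    and \<zeta>: "C1_grad \<zeta> Z" "\<And>x. 0 \<le> \<zeta> x" "\<And>x. \<zeta> x \<le> 1" "\<And>x. r < norm x \<Longrightarrow> \<zeta> x = 0"
    and L: "0 \<le> L" "\<And>x. norm (Z x) \<le> L * \<zeta> x powr ((p - 1) / p)"
  shows "(\<integral>x. w x powr a * (\<bar>g x\<bar> * \<zeta> x) \<partial>lebesgue)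
      + \<bar>a\<bar> * K1 / 2 * (\<integral>x. w x powr (a - 1) * (norm (G x) powr p * \<zeta> x) \<partial>lebesgue)
    \<le> C\<^sub>E a * L powr p * ball_int w (a - 1 + p) r"
    and "integrable lebesgue (\<lambda>x. w x powr (a - 1) * (norm (G x) powr p * \<zeta> x))"
    and "integrable lebesgue (\<lambda>x. w x powr a * (\<bar>g x\<bar> * \<zeta> x))"
proof -
  have d: "((\<lambda>s. s powr a) has_real_derivative a * s powr (a - 1)) (at s)" if "s > 0" for s
    using that by (auto intro!: derivative_eq_intros)
  have c: "continuous_on {0<..} (\<lambda>s. a * s powr (a - 1))"
    by (auto intro!: continuous_intros)
  have [measurable]: "\<zeta> \<in> borel_measurable lebesgue" "Z \<in> borel_measurable lebesgue" "g \<in> borel_measurable lebesgue"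
    using C1_gradD(4,5)[OF \<zeta>(1)] g_cont
    by (auto intro!: borel_measurable_imp_lebesgue borel_measurable_continuous_onI)
  note T = test_comp[OF d c _ \<zeta>(1,2,4), simplified]
  let ?X = "\<lambda>x. w x powr (a - 1) * (norm (G x) powr p * \<zeta> x)"
  let ?Y = "\<lambda>x. L powr p * (indicator (cball 0 r) x * w x powr (a - 1 + p))"
  let ?P = "\<lambda>x. w x powr (a - 1) * (\<zeta> x * (F x \<bullet> G x))"
  let ?Q = "\<lambda>x. w x powr a * (F x \<bullet> Z x)"
  define \<tau> where "\<tau> = \<bar>a\<bar> * K1 / 2"
  have \<tau>: "\<tau> > 0" using a K1 by (simp add: \<tau>_def)
  have Pi: "integrable lebesgue ?P"
    using T(2) a(1) by (simp add: mult.assoc)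
  have XP: "K1 * ?X x \<le> ?P x" for x
  proof -
    have "w x powr (a - 1) * (\<zeta> x * (K1 * norm (G x) powr p)) \<le> ?P x"
      using \<zeta>(2) coercive by (intro mult_left_mono) auto
    then show ?thesis by (simp add: mult_ac)
  qed
  show Xi: "integrable lebesgue ?X"
  proof (rule Bochner_Integration.integrable_bound)
    show "integrable lebesgue (\<lambda>x. (1 / K1) * ?P x)" using Pi by simp
    have "norm (?X x) \<le> norm ((1 / K1) * ?P x)" for x
    proof -
      have "?X x \<le> (1 / K1) * ?P x" using XP[of x] K1 by (simp add: field_simps)
      then have "?X x \<le> norm ((1 / K1) * ?P x)" by (metis abs_ge_self order_trans real_norm_def)
      moreover have "norm (?X x) = ?X x" using \<zeta>(2)[of x] by simp
      ultimately show ?thesis by (simp only:)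
    qed
    then show "AE x in lebesgue. norm (?X x) \<le> norm ((1 / K1) * ?P x)" by simp
  qed measurable
  have Yi: "integrable lebesgue ?Y" using ball_integrable by simp
  have g_eq: "\<bar>g x\<bar> = - sgn a * g x" for x
    using a(2)[of x] a(1) by (cases "a > 0") (auto simp: mult_le_0_iff zero_le_mult_iff)
  have g_int: "(\<lambda>x. w x powr a * (\<bar>g x\<bar> * \<zeta> x)) = (\<lambda>x. - sgn a * (w x powr a * (g x * \<zeta> x)))"
    by (simp add: g_eq mult_ac)
  show gi: "integrable lebesgue (\<lambda>x. w x powr a * (\<bar>g x\<bar> * \<zeta> x))"
    unfolding g_int using T(4) by simp
  have QXY: "\<bar>?Q x\<bar> \<le> \<tau> * ?X x + C\<^sub>E a * ?Y x" for x
  proof (cases "norm x \<le> r")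
    case True
    have "\<bar>?Q x\<bar> = w x powr a * \<bar>F x \<bullet> Z x\<bar>" by (simp add: abs_mult)
    also have "\<dots> \<le> w x powr a * ((c\<^sub>F * norm (G x) powr (p - 1)) * (L * \<zeta> x powr ((p - 1) / p)))"
      using F_le[of x] L(2)[of x] c\<^sub>F_pos
      by (intro mult_left_mono order_trans[OF Cauchy_Schwarz_ineq2] mult_mono) auto
    \<comment> \<open>The exponent of w is divided according to a = (a-1)(p-1)/p + (a-1+p)/p, so
      that one part joins the gradient and the other forms the remainder w^(a-1+p).\<close>
    also have "\<dots> = c\<^sub>F * (?X x) powr ((p - 1) / p) * (?Y x) powr (1 / p)"
    proof -
      have e1: "(?X x) powr ((p - 1) / p) = w x powr ((a - 1) * ((p - 1) / p)) * (norm (G x) powr (p - 1) * \<zeta> x powr ((p - 1) / p))"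
        using p \<zeta>(2)[of x] by (simp add: powr_mult powr_powr)
      have e2: "(?Y x) powr (1 / p) = L * w x powr ((a - 1 + p) * (1 / p))"
        using p L(1) True by (simp add: powr_mult powr_powr)
      have e3: "w x powr a = w x powr ((a - 1) * ((p - 1) / p)) * w x powr ((a - 1 + p) * (1 / p))"
        using p by (simp flip: powr_add add: field_simps)
      show ?thesis unfolding e1 e2 e3 by (simp add: mult_ac)
    qed
    also have "\<dots> \<le> \<tau> * ?X x + c\<^sub>F powr p * \<tau> powr (1 - p) * ?Y x"
      using p \<zeta>(2)[of x] \<tau> c\<^sub>F_pos by (intro young_weighted) auto
    finally show ?thesis by (simp add: C\<^sub>E_def \<tau>_def)
  next
    case False
    then have "Z x = 0" using C1_grad_support[OF \<zeta>(1), of r x] \<zeta>(4) by auto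
    then show ?thesis using \<zeta>(2)[of x] \<tau> C\<^sub>E_nonneg[of a] by simp
  qed
  have "\<bar>\<integral>x. ?Q x \<partial>lebesgue\<bar> \<le> (\<integral>x. \<tau> * ?X x + C\<^sub>E a * ?Y x \<partial>lebesgue)"
    using Bochner_Integration.integral_norm_bound_integral[OF T(3), where g = "\<lambda>x. \<tau> * ?X x + C\<^sub>E a * ?Y x"] Xi Yi QXY by simp
  also have "\<dots> = \<tau> * (\<integral>x. ?X x \<partial>lebesgue) + C\<^sub>E a * L powr p * ball_int w (a - 1 + p) r"
    using Xi Yi by (simp add: ball_int_def)
  finally have Q: "\<bar>\<integral>x. ?Q x \<partial>lebesgue\<bar> \<le> \<tau> * (\<integral>x. ?X x \<partial>lebesgue) + C\<^sub>E a * L powr p * ball_int w (a - 1 + p) r" .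
  have T1: "a * (\<integral>x. ?P x \<partial>lebesgue) + (\<integral>x. ?Q x \<partial>lebesgue) = (\<integral>x. w x powr a * (g x * \<zeta> x) \<partial>lebesgue)"
    using T(1) Pi by (simp add: mult.assoc)
  have "(\<integral>x. w x powr a * (\<bar>g x\<bar> * \<zeta> x) \<partial>lebesgue) = - sgn a * (\<integral>x. w x powr a * (g x * \<zeta> x) \<partial>lebesgue)"
    unfolding g_int by simp
  then have "(\<integral>x. w x powr a * (\<bar>g x\<bar> * \<zeta> x) \<partial>lebesgue) + \<bar>a\<bar> * (\<integral>x. ?P x \<partial>lebesgue) = - sgn a * (\<integral>x. ?Q x \<partial>lebesgue)"
    unfolding T1[symmetric] by (cases "a > 0") (use a(1) in \<open>simp_all add: distrib_left\<close>)
  also have "\<dots> \<le> \<bar>\<integral>x. ?Q x \<partial>lebesgue\<bar>" using a(1) by (auto simp: sgn_if abs_if)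
  finally have 1: "(\<integral>x. w x powr a * (\<bar>g x\<bar> * \<zeta> x) \<partial>lebesgue) + \<bar>a\<bar> * (\<integral>x. ?P x \<partial>lebesgue)
    \<le> \<tau> * (\<integral>x. ?X x \<partial>lebesgue) + C\<^sub>E a * L powr p * ball_int w (a - 1 + p) r" using Q by simp
  have "K1 * (\<integral>x. ?X x \<partial>lebesgue) \<le> (\<integral>x. ?P x \<partial>lebesgue)"
    using integral_mono[of lebesgue "\<lambda>x. K1 * ?X x" ?P] Xi Pi XP by simp
  then have "\<bar>a\<bar> * (K1 * (\<integral>x. ?X x \<partial>lebesgue)) \<le> \<bar>a\<bar> * (\<integral>x. ?P x \<partial>lebesgue)" by (intro mult_left_mono) auto
  with 1 show "(\<integral>x. w x powr a * (\<bar>g x\<bar> * \<zeta> x) \<partial>lebesgue) + \<bar>a\<bar> * K1 / 2 * (\<integral>x. ?X x \<partial>lebesgue)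
    \<le> C\<^sub>E a * L powr p * ball_int w (a - 1 + p) r"
    by (simp add: \<tau>_def mult.assoc)
qed

end

section \<open>One-step estimates and iteration over radii\<close>

context weak_sol
begin

lemma ball_int_mono_radius:
  assumes "\<rho> \<le> \<rho>'"
  shows "ball_int w k \<rho> \<le> ball_int w k \<rho>'"
  unfolding ball_int_def using assms ball_integrable
  by (intro integral_mono) (auto simp: indicator_def)

lemma const_ball_integrable: "integrable lebesgue (\<lambda>x::'a. indicator (cball 0 r) x :: real)"
  using emeasure_lborel_cball_finite[of "0::'a" r] by (intro integrable_real_indicator) auto

definition "C\<^sub>M = c\<^sub>F * cutoff_const p powr p * (2 / K1 * C\<^sub>E 1) powr ((p - 1) / p)"

text \<open>The cutoff alone is the test function, so the mass of g is bounded by the flux against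
  its gradient. The Hoelder inequality reduces this to the integral of |G|^p zeta, and the energy
  estimate with a = 1, whose gradient weight is trivial, to that of w^p.\<close>

lemma mass_step:
  assumes g: "\<And>x. g x \<le> 0" and \<rho>: "0 < \<rho>" "\<rho> < \<rho>'"
  shows "(\<integral>x. indicator (cball 0 \<rho>) x * \<bar>g x\<bar> \<partial>lebesgue)
    \<le> C\<^sub>M * (\<rho>' - \<rho>) powr (- p) * ball_int w p \<rho>' powr ((p - 1) / p) * measure lborel (cball (0::'a) \<rho>') powr (1 / p)"
proof -
  obtain \<zeta> :: "'a \<Rightarrow> real" and Z where \<zeta>: "C1_grad \<zeta> Z" "\<And>x. 0 \<le> \<zeta> x" "\<And>x. \<zeta> x \<le> 1"
    "\<And>x. norm x \<le> \<rho> \<Longrightarrow> \<zeta> x = 1" "\<And>x. \<rho>' < norm x \<Longrightarrow> \<zeta> x = 0"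
    "\<And>x. norm (Z x) \<le> cutoff_const p / (\<rho>' - \<rho>) * \<zeta> x powr ((p - 1) / p)"
    using cutoff_exists[OF p \<rho>] by metis
  define L where "L = cutoff_const p / (\<rho>' - \<rho>)"
  have L: "0 \<le> L" using \<rho> by (simp add: L_def cutoff_const_def)
  have one: "(1::real) \<noteq> 0" "\<And>x. 1 * g x \<le> 0" and e: "(1::real) - 1 = 0" "0 + p = p" using g by auto
  note EE = energy_estimate[where r = \<rho>', OF one \<zeta>(1-3,5) L \<zeta>(6)[folded L_def], unfolded e]
  let ?X = "\<lambda>x. norm (G x) powr p * \<zeta> x"
  \<comment> \<open>Positivity of w matters here, since \<open>0 powr 0\<close> is 0.\<close>
  have w0: "w x powr 0 = 1" for x using w_pos[of x] by simp
  have Xi: "integrable lebesgue ?X" using EE(2) w_pos by (simp add: less_imp_neq[symmetric])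
  have gi: "integrable lebesgue (\<lambda>x. \<bar>g x\<bar> * \<zeta> x)"
    using g_cont C1_gradD(3)[OF \<zeta>(1)] \<zeta>(5)
    by (subst integrable_completion) (auto intro!: integrable_continuous_compact_support[of _ \<rho>'] continuous_intros borel_measurable_continuous_onI)
  have X_le: "(\<integral>x. ?X x \<partial>lebesgue) \<le> 2 / K1 * C\<^sub>E 1 * (L powr p * ball_int w p \<rho>')"
  proof -
    have "0 \<le> (\<integral>x. w x powr 1 * (\<bar>g x\<bar> * \<zeta> x) \<partial>lebesgue)"
      using \<zeta>(2) by (intro Bochner_Integration.integral_nonneg) auto
    moreover have "\<bar>1\<bar> * K1 / 2 * (\<integral>x. w x powr 0 * ?X x \<partial>lebesgue) = K1 / 2 * (\<integral>x. ?X x \<partial>lebesgue)"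
      unfolding w0 by simp
    moreover have "(\<integral>x. w x powr 1 * (\<bar>g x\<bar> * \<zeta> x) \<partial>lebesgue) + \<bar>1\<bar> * K1 / 2 * (\<integral>x. w x powr 0 * ?X x \<partial>lebesgue)
        \<le> C\<^sub>E 1 * L powr p * ball_int w p \<rho>'"
      by (rule EE(1))
    ultimately have "K1 / 2 * (\<integral>x. ?X x \<partial>lebesgue) \<le> C\<^sub>E 1 * L powr p * ball_int w p \<rho>'"
      by linarith
    then show ?thesis using K1 by (simp add: field_simps)
  qed
  have T: "(\<integral>x. F x \<bullet> Z x \<partial>lebesgue) = (\<integral>x. g x * \<zeta> x \<partial>lebesgue)" "integrable lebesgue (\<lambda>x. F x \<bullet> Z x)"
    using test_comp[of "\<lambda>_. 1" "\<lambda>_. 0", OF _ _ _ \<zeta>(1,2,5)] by auto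
  have \<theta>: "0 < (p - 1) / p" "(p - 1) / p < 1" using p by auto
  have th: "1 - (p - 1) / p = 1 / p" using p by (simp add: field_simps)
  note H = Holder_powr[OF Xi _ const_ball_integrable[of \<rho>'] _ \<theta>, unfolded th]
  have "(\<integral>x. indicator (cball 0 \<rho>) x * \<bar>g x\<bar> \<partial>lebesgue) \<le> (\<integral>x. \<bar>g x\<bar> * \<zeta> x \<partial>lebesgue)"
  proof (rule integral_mono_AE'[OF gi])
    show "AE x in lebesgue. indicator (cball 0 \<rho>) x * \<bar>g x\<bar> \<le> \<bar>g x\<bar> * \<zeta> x"
      using \<zeta>(2,4) by (intro AE_I2) (auto simp: indicator_def)
    show "AE x in lebesgue. 0 \<le> \<bar>g x\<bar> * \<zeta> x" using \<zeta>(2) by simp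
  qed
  also have "\<dots> = - (\<integral>x. F x \<bullet> Z x \<partial>lebesgue)"
    using T g by (simp add: abs_of_nonpos)
  also have "\<dots> \<le> norm (\<integral>x. F x \<bullet> Z x \<partial>lebesgue)" by simp
  also have "\<dots> \<le> (\<integral>x. (c\<^sub>F * L) * (?X x powr ((p - 1) / p) * indicator (cball 0 \<rho>') x powr (1 / p)) \<partial>lebesgue)"
  proof (rule Bochner_Integration.integral_norm_bound_integral[OF T(2)])
    show "integrable lebesgue (\<lambda>x. (c\<^sub>F * L) * (?X x powr ((p - 1) / p) * indicator (cball 0 \<rho>') x powr (1 / p)))"
      using H(1) \<zeta>(2) by simp
    fix x
    show "norm (F x \<bullet> Z x) \<le> (c\<^sub>F * L) * (?X x powr ((p - 1) / p) * indicator (cball 0 \<rho>') x powr (1 / p))"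
    proof (cases "norm x \<le> \<rho>'")
      case True
      have "norm (F x \<bullet> Z x) \<le> (c\<^sub>F * norm (G x) powr (p - 1)) * (L * \<zeta> x powr ((p - 1) / p))"
        using F_le[of x] \<zeta>(6)[of x] c\<^sub>F_pos unfolding L_def real_norm_def
        by (intro order_trans[OF Cauchy_Schwarz_ineq2] mult_mono) auto
      also have "\<dots> = (c\<^sub>F * L) * ?X x powr ((p - 1) / p)"
        using p \<zeta>(2)[of x] by (simp add: powr_mult powr_powr)
      finally show ?thesis using True by simp
    next
      case False
      then have "Z x = 0" using C1_grad_support[OF \<zeta>(1), of \<rho>' x] \<zeta>(5) by auto
      then show ?thesis using False by simp
    qed
  qed
  also have "\<dots> = (c\<^sub>F * L) * (\<integral>x. ?X x powr ((p - 1) / p) * indicator (cball 0 \<rho>') x powr (1 / p) \<partial>lebesgue)"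
    by simp
  also have "\<dots> \<le> (c\<^sub>F * L) * ((\<integral>x. ?X x \<partial>lebesgue) powr ((p - 1) / p) * measure lborel (cball (0::'a) \<rho>') powr (1 / p))"
    using H(2) \<zeta>(2) c\<^sub>F_pos L by (intro mult_left_mono) auto
  also have "\<dots> \<le> (c\<^sub>F * L) * ((2 / K1 * C\<^sub>E 1 * (L powr p * ball_int w p \<rho>')) powr ((p - 1) / p) * measure lborel (cball (0::'a) \<rho>') powr (1 / p))"
    using X_le \<theta> \<zeta>(2) c\<^sub>F_pos L by (intro mult_left_mono mult_right_mono powr_mono2) (auto intro!: Bochner_Integration.integral_nonneg)
  also have "\<dots> = (c\<^sub>F * (2 / K1 * C\<^sub>E 1) powr ((p - 1) / p)) * (L * (L powr p) powr ((p - 1) / p)) * ball_int w p \<rho>' powr ((p - 1) / p) * measure lborel (cball (0::'a) \<rho>') powr (1 / p)"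
    using K1 C\<^sub>E_nonneg[of 1] ball_int_nonneg[of w p \<rho>'] by (simp add: powr_mult powr_divide mult_ac)
  \<comment> \<open>One power of L from the cutoff gradient and p - 1 from the energy combine to
    L^p, the scaling (rho'-rho)^(-p).\<close>
  also have "L * (L powr p) powr ((p - 1) / p) = L powr p"
    using p L powr_mult_base[of L "p - 1"] by (simp add: powr_powr)
  also have "L powr p = cutoff_const p powr p * (\<rho>' - \<rho>) powr (- p)"
  proof -
    have "L powr p = cutoff_const p powr p / (\<rho>' - \<rho>) powr p"
      unfolding L_def by (rule powr_divide)
    then show ?thesis by (simp add: powr_minus_divide)
  qed
  finally show ?thesis by (simp add: C\<^sub>M_def mult_ac)
qed

text \<open>The first summand is the gradient part of the translation bound for w^(k/p) zeta, after
  the energy estimate with a = k - p + 1; the second comes from the cutoff gradient.\<close>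

definition "C\<^sub>D k = 4 powr p * (k / p) powr p * (2 / ((k - p + 1) * K1) * C\<^sub>E (k - p + 1)) + 2 powr p"

text \<open>Applied to f = w^(k/p) zeta, the Nash-type inequality speaks of w^k on the left, and the
  energy estimate bounds the increments of f. The shift length \<open>r\<close> is left free: small
  \<open>r\<close> makes the first term absorbable, at the expense of the second.\<close>

lemma reverse_step:
  assumes g: "\<And>x. g x \<le> 0" and \<rho>: "0 < \<rho>" "\<rho> < \<rho>'" and k: "p \<le> k" and m: "0 < m" and r: "0 < r"
  shows "ball_int w k \<rho> \<le> 2 powr (p + 1) * (r powr p * (C\<^sub>D k * (cutoff_const p / (\<rho>' - \<rho>)) powr p * ball_int w k \<rho>')
    + measure lborel (cball (0::'a) \<rho>') * (2 * ball_int w m \<rho>' / measure lborel (cball (0::'a) r)) powr (k / m))"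
proof -
  obtain \<zeta> :: "'a \<Rightarrow> real" and Z where \<zeta>: "C1_grad \<zeta> Z" "\<And>x. 0 \<le> \<zeta> x" "\<And>x. \<zeta> x \<le> 1"
    "\<And>x. norm x \<le> \<rho> \<Longrightarrow> \<zeta> x = 1" "\<And>x. \<rho>' < norm x \<Longrightarrow> \<zeta> x = 0"
    "\<And>x. norm (Z x) \<le> cutoff_const p / (\<rho>' - \<rho>) * \<zeta> x powr ((p - 1) / p)"
    using cutoff_exists[OF p \<rho>] by metis
  define L where "L = cutoff_const p / (\<rho>' - \<rho>)"
  have L: "0 \<le> L" using \<rho> by (simp add: L_def cutoff_const_def)
  \<comment> \<open>With this power the energy weight w^(a-1) is w^(k-p), the p-th power of the
    derivative of s^(k/p) up to a constant.\<close>
  define a where "a = k - p + 1"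
  have a: "a \<ge> 1" "a \<noteq> 0" "\<And>x. a * g x \<le> 0" "a - 1 + p = k" "a - 1 = k - p"
    using k g by (auto simp: a_def mult_le_0_iff)
  note EE = energy_estimate[where r = \<rho>', OF a(2,3) \<zeta>(1-3,5) L \<zeta>(6)[folded L_def], unfolded a(4,5)]
  have kp: "k > 0" "k / p > 0" using p k by auto
  have Zp: "norm (Z x) powr p \<le> L powr p * indicator (cball 0 \<rho>') x" for x
  proof (cases "norm x \<le> \<rho>'")
    case True
    have "\<zeta> x powr ((p - 1) / p) \<le> 1" using p \<zeta>(2,3)[of x] by (intro powr_le1) auto
    then have "norm (Z x) \<le> L * 1"
      using \<zeta>(6)[of x, folded L_def] L by (meson mult_left_mono order_trans)
    then have "norm (Z x) powr p \<le> L powr p" using p by (intro powr_mono2) auto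
    then show ?thesis using True by simp
  next
    case False
    then have "Z x = 0" using C1_grad_support[OF \<zeta>(1), of \<rho>' x] \<zeta>(5) by auto
    then show ?thesis using False by simp
  qed
  let ?h = "\<lambda>s::real. s powr (k / p)" and ?h' = "\<lambda>s::real. k / p * s powr (k / p - 1)"
  define f where "f = (\<lambda>x. ?h (w x) * \<zeta> x)"
  define E where "E = 4 powr p * (\<integral>x. \<bar>?h' (w x)\<bar> powr p * (\<bar>\<zeta> x\<bar> powr p * norm (G x) powr p) \<partial>lebesgue)
      + 2 powr p * (\<integral>x. \<bar>?h (w x)\<bar> powr p * norm (Z x) powr p \<partial>lebesgue)"
  have diff: "(\<integral>x. \<bar>f (x + z) - f x\<bar> powr p \<partial>lborel) \<le> norm z powr p * E" for z
    unfolding f_def E_def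
    by (rule comp_difference[OF _ _ \<zeta>(1,5)]) (use p in \<open>auto intro!: derivative_eq_intros continuous_intros\<close>)
  have E0: "E \<ge> 0" unfolding E_def by (intro add_nonneg_nonneg mult_nonneg_nonneg Bochner_Integration.integral_nonneg) auto
  have E_le: "E \<le> C\<^sub>D k * L powr p * ball_int w k \<rho>'"
  proof -
    have "(\<integral>x. \<bar>?h' (w x)\<bar> powr p * (\<bar>\<zeta> x\<bar> powr p * norm (G x) powr p) \<partial>lebesgue)
      \<le> (\<integral>x. (k / p) powr p * (w x powr (k - p) * (norm (G x) powr p * \<zeta> x)) \<partial>lebesgue)"
    proof (rule integral_mono_AE')
      show "integrable lebesgue (\<lambda>x. (k / p) powr p * (w x powr (k - p) * (norm (G x) powr p * \<zeta> x)))"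
        using EE(2) by simp
      show "AE x in lebesgue. \<bar>?h' (w x)\<bar> powr p * (\<bar>\<zeta> x\<bar> powr p * norm (G x) powr p) \<le> (k / p) powr p * (w x powr (k - p) * (norm (G x) powr p * \<zeta> x))"
      proof (rule AE_I2)
        fix x
        have "\<zeta> x powr p \<le> \<zeta> x powr 1" using p \<zeta>(2,3)[of x] by (intro powr_mono') auto
        then have z: "\<bar>\<zeta> x\<bar> powr p \<le> \<zeta> x" using \<zeta>(2)[of x] by simp
        have e: "(k / p - 1) * p = k - p" using p by (simp add: field_simps)
        have "\<bar>?h' (w x)\<bar> powr p = (k / p) powr p * w x powr (k - p)"
        proof -
          have "\<bar>?h' (w x)\<bar> = k / p * w x powr (k / p - 1)" using kp by (intro abs_of_nonneg mult_nonneg_nonneg) auto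
          then show ?thesis using powr_mult[of "k / p" "w x powr (k / p - 1)" p] by (simp only: powr_powr e)
        qed
        then show "\<bar>?h' (w x)\<bar> powr p * (\<bar>\<zeta> x\<bar> powr p * norm (G x) powr p) \<le> (k / p) powr p * (w x powr (k - p) * (norm (G x) powr p * \<zeta> x))"
          using mult_left_mono[OF z, of "(k / p) powr p * w x powr (k - p) * norm (G x) powr p"] by (simp add: mult_ac)
      qed
      show "AE x in lebesgue. 0 \<le> (k / p) powr p * (w x powr (k - p) * (norm (G x) powr p * \<zeta> x))"
        using \<zeta>(2) by simp
    qed
    also have "\<dots> = (k / p) powr p * (\<integral>x. w x powr (k - p) * (norm (G x) powr p * \<zeta> x) \<partial>lebesgue)" by simp
    also have "\<dots> \<le> (k / p) powr p * (2 / (a * K1) * C\<^sub>E a * (L powr p * ball_int w k \<rho>'))"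
    proof (rule mult_left_mono)
      have "0 \<le> (\<integral>x. w x powr a * (\<bar>g x\<bar> * \<zeta> x) \<partial>lebesgue)"
        using \<zeta>(2) by (intro Bochner_Integration.integral_nonneg) auto
      then have "a * K1 / 2 * (\<integral>x. w x powr (k - p) * (norm (G x) powr p * \<zeta> x) \<partial>lebesgue) \<le> C\<^sub>E a * L powr p * ball_int w k \<rho>'"
        using EE(1) a(1) by simp
      moreover have "a * K1 > 0" using a(1) K1 by simp
      ultimately show "(\<integral>x. w x powr (k - p) * (norm (G x) powr p * \<zeta> x) \<partial>lebesgue) \<le> 2 / (a * K1) * C\<^sub>E a * (L powr p * ball_int w k \<rho>')"
        by (simp add: field_simps)
    qed simp
    finally have e1: "(\<integral>x. \<bar>?h' (w x)\<bar> powr p * (\<bar>\<zeta> x\<bar> powr p * norm (G x) powr p) \<partial>lebesgue)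
      \<le> (k / p) powr p * (2 / (a * K1) * C\<^sub>E a * (L powr p * ball_int w k \<rho>'))" .
    have e2: "(\<integral>x. \<bar>?h (w x)\<bar> powr p * norm (Z x) powr p \<partial>lebesgue) \<le> (\<integral>x. L powr p * (indicator (cball 0 \<rho>') x * w x powr k) \<partial>lebesgue)"
    proof (rule integral_mono_AE')
      show "integrable lebesgue (\<lambda>x. L powr p * (indicator (cball 0 \<rho>') x * w x powr k))"
        using ball_integrable by simp
      show "AE x in lebesgue. \<bar>?h (w x)\<bar> powr p * norm (Z x) powr p \<le> L powr p * (indicator (cball 0 \<rho>') x * w x powr k)"
      proof (rule AE_I2)
        fix x
        show "\<bar>?h (w x)\<bar> powr p * norm (Z x) powr p \<le> L powr p * (indicator (cball 0 \<rho>') x * w x powr k)"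
          using mult_left_mono[OF Zp[of x], of "w x powr k"] p by (simp add: powr_powr mult_ac)
      qed
    qed simp
    also have "\<dots> = L powr p * ball_int w k \<rho>'" by (simp add: ball_int_def)
    finally have e2: "(\<integral>x. \<bar>?h (w x)\<bar> powr p * norm (Z x) powr p \<partial>lebesgue) \<le> L powr p * ball_int w k \<rho>'" .
    have "E \<le> 4 powr p * ((k / p) powr p * (2 / (a * K1) * C\<^sub>E a * (L powr p * ball_int w k \<rho>'))) + 2 powr p * (L powr p * ball_int w k \<rho>')"
      unfolding E_def using e1 e2 by (intro add_mono mult_left_mono) auto
    also have "\<dots> = C\<^sub>D k * L powr p * ball_int w k \<rho>'"
      unfolding C\<^sub>D_def a_def by (simp add: algebra_simps)
    finally show ?thesis .
  qed
  have fcont: "continuous_on UNIV f"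
    unfolding f_def by (intro continuous_on_mult w_powr_cont C1_gradD(3)[OF \<zeta>(1)])
  have f0: "0 \<le> f x" "\<rho>' < norm x \<Longrightarrow> f x = 0" for x using \<zeta>(2)[of x] \<zeta>(5)[of x] by (auto simp: f_def)
  \<comment> \<open>The exponent for f = w^(k/p) zeta that corresponds to w^m.\<close>
  define m' where "m' = m * p / k"
  have m': "m' > 0" "p / m' = k / m" using m p kp by (auto simp: m'_def)
  have fm[measurable]: "f \<in> borel_measurable borel" using fcont by (rule borel_measurable_continuous_onI)
  define S where "S = (\<integral>x. f x powr m' \<partial>lborel)"
  have Si: "integrable lborel (\<lambda>x. f x powr m')"
    using integrable_powr_compact_support[OF fcont f0(2) m'(1)] f0(1) by simp
  have S_le: "S \<le> ball_int w m \<rho>'"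
  proof -
    have "S = (\<integral>x. f x powr m' \<partial>lebesgue)" unfolding S_def using Si by (subst integral_completion) auto
    also have "\<dots> \<le> ball_int w m \<rho>'"
      unfolding ball_int_def
    proof (rule integral_mono_AE'[OF ball_integrable])
      show "AE x in lebesgue. f x powr m' \<le> indicator (cball 0 \<rho>') x * w x powr m"
      proof (rule AE_I2)
        fix x
        show "f x powr m' \<le> indicator (cball 0 \<rho>') x * w x powr m"
        proof (cases "norm x \<le> \<rho>'")
          case True
          have e: "k / p * m' = m" using kp p by (simp add: m'_def)
          have "f x \<le> ?h (w x) * 1" unfolding f_def using \<zeta>(3)[of x] by (intro mult_left_mono) auto
          then have "f x powr m' \<le> (?h (w x)) powr m'" using m' f0(1)[of x] by (intro powr_mono2) auto
          then show ?thesis using True e by (simp add: powr_powr)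
        qed (use f0(2) in auto)
      qed
    qed auto
    finally show ?thesis .
  qed
  have S_pos: "S > 0"
  proof -
    have "S \<noteq> 0"
    proof
      assume "S = 0"
      then have "AE x in lborel. f x powr m' = 0"
        using integral_nonneg_eq_0_iff_AE[OF Si] by (simp add: S_def)
      then have "AE x in lborel. x \<notin> ball (0::'a) \<rho>"
      proof eventually_elim
        fix x assume "f x powr m' = 0"
        then have "f x = 0" by simp
        then show "x \<notin> ball 0 \<rho>" using \<zeta>(4)[of x] w_pos[of x] by (auto simp: f_def)
      qed
      then have "emeasure lborel (ball (0::'a) \<rho>) = 0"
        by (subst (asm) AE_iff_measurable[of "ball 0 \<rho>"]) auto
      then show False using content_ball_pos[OF \<rho>(1), of "0::'a"] by (simp add: measure_def)
    qed
    moreover have "S \<ge> 0" unfolding S_def by (intro Bochner_Integration.integral_nonneg) auto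
    ultimately show ?thesis by simp
  qed
  have b: "measure lborel (cball (0::'a) r) > 0" using content_cball_pos[OF r] .
  have fpi: "integrable lborel (\<lambda>x. f x powr p)"
    using integrable_powr_compact_support[where r = \<rho>' and p = p, OF fcont f0(2)] f0(1) p by simp
  have "ball_int w k \<rho> \<le> (\<integral>x. f x powr p \<partial>lebesgue)"
    unfolding ball_int_def
  proof (rule integral_mono_AE')
    show "integrable lebesgue (\<lambda>x. f x powr p)" using fpi by (subst integrable_completion) auto
    show "AE x in lebesgue. indicator (cball 0 \<rho>) x * w x powr k \<le> f x powr p"
    proof (rule AE_I2)
      fix x show "indicator (cball 0 \<rho>) x * w x powr k \<le> f x powr p"
        using \<zeta>(4)[of x] p by (auto simp: indicator_def f_def powr_powr)
    qed
  qed simp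
  also have "\<dots> = (\<integral>x. f x powr p \<partial>lborel)" using fpi by (subst integral_completion) auto
  also have "\<dots> \<le> 2 powr (p + 1) * (r powr p * E + measure lborel (cball (0::'a) \<rho>') * (2 * S / measure lborel (cball (0::'a) r)) powr (p / m'))"
    using Nash_type_inequality[OF fcont f0 _ m'(1) r E0 diff S_pos[unfolded S_def]] p by (simp add: S_def)
  also have "\<dots> \<le> 2 powr (p + 1) * (r powr p * (C\<^sub>D k * L powr p * ball_int w k \<rho>')
    + measure lborel (cball (0::'a) \<rho>') * (2 * ball_int w m \<rho>' / measure lborel (cball (0::'a) r)) powr (k / m))"
    unfolding m'(2) using E_le S_le S_pos b kp m
    by (intro mult_left_mono add_mono powr_mono2 divide_right_mono) auto
  finally show ?thesis by (simp add: L_def)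
qed

text \<open>The gradient term of the energy estimate is nonnegative and dropped. What matters is the
  order \<open>p - 1 - \<beta>\<close> on the right, which stays below p - 1.\<close>

lemma supersolution_step:
  assumes g: "\<And>x. 0 \<le> g x" and \<rho>: "0 < \<rho>" "\<rho> < \<rho>'" and \<beta>: "0 < \<beta>"
  shows "(\<integral>x. indicator (cball 0 \<rho>) x * (w x powr (- \<beta>) * g x) \<partial>lebesgue)
    \<le> C\<^sub>E (- \<beta>) * (cutoff_const p / (\<rho>' - \<rho>)) powr p * ball_int w (p - 1 - \<beta>) \<rho>'"
proof -
  obtain \<zeta> :: "'a \<Rightarrow> real" and Z where \<zeta>: "C1_grad \<zeta> Z" "\<And>x. 0 \<le> \<zeta> x" "\<And>x. \<zeta> x \<le> 1"
    "\<And>x. norm x \<le> \<rho> \<Longrightarrow> \<zeta> x = 1" "\<And>x. \<rho>' < norm x \<Longrightarrow> \<zeta> x = 0"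
    "\<And>x. norm (Z x) \<le> cutoff_const p / (\<rho>' - \<rho>) * \<zeta> x powr ((p - 1) / p)"
    using cutoff_exists[OF p \<rho>] by metis
  define L where "L = cutoff_const p / (\<rho>' - \<rho>)"
  have L: "0 \<le> L" using \<rho> by (simp add: L_def cutoff_const_def)
  have a: "- \<beta> \<noteq> 0" "\<And>x. - \<beta> * g x \<le> 0" "- \<beta> - 1 + p = p - 1 - \<beta>" using \<beta> g by auto
  note EE = energy_estimate[where r = \<rho>', OF a(1,2) \<zeta>(1-3,5) L \<zeta>(6)[folded L_def], unfolded a(3)]
  have "(\<integral>x. indicator (cball 0 \<rho>) x * (w x powr (- \<beta>) * g x) \<partial>lebesgue) \<le> (\<integral>x. w x powr (- \<beta>) * (\<bar>g x\<bar> * \<zeta> x) \<partial>lebesgue)"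
  proof (rule integral_mono_AE'[OF EE(3)])
    show "AE x in lebesgue. indicator (cball 0 \<rho>) x * (w x powr (- \<beta>) * g x) \<le> w x powr (- \<beta>) * (\<bar>g x\<bar> * \<zeta> x)"
      using \<zeta>(2,4) g by (intro AE_I2) (auto simp: indicator_def)
    show "AE x in lebesgue. 0 \<le> w x powr (- \<beta>) * (\<bar>g x\<bar> * \<zeta> x)" using \<zeta>(2) by simp
  qed
  moreover have "0 \<le> \<bar>- \<beta>\<bar> * K1 / 2 * (\<integral>x. w x powr (- \<beta> - 1) * (norm (G x) powr p * \<zeta> x) \<partial>lebesgue)"
    using \<zeta>(2) K1 by (intro mult_nonneg_nonneg Bochner_Integration.integral_nonneg) auto
  ultimately show ?thesis using EE(1) unfolding L_def by linarith
qed

end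

section \<open>Absorption by iterating over radii\<close>

text \<open>The supremum S of (b-rho)^M Phi(rho) satisfies S \<le> S/2 + 2^M A: stepping halfway
  towards b costs 2^M, which the factor 2^(-M-1) turns into 1/2. The a priori bound \<open>B\<close>
  makes S finite, without which nothing could be subtracted.\<close>

lemma radius_iteration:
  fixes \<Phi> :: "real \<Rightarrow> real"
  assumes ab: "a < b" and M: "M > 0" and A: "0 \<le> A"
    and \<Phi>: "\<And>\<rho>. a \<le> \<rho> \<Longrightarrow> \<rho> \<le> b \<Longrightarrow> 0 \<le> \<Phi> \<rho>" "\<And>\<rho>. a \<le> \<rho> \<Longrightarrow> \<rho> \<le> b \<Longrightarrow> \<Phi> \<rho> \<le> B"
    and step: "\<And>\<rho> \<rho>'. a \<le> \<rho> \<Longrightarrow> \<rho> < \<rho>' \<Longrightarrow> \<rho>' \<le> b \<Longrightarrow> \<Phi> \<rho> \<le> 2 powr (- M - 1) * \<Phi> \<rho>' + A * (\<rho>' - \<rho>) powr (- M)"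
  shows "\<Phi> a \<le> 2 powr (M + 1) * A * (b - a) powr (- M)"
proof -
  let ?f = "\<lambda>\<rho>. (b - \<rho>) powr M * \<Phi> \<rho>"
  define S where "S = (SUP \<rho>\<in>{a..<b}. ?f \<rho>)"
  have bdd: "bdd_above (?f ` {a..<b})"
  proof (rule bdd_aboveI2)
    fix \<rho> assume "\<rho> \<in> {a..<b}"
    then show "?f \<rho> \<le> (b - a) powr M * B" using \<Phi>[of \<rho>] M by (intro mult_mono powr_mono2) auto
  qed
  have le_S: "?f \<rho> \<le> S" if "a \<le> \<rho>" "\<rho> < b" for \<rho>
    unfolding S_def using that by (intro cSUP_upper bdd) auto
  have "?f \<rho> \<le> S / 2 + A * 2 powr M" if "\<rho> \<in> {a..<b}" for \<rho>
  proof -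
    define t where "t = (b - \<rho>) / 2"
    define \<rho>' where "\<rho>' = \<rho> + t"
    have t: "t > 0" "b - \<rho> = 2 * t" "b - \<rho>' = t" "\<rho>' - \<rho> = t" "a \<le> \<rho>" "\<rho> < \<rho>'" "\<rho>' < b"
      using that by (auto simp: t_def \<rho>'_def field_simps)
    have "?f \<rho> \<le> (2 * t) powr M * (2 powr (- M - 1) * \<Phi> \<rho>' + A * t powr (- M))"
      unfolding t(2) using step[of \<rho> \<rho>'] t by (intro mult_left_mono) auto
    also have "\<dots> = (2 powr M * 2 powr (- M - 1)) * (t powr M * \<Phi> \<rho>') + A * 2 powr M * (t powr M * t powr (- M))"
      using t(1) by (simp add: powr_mult algebra_simps)
    also have "2 powr M * 2 powr (- M - 1) = (1 / 2 :: real)" by (simp add: powr_minus flip: powr_add)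
    also have "t powr M * t powr (- M) = 1" using t(1) by (simp flip: powr_add)
    also have "t powr M * \<Phi> \<rho>' \<le> S" using le_S[of \<rho>'] t by simp
    finally show ?thesis by simp
  qed
  then have "S \<le> S / 2 + A * 2 powr M"
    unfolding S_def[symmetric] by (subst S_def) (intro cSUP_least, use ab in auto)
  then have "S \<le> 2 powr (M + 1) * A" by (simp add: powr_add algebra_simps)
  then have "(b - a) powr M * \<Phi> a \<le> 2 powr (M + 1) * A"
    using le_S[of a] ab by simp
  then have "(b - a) powr (- M) * ((b - a) powr M * \<Phi> a) \<le> (b - a) powr (- M) * (2 powr (M + 1) * A)"
    by (intro mult_left_mono) auto
  moreover have "(b - a) powr (- M) * ((b - a) powr M * \<Phi> a) = \<Phi> a"
    using ab by (simp add: mult.assoc[symmetric] flip: powr_add)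
  ultimately have "\<Phi> a \<le> (b - a) powr (- M) * (2 powr (M + 1) * A)" by (simp only:)
  then show ?thesis by (simp only: mult.commute)
qed

text \<open>The sublinear counterpart: the weighted supremum satisfies S \<le> K S^sigma, so S \<le>
  K^(1/(1-sigma)) whatever the a priori bound was. This removes the gap factor and improves the
  decay to \<open>\<gamma> / (1 - \<sigma>)\<close>.\<close>

lemma radius_iteration_power:
  fixes X :: "real \<Rightarrow> real"
  assumes R: "0 < R" and M: "M > 0" and C: "0 < C" and \<sigma>: "0 < \<sigma>" "\<sigma> < 1"
    and X: "\<And>\<rho>. R \<le> \<rho> \<Longrightarrow> \<rho> \<le> 2 * R \<Longrightarrow> 0 \<le> X \<rho>" "\<And>\<rho>. R \<le> \<rho> \<Longrightarrow> \<rho> \<le> 2 * R \<Longrightarrow> X \<rho> \<le> B"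
    and step: "\<And>\<rho> \<rho>'. R \<le> \<rho> \<Longrightarrow> \<rho> < \<rho>' \<Longrightarrow> \<rho>' \<le> 2 * R \<Longrightarrow>
      X \<rho> \<le> C * (R / (\<rho>' - \<rho>)) powr M * R powr (- \<gamma>) * X \<rho>' powr \<sigma>"
  shows "X R \<le> (2 powr (M / (1 - \<sigma>)) * C) powr (1 / (1 - \<sigma>)) * R powr (- \<gamma> / (1 - \<sigma>))"
proof -
  \<comment> \<open>The weight for which M' - M = M' sigma: after the loss t^(-M), the remaining
    power of t is exactly what t^M' X needs inside the sigma-th power.\<close>
  define M' where "M' = M / (1 - \<sigma>)"
  have M': "M' > 0" "M' - M = M' * \<sigma>" using M \<sigma> by (auto simp: M'_def field_simps)
  let ?f = "\<lambda>\<rho>. (2 * R - \<rho>) powr M' * X \<rho>"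
  define S where "S = (SUP \<rho>\<in>{R..<2*R}. ?f \<rho>)"
  have bdd: "bdd_above (?f ` {R..<2*R})"
  proof (rule bdd_aboveI2)
    fix \<rho> assume "\<rho> \<in> {R..<2*R}"
    then show "?f \<rho> \<le> R powr M' * B" using X[of \<rho>] M' by (intro mult_mono powr_mono2) auto
  qed
  have le_S: "?f \<rho> \<le> S" if "R \<le> \<rho>" "\<rho> < 2 * R" for \<rho>
    unfolding S_def using that by (intro cSUP_upper bdd) auto
  define K where "K = 2 powr M' * C * R powr (M - \<gamma>)"
  have K: "K > 0" using C R by (simp add: K_def)
  have "0 \<le> ?f R" using X(1)[of R] R by simp
  then have S0: "S \<ge> 0" using le_S[of R] R by simp
  have "?f \<rho> \<le> K * S powr \<sigma>" if "\<rho> \<in> {R..<2*R}" for \<rho>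
  proof -
    define t where "t = (2 * R - \<rho>) / 2"
    define \<rho>' where "\<rho>' = \<rho> + t"
    have t: "t > 0" "2 * R - \<rho> = 2 * t" "2 * R - \<rho>' = t" "\<rho>' - \<rho> = t" "R \<le> \<rho>" "\<rho> < \<rho>'" "\<rho>' < 2 * R" "R \<le> \<rho>'"
      using that by (auto simp: t_def \<rho>'_def field_simps)
    have Xn: "0 \<le> X \<rho>'" using X(1)[of \<rho>'] t by simp
    have "?f \<rho> \<le> (2 * t) powr M' * (C * (R / t) powr M * R powr (- \<gamma>) * X \<rho>' powr \<sigma>)"
      unfolding t(2) using step[of \<rho> \<rho>'] t by (intro mult_left_mono) auto
    also have "\<dots> = 2 powr M' * C * (R powr M * R powr (- \<gamma>)) * ((t powr M' / t powr M) * X \<rho>' powr \<sigma>)"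
      using t(1) R by (simp add: powr_mult powr_divide mult_ac)
    also have "R powr M * R powr (- \<gamma>) = R powr (M - \<gamma>)" using R by (simp flip: powr_add)
    also have "t powr M' / t powr M = (t powr M') powr \<sigma>"
      using t(1) M'(2) by (simp add: powr_powr flip: powr_diff)
    also have "(t powr M') powr \<sigma> * X \<rho>' powr \<sigma> = (t powr M' * X \<rho>') powr \<sigma>"
      using Xn by (simp add: powr_mult)
    also have "2 powr M' * C * R powr (M - \<gamma>) * (t powr M' * X \<rho>') powr \<sigma> \<le> K * S powr \<sigma>"
      unfolding K_def using le_S[of \<rho>'] t \<sigma> C Xn by (intro mult_left_mono powr_mono2) auto
    finally show ?thesis .
  qed
  then have S1: "S \<le> K * S powr \<sigma>"
    unfolding S_def[symmetric] by (subst S_def) (intro cSUP_least, use R in auto)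
  have S2: "S \<le> K powr (1 / (1 - \<sigma>))"
  proof (cases "S = 0")
    case False
    then have "S > 0" using S0 by simp
    have "S powr (1 - \<sigma>) = S / S powr \<sigma>" using \<open>S > 0\<close> by (simp add: powr_diff)
    also have "\<dots> \<le> K" using S1 \<open>S > 0\<close> by (simp add: field_simps)
    finally have "(S powr (1 - \<sigma>)) powr (1 / (1 - \<sigma>)) \<le> K powr (1 / (1 - \<sigma>))"
      using \<sigma> by (intro powr_mono2) auto
    then show ?thesis using \<sigma> \<open>S > 0\<close> by (simp add: powr_powr)
  qed simp
  have "R powr M' * X R \<le> K powr (1 / (1 - \<sigma>))" using le_S[of R] R S2 by simp
  also have "\<dots> = (2 powr M' * C) powr (1 / (1 - \<sigma>)) * R powr ((M - \<gamma>) * (1 / (1 - \<sigma>)))"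
    using C R by (simp add: K_def powr_mult powr_powr)
  finally have "R powr (- M') * (R powr M' * X R) \<le> R powr (- M') * ((2 powr M' * C) powr (1 / (1 - \<sigma>)) * R powr ((M - \<gamma>) * (1 / (1 - \<sigma>))))"
    by (intro mult_left_mono) auto
  moreover have "R powr (- M') * (R powr M' * X R) = X R" using R by (simp add: mult.assoc[symmetric] flip: powr_add)
  moreover have "R powr (- M') * R powr ((M - \<gamma>) * (1 / (1 - \<sigma>))) = R powr (- \<gamma> / (1 - \<sigma>))"
    using R \<sigma> by (simp add: M'_def diff_divide_distrib flip: powr_add)
  moreover have "R powr (- M') * ((2 powr M' * C) powr (1 / (1 - \<sigma>)) * R powr ((M - \<gamma>) * (1 / (1 - \<sigma>))))
    = (2 powr M' * C) powr (1 / (1 - \<sigma>)) * (R powr (- M') * R powr ((M - \<gamma>) * (1 / (1 - \<sigma>))))"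
    by (rule mult.left_commute)
  ultimately show ?thesis unfolding M'_def[symmetric] by (simp only:)
qed

section \<open>Estimates for nonnegative solutions\<close>

lemma measure_cball_powr:
  assumes "0 < r"
  shows "measure lborel (cball (0::'a::euclidean_space) r) = measure lborel (cball (0::'a) 1) * r powr real DIM('a)"
  using assms content_ball_conv_unit_ball[of r "0::'a"]
  by (simp add: content_cball_conv_ball powr_realpow mult.commute)

lemma ball_measure_unit_pos: "0 < measure lborel (cball (0::'a::euclidean_space) 1)"
  using content_cball_pos[of 1 "0::'a"] by simp

text \<open>The constant is fixed before \<open>\<epsilon>\<close>, w, G, F and g, so the estimate
  survives letting the shift tend to zero. It is the iteration of \<open>reverse_step\<close> with
  shift length proportional to the gap between the radii.\<close>

lemma reverse_Holder_pos:
  fixes p K1 K2 k m :: real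
  assumes p: "1 < p" and k: "p \<le> k" and m: "0 < m"
  obtains C where "C > 0"
    "\<And>\<epsilon> (w::'a::euclidean_space \<Rightarrow> real) G F g R \<rho> \<rho>'. weak_sol p K1 K2 \<epsilon> w G F g \<Longrightarrow> (\<And>x. g x \<le> 0) \<Longrightarrow>
      0 < R \<Longrightarrow> R \<le> \<rho> \<Longrightarrow> \<rho> < \<rho>' \<Longrightarrow> \<rho>' \<le> 2 * R \<Longrightarrow>
      ball_int w k \<rho> \<le> C * R powr real DIM('a) * (\<rho>' - \<rho>) powr (- (real DIM('a) * k / m)) * ball_int w m \<rho>' powr (k / m)"
proof -
  let ?N = "real DIM('a)"
  define M where "M = ?N * k / m"
  have M: "M > 0" using p k m by (simp add: M_def)
  define \<omega> where "\<omega> = measure lborel (cball (0::'a) 1)"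
  have \<omega>: "\<omega> > 0" unfolding \<omega>_def by (rule ball_measure_unit_pos)
  define D0 where "D0 = weak_sol.C\<^sub>D p K1 K2 k * cutoff_const p powr p"
  define D where "D = max 1 D0"
  have D: "D > 0" "D0 \<le> D" by (auto simp: D_def)
  \<comment> \<open>Ratio of shift length to gap, tuned so that the term containing
    \<open>ball_int w k r'\<close> has the factor demanded by \<open>radius_iteration\<close>. The
    maximum in \<open>D\<close> keeps the division legitimate.\<close>
  define \<eta> where "\<eta> = (2 powr (- M - 1) / (2 powr (p + 1) * D)) powr (1 / p)"
  have \<eta>: "\<eta> > 0" "2 powr (p + 1) * \<eta> powr p * D = 2 powr (- M - 1)"
    using D p by (auto simp: \<eta>_def powr_powr)
  define A0 where "A0 = 2 powr (p + 1) * (\<omega> * 2 powr ?N) * (2 / (\<omega> * \<eta> powr ?N)) powr (k / m)"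
  have A0: "A0 > 0" using \<omega> \<eta> by (simp add: A0_def)
  show ?thesis
  proof (rule that[of "2 powr (M + 1) * A0"])
    fix \<epsilon> w G F g and R \<rho> \<rho>' :: real
    assume W: "weak_sol p K1 K2 \<epsilon> (w::'a \<Rightarrow> real) G F g" and g: "\<And>x. g x \<le> 0"
      and R: "0 < R" "R \<le> \<rho>" "\<rho> < \<rho>'" "\<rho>' \<le> 2 * R"
    interpret weak_sol p K1 K2 \<epsilon> w G F g by (rule W)
    define J where "J = ball_int w m \<rho>'"
    have J: "J \<ge> 0" by (simp add: J_def ball_int_nonneg)
    define A where "A = A0 * R powr ?N * J powr (k / m)"
    have "ball_int w k \<rho> \<le> 2 powr (M + 1) * A * (\<rho>' - \<rho>) powr (- M)"
    proof (rule radius_iteration[OF R(3) M])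
      show "0 \<le> A" using A0 by (simp add: A_def)
      show "0 \<le> ball_int w k r" for r by (rule ball_int_nonneg)
      show "ball_int w k r \<le> ball_int w k \<rho>'" if "r \<le> \<rho>'" for r using that by (rule ball_int_mono_radius)
      fix r r' assume r: "\<rho> \<le> r" "r < r'" "r' \<le> \<rho>'"
      define s where "s = r' - r"
      have s: "s > 0" using r by (simp add: s_def)
      have r0: "0 < r" "0 < r'" using r R by auto
      have "ball_int w k r \<le> 2 powr (p + 1) * ((\<eta> * s) powr p * (C\<^sub>D k * (cutoff_const p / s) powr p * ball_int w k r')
        + measure lborel (cball (0::'a) r') * (2 * ball_int w m r' / measure lborel (cball (0::'a) (\<eta> * s))) powr (k / m))"
        unfolding s_def using r r0 \<eta>(1) by (intro reverse_step g k m) auto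
      also have "(\<eta> * s) powr p * (C\<^sub>D k * (cutoff_const p / s) powr p * ball_int w k r') = \<eta> powr p * (D0 * ball_int w k r')"
        using s \<eta>(1) by (simp add: D0_def powr_mult powr_divide cutoff_const_def)
      also have "\<dots> \<le> \<eta> powr p * (D * ball_int w k r')"
        using D ball_int_nonneg by (intro mult_left_mono mult_right_mono) auto
      also have "measure lborel (cball (0::'a) r') * (2 * ball_int w m r' / measure lborel (cball (0::'a) (\<eta> * s))) powr (k / m)
        \<le> (\<omega> * (2 * R) powr ?N) * (2 * J / (\<omega> * (\<eta> * s) powr ?N)) powr (k / m)"
      proof (intro mult_mono powr_mono2)
        show "measure lborel (cball (0::'a) r') \<le> \<omega> * (2 * R) powr ?N"
          unfolding measure_cball_powr[OF r0(2)] \<omega>_def[symmetric] using \<omega> r R r0 by (intro mult_left_mono powr_mono2) auto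
        show "2 * ball_int w m r' / measure lborel (cball (0::'a) (\<eta> * s)) \<le> 2 * J / (\<omega> * (\<eta> * s) powr ?N)"
        proof -
          have "0 < \<eta> * s" using s \<eta> by simp
          moreover have "ball_int w m r' \<le> J" unfolding J_def using r(3) by (rule ball_int_mono_radius)
          ultimately show ?thesis
            unfolding measure_cball_powr[OF \<open>0 < \<eta> * s\<close>] \<omega>_def[symmetric] using \<omega> by (intro divide_right_mono) auto
        qed
      qed (use \<omega> p k m ball_int_nonneg[of w m r'] in auto)
      also have "\<dots> = (\<omega> * 2 powr ?N) * (2 / (\<omega> * \<eta> powr ?N)) powr (k / m) * (R powr ?N * J powr (k / m)) * s powr (- M)"
      proof -
        have "2 * J / (\<omega> * (\<eta> * s) powr ?N) = (2 / (\<omega> * \<eta> powr ?N)) * (J * s powr (- ?N))"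
          using s \<eta>(1) by (simp add: powr_mult powr_minus divide_inverse)
        moreover have "(s powr (- ?N)) powr (k / m) = s powr (- M)" by (simp add: powr_powr M_def)
        moreover have "(2 * R) powr ?N = 2 powr ?N * R powr ?N" using R by (simp add: powr_mult)
        ultimately show ?thesis using \<omega> \<eta>(1) s J
          by (simp only: powr_mult[of "2 / (\<omega> * \<eta> powr ?N)" "J * s powr (- ?N)"] powr_mult[of J "s powr (- ?N)"]) (simp add: mult_ac)
      qed
      finally have "ball_int w k r \<le> 2 powr (p + 1) * (\<eta> powr p * (D * ball_int w k r')
         + (\<omega> * 2 powr ?N) * (2 / (\<omega> * \<eta> powr ?N)) powr (k / m) * (R powr ?N * J powr (k / m)) * s powr (- M))"
        by (simp add: mult_left_mono)
      also have "\<dots> = (2 powr (p + 1) * \<eta> powr p * D) * ball_int w k r' + A * s powr (- M)"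
        unfolding A_def A0_def by (simp add: algebra_simps)
      finally show "ball_int w k r \<le> 2 powr (- M - 1) * ball_int w k r' + A * (r' - r) powr (- M)"
        unfolding \<eta>(2) s_def .
    qed
    then show "ball_int w k \<rho> \<le> 2 powr (M + 1) * A0 * R powr ?N * (\<rho>' - \<rho>) powr (- (?N * k / m)) * ball_int w m \<rho>' powr (k / m)"
      unfolding A_def J_def M_def by (simp add: mult_ac)
  qed (use A0 in simp)
qed

text \<open>The source g and the constants are the same for every shift, while G and F may depend on
  it. The function u itself may vanish, so the estimates are first proved for u + \<epsilon> and
  then passed to the limit.\<close>

definition regularized_sol :: "real \<Rightarrow> real \<Rightarrow> real \<Rightarrow> ('a::euclidean_space \<Rightarrow> real) \<Rightarrow> ('a \<Rightarrow> real) \<Rightarrow> bool" where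
  "regularized_sol p K1 K2 u g \<longleftrightarrow> continuous_on UNIV u \<and> (\<forall>x. 0 \<le> u x) \<and>
     (\<forall>\<epsilon>>0. \<exists>G F. weak_sol p K1 K2 \<epsilon> (\<lambda>x. u x + \<epsilon>) G F g)"

lemma regularized_solD:
  assumes "regularized_sol p K1 K2 u g"
  shows "\<exists>G F. weak_sol p K1 K2 (1 / real (Suc n)) (\<lambda>x. u x + 1 / real (Suc n)) G F g"
proof -
  have "0 < 1 / real (Suc n)" by simp
  with assms show ?thesis unfolding regularized_sol_def by blast
qed

lemma ball_int_integrable:
  fixes u :: "'a::euclidean_space \<Rightarrow> real"
  assumes "continuous_on UNIV u" "\<And>x. 0 \<le> u x" "0 < k"
  shows "integrable lebesgue (\<lambda>x. indicator (cball 0 \<rho>) x * u x powr k)"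
proof -
  have "integrable lborel (\<lambda>x. indicator (cball 0 \<rho>) x *\<^sub>R (u x powr k))"
    using assms by (intro borel_integrable_compact continuous_on_powr' continuous_on_const) (auto intro: continuous_on_subset)
  then show ?thesis by (subst integrable_completion) auto
qed

lemma ball_int_limit:
  fixes u :: "'a::euclidean_space \<Rightarrow> real"
  assumes u: "continuous_on UNIV u" "\<And>x. 0 \<le> u x" and k: "0 < k"
  shows "(\<lambda>n. ball_int (\<lambda>x. u x + 1 / real (Suc n)) k \<rho>) \<longlonglongrightarrow> ball_int u k \<rho>"
  unfolding ball_int_def
proof (rule integral_dominated_convergence)
  have m: "(\<lambda>x. v x powr k) \<in> borel_measurable lebesgue" if "continuous_on UNIV v" "\<And>x. 0 \<le> v x" for v :: "'a \<Rightarrow> real"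
    using that k by (intro borel_measurable_imp_lebesgue borel_measurable_continuous_onI continuous_on_powr' continuous_on_const) auto
  show "(\<lambda>x. indicator (cball 0 \<rho>) x * u x powr k) \<in> borel_measurable lebesgue"
    using u by (intro borel_measurable_times m borel_measurable_indicator) auto
  show "(\<lambda>x. indicator (cball 0 \<rho>) x * (u x + 1 / real (Suc n)) powr k) \<in> borel_measurable lebesgue" for n
    using u by (intro borel_measurable_times m borel_measurable_indicator continuous_on_add continuous_on_const) auto
  show "integrable lebesgue (\<lambda>x. indicator (cball 0 \<rho>) x * (u x + 1) powr k)"
    using u k by (intro ball_int_integrable continuous_on_add continuous_on_const) auto
  show "AE x in lebesgue. (\<lambda>n. indicator (cball 0 \<rho>) x * (u x + 1 / real (Suc n)) powr k) \<longlonglongrightarrow> indicator (cball 0 \<rho>) x * u x powr k"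
  proof (rule AE_I2)
    fix x
    have "(\<lambda>n. u x + 1 / real (Suc n)) \<longlonglongrightarrow> u x + 0"
      using LIMSEQ_inverse_real_of_nat by (intro tendsto_add tendsto_const) (simp add: inverse_eq_divide)
    then have "(\<lambda>n. (u x + 1 / real (Suc n)) powr k) \<longlonglongrightarrow> u x powr k"
      using k u(2)[of x] by (intro tendsto_powr') auto
    then show "(\<lambda>n. indicator (cball 0 \<rho>) x * (u x + 1 / real (Suc n)) powr k) \<longlonglongrightarrow> indicator (cball 0 \<rho>) x * u x powr k"
      by (intro tendsto_mult tendsto_const)
  qed
  show "AE x in lebesgue. norm (indicator (cball 0 \<rho>) x * (u x + 1 / real (Suc n)) powr k) \<le> indicator (cball 0 \<rho>) x * (u x + 1) powr k" for n
  proof (rule AE_I2)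
    fix x
    have "1 / real (Suc n) \<le> 1" "0 \<le> u x + 1 / real (Suc n)" using u(2)[of x] by auto
    then have "(u x + 1 / real (Suc n)) powr k \<le> (u x + 1) powr k" using k by (intro powr_mono2) auto
    then show "norm (indicator (cball 0 \<rho>) x * (u x + 1 / real (Suc n)) powr k) \<le> indicator (cball 0 \<rho>) x * (u x + 1) powr k"
      by (auto simp: indicator_def)
  qed
qed

lemma ball_int_powr_limit:
  fixes u :: "'a::euclidean_space \<Rightarrow> real"
  assumes u: "continuous_on UNIV u" "\<And>x. 0 \<le> u x" and k: "0 < k" and a: "0 < a"
  shows "(\<lambda>n. C * ball_int (\<lambda>x. u x + 1 / real (Suc n)) k \<rho> powr a) \<longlonglongrightarrow> C * ball_int u k \<rho> powr a"
  using a by (intro tendsto_mult tendsto_const tendsto_powr' ball_int_limit u k) (auto simp: ball_int_nonneg)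

lemma reverse_Holder:
  fixes u :: "'a::euclidean_space \<Rightarrow> real"
  assumes u: "regularized_sol p K1 K2 u g" and g: "\<And>x. g x \<le> 0" and p: "1 < p" and k: "p \<le> k" and m: "0 < m"
  obtains C where "C > 0"
    "\<And>R \<rho> \<rho>'. 0 < R \<Longrightarrow> R \<le> \<rho> \<Longrightarrow> \<rho> < \<rho>' \<Longrightarrow> \<rho>' \<le> 2 * R \<Longrightarrow>
      ball_int u k \<rho> \<le> C * R powr real DIM('a) * (\<rho>' - \<rho>) powr (- (real DIM('a) * k / m)) * ball_int u m \<rho>' powr (k / m)"
proof -
  obtain C where C: "C > 0"
    "\<And>\<epsilon> (w::'a::euclidean_space \<Rightarrow> real) G F g R \<rho> \<rho>'. weak_sol p K1 K2 \<epsilon> w G F g \<Longrightarrow> (\<And>x. g x \<le> 0) \<Longrightarrow>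
      0 < R \<Longrightarrow> R \<le> \<rho> \<Longrightarrow> \<rho> < \<rho>' \<Longrightarrow> \<rho>' \<le> 2 * R \<Longrightarrow>
      ball_int w k \<rho> \<le> C * R powr real DIM('a) * (\<rho>' - \<rho>) powr (- (real DIM('a) * k / m)) * ball_int w m \<rho>' powr (k / m)"
    by (rule reverse_Holder_pos[OF p k m, of K1 K2]) blast
  have uc: "continuous_on UNIV u" "\<And>x. 0 \<le> u x" using u by (auto simp: regularized_sol_def)
  show ?thesis
  proof (rule that[OF C(1)])
    fix R \<rho> \<rho>' :: real assume R: "0 < R" "R \<le> \<rho>" "\<rho> < \<rho>'" "\<rho>' \<le> 2 * R"
    show "ball_int u k \<rho> \<le> C * R powr real DIM('a) * (\<rho>' - \<rho>) powr (- (real DIM('a) * k / m)) * ball_int u m \<rho>' powr (k / m)"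
    proof (rule LIMSEQ_le)
      show "(\<lambda>n. ball_int (\<lambda>x. u x + 1 / real (Suc n)) k \<rho>) \<longlonglongrightarrow> ball_int u k \<rho>"
        using p k by (intro ball_int_limit uc) auto
      show "(\<lambda>n. C * R powr real DIM('a) * (\<rho>' - \<rho>) powr (- (real DIM('a) * k / m)) * ball_int (\<lambda>x. u x + 1 / real (Suc n)) m \<rho>' powr (k / m))
        \<longlonglongrightarrow> C * R powr real DIM('a) * (\<rho>' - \<rho>) powr (- (real DIM('a) * k / m)) * ball_int u m \<rho>' powr (k / m)"
        using p k m by (intro ball_int_powr_limit uc) auto
      show "\<exists>N. \<forall>n\<ge>N. ball_int (\<lambda>x. u x + 1 / real (Suc n)) k \<rho> \<le> C * R powr real DIM('a) * (\<rho>' - \<rho>) powr (- (real DIM('a) * k / m)) * ball_int (\<lambda>x. u x + 1 / real (Suc n)) m \<rho>' powr (k / m)"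
      proof (intro exI allI impI)
        fix n :: nat
        obtain G F where "weak_sol p K1 K2 (1 / real (Suc n)) (\<lambda>x. u x + 1 / real (Suc n)) G F g"
          using regularized_solD[OF u] by blast
        from C(2)[OF this g R] show "ball_int (\<lambda>x. u x + 1 / real (Suc n)) k \<rho> \<le> C * R powr real DIM('a) * (\<rho>' - \<rho>) powr (- (real DIM('a) * k / m)) * ball_int (\<lambda>x. u x + 1 / real (Suc n)) m \<rho>' powr (k / m)" .
      qed
    qed
  qed
qed

lemma mass_estimate:
  fixes u :: "'a::euclidean_space \<Rightarrow> real"
  assumes u: "regularized_sol p K1 K2 u g" and g: "\<And>x. g x \<le> 0" and p: "1 < p"
  obtains C where "C > 0"
    "\<And>R \<rho> \<rho>'. 0 < R \<Longrightarrow> R \<le> \<rho> \<Longrightarrow> \<rho> < \<rho>' \<Longrightarrow> \<rho>' \<le> 2 * R \<Longrightarrow>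
      (\<integral>x. indicator (cball 0 \<rho>) x * \<bar>g x\<bar> \<partial>lebesgue) \<le> C * (\<rho>' - \<rho>) powr (- p) * R powr (real DIM('a) / p) * ball_int u p \<rho>' powr ((p - 1) / p)"
proof -
  let ?N = "real DIM('a)"
  define \<omega> where "\<omega> = measure lborel (cball (0::'a) 1)"
  have \<omega>: "\<omega> > 0" unfolding \<omega>_def by (rule ball_measure_unit_pos)
  \<comment> \<open>The maximum with 1 guarantees a strictly positive constant.\<close>
  define CM where "CM = max 1 (weak_sol.C\<^sub>M p K1 K2)"
  define C where "C = CM * (\<omega> * 2 powr ?N) powr (1 / p)"
  have uc: "continuous_on UNIV u" "\<And>x. 0 \<le> u x" using u by (auto simp: regularized_sol_def)
  show ?thesis
  proof (rule that[of C])
    show "C > 0" using \<omega> by (simp add: C_def CM_def)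
    fix R \<rho> \<rho>' :: real assume R: "0 < R" "R \<le> \<rho>" "\<rho> < \<rho>'" "\<rho>' \<le> 2 * R"
    show "(\<integral>x. indicator (cball 0 \<rho>) x * \<bar>g x\<bar> \<partial>lebesgue) \<le> C * (\<rho>' - \<rho>) powr (- p) * R powr (?N / p) * ball_int u p \<rho>' powr ((p - 1) / p)"
    \<comment> \<open>The left side is constant in n, as the source does not change with the
      shift.\<close>
    proof (rule LIMSEQ_le[OF tendsto_const])
      show "(\<lambda>n. C * (\<rho>' - \<rho>) powr (- p) * R powr (?N / p) * ball_int (\<lambda>x. u x + 1 / real (Suc n)) p \<rho>' powr ((p - 1) / p))
        \<longlonglongrightarrow> C * (\<rho>' - \<rho>) powr (- p) * R powr (?N / p) * ball_int u p \<rho>' powr ((p - 1) / p)"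
        using p by (intro ball_int_powr_limit uc) auto
      show "\<exists>N. \<forall>n\<ge>N. (\<integral>x. indicator (cball 0 \<rho>) x * \<bar>g x\<bar> \<partial>lebesgue) \<le> C * (\<rho>' - \<rho>) powr (- p) * R powr (?N / p) * ball_int (\<lambda>x. u x + 1 / real (Suc n)) p \<rho>' powr ((p - 1) / p)"
      proof (intro exI allI impI)
        fix n :: nat
        let ?w = "\<lambda>x. u x + 1 / real (Suc n)"
        obtain G F where W: "weak_sol p K1 K2 (1 / real (Suc n)) ?w G F g"
          using regularized_solD[OF u] by blast
        have r0: "0 < \<rho>" "0 < \<rho>'" using R by auto
        let ?B = "(\<rho>' - \<rho>) powr (- p) * ball_int ?w p \<rho>' powr ((p - 1) / p)"
        have "(\<integral>x. indicator (cball 0 \<rho>) x * \<bar>g x\<bar> \<partial>lebesgue) \<le> weak_sol.C\<^sub>M p K1 K2 * (?B * measure lborel (cball (0::'a) \<rho>') powr (1 / p))"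
          using weak_sol.mass_step[OF W g r0(1) R(3)] by (simp add: mult.assoc)
        also have "\<dots> \<le> CM * (?B * (\<omega> * (2 * R) powr ?N) powr (1 / p))"
          unfolding measure_cball_powr[OF r0(2)] \<omega>_def[symmetric] CM_def
          using \<omega> R r0 p by (intro mult_mono powr_mono2 mult_left_mono) auto
        also have "\<dots> = C * (\<rho>' - \<rho>) powr (- p) * R powr (?N / p) * ball_int ?w p \<rho>' powr ((p - 1) / p)"
          using \<omega> R by (simp add: C_def powr_mult powr_powr mult_ac)
        finally show "(\<integral>x. indicator (cball 0 \<rho>) x * \<bar>g x\<bar> \<partial>lebesgue) \<le> C * (\<rho>' - \<rho>) powr (- p) * R powr (?N / p) * ball_int ?w p \<rho>' powr ((p - 1) / p)" .
      qed
    qed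
  qed
qed

text \<open>Hoelder interpolation between w^(-beta) u^mu, bounded by the energy estimate, and w^s,
  with weights theta and 1 - theta. The powers of w cancel and leave u^(theta mu); the bound is
  linear in the integral of v because both factors involve the same integral J.\<close>

lemma supersolution_estimate:
  fixes u v :: "'a::euclidean_space \<Rightarrow> real"
  assumes v: "regularized_sol p K1 K2 v (\<lambda>x. u x powr \<mu>)" and u: "continuous_on UNIV u" "\<And>x. 0 \<le> u x"
    and p: "1 < p" and \<mu>: "0 < \<mu>" and \<theta>: "0 < \<theta>" "\<theta> < 1"
  obtains C where "C > 0"
    "\<And>\<rho> \<rho>'. 0 < \<rho> \<Longrightarrow> \<rho> < \<rho>' \<Longrightarrow> ball_int u (\<theta> * \<mu>) \<rho> \<le> C * (\<rho>' - \<rho>) powr (- (p * \<theta>)) * ball_int v (\<theta> * (p - 1)) \<rho>'"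
proof -
  \<comment> \<open>With \<open>\<beta>\<close> = (1-theta)(p-1), the energy estimate returns
    precisely the order s, and the exponent -beta theta + s(1-theta) of w in the interpolation is
    zero.\<close>
  define s where "s = \<theta> * (p - 1)"
  define \<beta> where "\<beta> = (1 - \<theta>) * (p - 1)"
  have "s > 0" "\<beta> > 0" unfolding s_def \<beta>_def using p \<theta> by (intro mult_pos_pos; simp)+
  moreover have "p - 1 - \<beta> = s" "- \<beta> * \<theta> + s * (1 - \<theta>) = 0"
    by (simp_all add: s_def \<beta>_def algebra_simps)
  ultimately have s: "s > 0" "\<beta> > 0" "p - 1 - \<beta> = s" "- \<beta> * \<theta> + s * (1 - \<theta>) = 0" by blast+
  define D where "D = max 1 (weak_sol.C\<^sub>E p K1 K2 (- \<beta>) * cutoff_const p powr p)"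
  have D: "D > 0" by (simp add: D_def)
  have vc: "continuous_on UNIV v" "\<And>x. 0 \<le> v x" using v by (auto simp: regularized_sol_def)
  show ?thesis
  proof (rule that[of "D powr \<theta>"])
    show "D powr \<theta> > 0" using D by simp
    fix \<rho> \<rho>' :: real assume R: "0 < \<rho>" "\<rho> < \<rho>'"
    have "ball_int u (\<theta> * \<mu>) \<rho> \<le> D powr \<theta> * (\<rho>' - \<rho>) powr (- (p * \<theta>)) * ball_int v s \<rho>'"
    proof (rule LIMSEQ_le[OF tendsto_const])
      show "(\<lambda>n. D powr \<theta> * (\<rho>' - \<rho>) powr (- (p * \<theta>)) * ball_int (\<lambda>x. v x + 1 / real (Suc n)) s \<rho>')
        \<longlonglongrightarrow> D powr \<theta> * (\<rho>' - \<rho>) powr (- (p * \<theta>)) * ball_int v s \<rho>'"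
        by (intro tendsto_mult tendsto_const ball_int_limit vc s)
      show "\<exists>N. \<forall>n\<ge>N. ball_int u (\<theta> * \<mu>) \<rho> \<le> D powr \<theta> * (\<rho>' - \<rho>) powr (- (p * \<theta>)) * ball_int (\<lambda>x. v x + 1 / real (Suc n)) s \<rho>'"
      proof (intro exI allI impI)
        fix n :: nat
        define w where "w = (\<lambda>x. v x + 1 / real (Suc n))"
        obtain G F where W: "weak_sol p K1 K2 (1 / real (Suc n)) w G F (\<lambda>x. u x powr \<mu>)"
          using regularized_solD[OF v] unfolding w_def by blast
        interpret weak_sol p K1 K2 "1 / real (Suc n)" w G F "\<lambda>x. u x powr \<mu>" by (rule W)
        let ?f = "\<lambda>x. indicator (cball 0 \<rho>) x * (w x powr (- \<beta>) * u x powr \<mu>)"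
        let ?g = "\<lambda>x. indicator (cball 0 \<rho>) x * w x powr s"
        let ?J = "ball_int w s \<rho>'"
        have "(\<integral>x. ?f x \<partial>lebesgue) \<le> C\<^sub>E (- \<beta>) * (cutoff_const p / (\<rho>' - \<rho>)) powr p * ?J"
          using supersolution_step[OF _ R s(2)] s(3) by simp
        also have "\<dots> = (C\<^sub>E (- \<beta>) * cutoff_const p powr p) * ((\<rho>' - \<rho>) powr (- p) * ?J)"
          using R by (simp add: powr_divide powr_minus_divide cutoff_const_def)
        also have "\<dots> \<le> D * ((\<rho>' - \<rho>) powr (- p) * ?J)"
          using ball_int_nonneg[of w s \<rho>'] by (intro mult_right_mono) (auto simp: D_def)
        finally have f_le: "(\<integral>x. ?f x \<partial>lebesgue) \<le> D * ((\<rho>' - \<rho>) powr (- p) * ?J)" .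
        have fi: "integrable lebesgue ?f"
        proof -
          have "continuous_on UNIV (\<lambda>x. w x powr (- \<beta>) * u x powr \<mu>)"
            using u \<mu> by (intro continuous_on_mult w_powr_cont continuous_on_powr' continuous_on_const) auto
          then have "integrable lborel (\<lambda>x. indicator (cball 0 \<rho>) x *\<^sub>R (w x powr (- \<beta>) * u x powr \<mu>))"
            by (intro borel_integrable_compact) (auto intro: continuous_on_subset)
          then show ?thesis by (subst integrable_completion) auto
        qed
        have eq: "?f x powr \<theta> * ?g x powr (1 - \<theta>) = indicator (cball 0 \<rho>) x * u x powr (\<theta> * \<mu>)" for x
        proof (cases "norm x \<le> \<rho>")
          case True
          have "?f x powr \<theta> * ?g x powr (1 - \<theta>) = (w x powr (- \<beta> * \<theta>) * w x powr (s * (1 - \<theta>))) * u x powr (\<mu> * \<theta>)"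
            using True by (simp add: powr_mult powr_powr)
          also have "w x powr (- \<beta> * \<theta>) * w x powr (s * (1 - \<theta>)) = 1"
            using s(4) w_pos[of x] by (simp flip: powr_add)
          finally show ?thesis using True by (simp add: mult.commute)
        qed (use \<theta> in simp)
        have "ball_int u (\<theta> * \<mu>) \<rho> \<le> (\<integral>x. ?f x \<partial>lebesgue) powr \<theta> * ball_int w s \<rho> powr (1 - \<theta>)"
          using Holder_powr(2)[OF fi _ ball_integrable[of \<rho> s] _ \<theta>, unfolded eq] by (simp add: ball_int_def)
        also have "\<dots> \<le> (D * ((\<rho>' - \<rho>) powr (- p) * ?J)) powr \<theta> * ?J powr (1 - \<theta>)"
          using f_le \<theta> R ball_int_nonneg[of w s \<rho>] ball_int_mono_radius[of \<rho> \<rho>' s]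
          by (intro mult_mono powr_mono2) (auto intro!: Bochner_Integration.integral_nonneg)
        also have "\<dots> = D powr \<theta> * (\<rho>' - \<rho>) powr (- (p * \<theta>)) * (?J powr \<theta> * ?J powr (1 - \<theta>))"
          using D ball_int_nonneg[of w s \<rho>'] by (simp add: powr_mult powr_powr)
        also have "?J powr \<theta> * ?J powr (1 - \<theta>) = ?J"
          using ball_int_nonneg[of w s \<rho>'] by (cases "?J = 0") (simp_all flip: powr_add)
        finally show "ball_int u (\<theta> * \<mu>) \<rho> \<le> D powr \<theta> * (\<rho>' - \<rho>) powr (- (p * \<theta>)) * ball_int (\<lambda>x. v x + 1 / real (Suc n)) s \<rho>'"
          unfolding w_def .
      qed
    qed
    then show "ball_int u (\<theta> * \<mu>) \<rho> \<le> D powr \<theta> * (\<rho>' - \<rho>) powr (- (p * \<theta>)) * ball_int v (\<theta> * (p - 1)) \<rho>'"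
      by (simp add: s_def)
  qed
qed

lemma ball_int_Jensen:
  fixes u :: "'a::euclidean_space \<Rightarrow> real"
  assumes u: "continuous_on UNIV u" "\<And>x. 0 \<le> u x" and st: "0 < s" "s \<le> t" and \<rho>: "0 < \<rho>"
  shows "ball_int u s \<rho> \<le> ball_int u t \<rho> powr (s / t) * measure lborel (cball (0::'a) \<rho>) powr (1 - s / t)"
proof (cases "s = t")
  case True
  have "0 < measure lborel (cball (0::'a) \<rho>)" using content_cball_pos[OF \<rho>] by simp
  then show ?thesis using True st ball_int_nonneg[of u t \<rho>] by auto
next
  case False
  then have \<theta>: "0 < s / t" "s / t < 1" using st by auto
  have ii: "integrable lebesgue (\<lambda>x::'a. indicator (cball 0 \<rho>) x :: real)"
    using emeasure_lborel_cball_finite[of "0::'a" \<rho>] by (intro integrable_real_indicator) auto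
  have eq: "(indicator (cball 0 \<rho>) x * u x powr t) powr (s / t) * indicator (cball 0 \<rho>) x powr (1 - s / t)
    = indicator (cball 0 \<rho>) x * u x powr s" for x
    using st by (auto simp: indicator_def powr_powr)
  show ?thesis
    using Holder_powr(2)[OF ball_int_integrable[OF u, of t \<rho>] _ ii _ \<theta>, unfolded eq] st u(2)
    by (simp add: ball_int_def)
qed

section \<open>Liouville theorem\<close>

text \<open>The volume factor uses the outer scale \<open>R\<close> instead of
  \<open>\<rho>\<close>. For radii in [R, 2R] this differs from a true mean by bounded factors only,
  and for \<open>k > 0\<close> it makes the norm monotone in the radius.\<close>

definition mean_norm :: "real \<Rightarrow> ('a::euclidean_space \<Rightarrow> real) \<Rightarrow> real \<Rightarrow> real \<Rightarrow> real" where
  "mean_norm R u k \<rho> = (ball_int u k \<rho> / R powr real DIM('a)) powr (1 / k)"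

text \<open>Hides the constant and the power of the gap factor. Only the decay
  \<open>\<gamma>\<close> and the exponent \<open>\<sigma>\<close> matter in the end, and they must
  not depend on \<open>R\<close>.\<close>

definition controls :: "('a::euclidean_space \<Rightarrow> real) \<Rightarrow> real \<Rightarrow> ('a \<Rightarrow> real) \<Rightarrow> real \<Rightarrow> real \<Rightarrow> real \<Rightarrow> bool" where
  "controls u a v b \<gamma> \<sigma> \<longleftrightarrow> (\<exists>C>0. \<exists>M>0. \<forall>R \<rho> \<rho>'. 0 < R \<longrightarrow> R \<le> \<rho> \<longrightarrow> \<rho> < \<rho>' \<longrightarrow> \<rho>' \<le> 2 * R \<longrightarrow>
     mean_norm R u a \<rho> \<le> C * (R / (\<rho>' - \<rho>)) powr M * R powr (- \<gamma>) * mean_norm R v b \<rho>' powr \<sigma>)"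

lemma mean_norm_nonneg: "0 \<le> mean_norm R u k \<rho>"
  by (simp add: mean_norm_def)

lemma ball_int_eq_scaled:
  fixes u :: "'a::euclidean_space \<Rightarrow> real"
  assumes "0 < R"
  shows "ball_int u k \<rho> = R powr real DIM('a) * (ball_int u k \<rho> / R powr real DIM('a))"
    and "0 \<le> ball_int u k \<rho> / R powr real DIM('a)"
  using assms ball_int_nonneg[of u k \<rho>] by auto

text \<open>The two bounds are joined at the midpoint radius, which merely doubles the gap factor.
  The pairs (gamma, sigma) compose like affine maps.\<close>

lemma controls_trans:
  assumes 1: "controls u a v b \<gamma>1 \<sigma>1" and 2: "controls v b z c \<gamma>2 \<sigma>2" and \<sigma>: "0 < \<sigma>1"
  shows "controls u a z c (\<gamma>1 + \<sigma>1 * \<gamma>2) (\<sigma>1 * \<sigma>2)"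
proof -
  obtain C1 M1 where c1: "C1 > 0" "M1 > 0" "\<And>R \<rho> \<rho>'. 0 < R \<Longrightarrow> R \<le> \<rho> \<Longrightarrow> \<rho> < \<rho>' \<Longrightarrow> \<rho>' \<le> 2 * R \<Longrightarrow>
     mean_norm R u a \<rho> \<le> C1 * (R / (\<rho>' - \<rho>)) powr M1 * R powr (- \<gamma>1) * mean_norm R v b \<rho>' powr \<sigma>1"
    using 1 unfolding controls_def by blast
  obtain C2 M2 where c2: "C2 > 0" "M2 > 0" "\<And>R \<rho> \<rho>'. 0 < R \<Longrightarrow> R \<le> \<rho> \<Longrightarrow> \<rho> < \<rho>' \<Longrightarrow> \<rho>' \<le> 2 * R \<Longrightarrow>
     mean_norm R v b \<rho> \<le> C2 * (R / (\<rho>' - \<rho>)) powr M2 * R powr (- \<gamma>2) * mean_norm R z c \<rho>' powr \<sigma>2"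
    using 2 unfolding controls_def by blast
  define M where "M = M1 + M2 * \<sigma>1"
  have M: "M > 0" using c1 c2 \<sigma> by (simp add: M_def add_pos_pos)
  define C where "C = C1 * C2 powr \<sigma>1 * 2 powr M"
  have C: "C > 0" using c1 c2 by (simp add: C_def)
  have "mean_norm R u a \<rho> \<le> C * (R / (\<rho>' - \<rho>)) powr M * R powr (- (\<gamma>1 + \<sigma>1 * \<gamma>2)) * mean_norm R z c \<rho>' powr (\<sigma>1 * \<sigma>2)"
    if R: "0 < R" "R \<le> \<rho>" "\<rho> < \<rho>'" "\<rho>' \<le> 2 * R" for R \<rho> \<rho>'
  proof -
    define m where "m = (\<rho> + \<rho>') / 2"
    have m: "R \<le> m" "\<rho> < m" "m < \<rho>'" "m \<le> 2 * R" "m - \<rho> = (\<rho>' - \<rho>) / 2" "\<rho>' - m = (\<rho>' - \<rho>) / 2"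
      using R by (auto simp: m_def field_simps)
    define t where "t = R / ((\<rho>' - \<rho>) / 2)"
    have t: "t > 0" "t = 2 * (R / (\<rho>' - \<rho>))" using R by (auto simp: t_def)
    let ?X = "mean_norm R z c \<rho>'"
    have "mean_norm R u a \<rho> \<le> C1 * t powr M1 * R powr (- \<gamma>1) * mean_norm R v b m powr \<sigma>1"
      using c1(3)[OF R(1,2) m(2,4)] by (simp add: m(5) t_def)
    also have "\<dots> \<le> C1 * t powr M1 * R powr (- \<gamma>1) * (C2 * t powr M2 * R powr (- \<gamma>2) * ?X powr \<sigma>2) powr \<sigma>1"
      using c2(3)[OF R(1) m(1,3) R(4)] \<sigma> c1(1) mean_norm_nonneg[of R v b m]
      by (intro mult_left_mono powr_mono2) (auto simp: m(6) t_def)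
    also have "\<dots> = C1 * C2 powr \<sigma>1 * (t powr M1 * t powr (M2 * \<sigma>1)) * (R powr (- \<gamma>1) * R powr (- \<gamma>2 * \<sigma>1)) * ?X powr (\<sigma>2 * \<sigma>1)"
      using c2(1) t(1) R(1) by (simp add: powr_mult powr_powr mult_ac)
    also have "t powr M1 * t powr (M2 * \<sigma>1) = t powr M" using t by (simp add: M_def powr_add)
    also have "t powr M = 2 powr M * (R / (\<rho>' - \<rho>)) powr M" unfolding t(2) using R by (intro powr_mult)
    also have "R powr (- \<gamma>1) * R powr (- \<gamma>2 * \<sigma>1) = R powr (- (\<gamma>1 + \<sigma>1 * \<gamma>2))"
      using R by (simp add: mult.commute flip: powr_add)
    finally show ?thesis by (simp add: C_def mult_ac)
  qed
  then show ?thesis unfolding controls_def using C M by blast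
qed

text \<open>The reverse Hoelder inequality is scale invariant: after normalisation all powers of R
  collect in the gap factor, so there is no decay and the exponent is 1.\<close>

lemma controls_reverse_Holder:
  fixes u :: "'a::euclidean_space \<Rightarrow> real"
  assumes u: "regularized_sol p K1 K2 u g" and g: "\<And>x. g x \<le> 0" and p: "1 < p" and k: "p \<le> k" and m: "0 < m"
  shows "controls u k u m 0 1"
proof -
  let ?N = "real DIM('a)"
  obtain C where C: "C > 0"
    "\<And>R \<rho> \<rho>'. 0 < R \<Longrightarrow> R \<le> \<rho> \<Longrightarrow> \<rho> < \<rho>' \<Longrightarrow> \<rho>' \<le> 2 * R \<Longrightarrow>
      ball_int u k \<rho> \<le> C * R powr ?N * (\<rho>' - \<rho>) powr (- (?N * k / m)) * ball_int u m \<rho>' powr (k / m)"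
    by (rule reverse_Holder[OF u g p k m]) blast
  have k0: "k > 0" using p k by simp
  have "mean_norm R u k \<rho> \<le> C powr (1 / k) * (R / (\<rho>' - \<rho>)) powr (?N / m) * R powr (- 0) * mean_norm R u m \<rho>' powr 1"
    if R: "0 < R" "R \<le> \<rho>" "\<rho> < \<rho>'" "\<rho>' \<le> 2 * R" for R \<rho> \<rho>'
  proof -
    define j where "j = ball_int u m \<rho>' / R powr ?N"
    have j: "ball_int u m \<rho>' = R powr ?N * j" "j \<ge> 0" using ball_int_eq_scaled[OF R(1), of u m \<rho>'] by (auto simp: j_def)
    have "ball_int u k \<rho> / R powr ?N \<le> C * R powr ?N * (\<rho>' - \<rho>) powr (- (?N * k / m)) * (R powr ?N * j) powr (k / m) / R powr ?N"
      using C(2)[OF R] unfolding j(1) by (intro divide_right_mono) auto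
    also have "\<dots> = C * (R / (\<rho>' - \<rho>)) powr (?N * k / m) * j powr (k / m)"
      using R j(2) by (simp add: powr_mult powr_powr powr_divide powr_minus_divide)
    finally have "mean_norm R u k \<rho> \<le> (C * (R / (\<rho>' - \<rho>)) powr (?N * k / m) * j powr (k / m)) powr (1 / k)"
      unfolding mean_norm_def using k0 ball_int_nonneg[of u k \<rho>] by (intro powr_mono2) auto
    also have "\<dots> = C powr (1 / k) * (R / (\<rho>' - \<rho>)) powr (?N / m) * j powr (1 / m)"
      using C(1) R j(2) k0 by (simp add: powr_mult powr_powr)
    finally show ?thesis using R by (simp add: mean_norm_def j_def)
  qed
  moreover have "C powr (1 / k) > 0" "?N / m > 0" using C m by auto
  ultimately show ?thesis unfolding controls_def by blast
qed

text \<open>The volume powers N/p and N(p-1)/p add up to N and cancel with the normalisation. What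
  remains is (rho'-rho)^(-p), a gap factor times R^(-p): this is the source of the decay.\<close>

lemma controls_mass:
  fixes u :: "'a::euclidean_space \<Rightarrow> real"
  assumes u: "regularized_sol p K1 K2 u (\<lambda>x. - (v x powr \<delta>))" and p: "1 < p" and \<delta>: "0 < \<delta>"
  shows "controls v \<delta> u p (p / \<delta>) ((p - 1) / \<delta>)"
proof -
  let ?N = "real DIM('a)"
  obtain C where C: "C > 0"
    "\<And>R \<rho> \<rho>'. 0 < R \<Longrightarrow> R \<le> \<rho> \<Longrightarrow> \<rho> < \<rho>' \<Longrightarrow> \<rho>' \<le> 2 * R \<Longrightarrow>
      (\<integral>x. indicator (cball 0 \<rho>) x * \<bar>- (v x powr \<delta>)\<bar> \<partial>lebesgue) \<le> C * (\<rho>' - \<rho>) powr (- p) * R powr (?N / p) * ball_int u p \<rho>' powr ((p - 1) / p)"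
    by (rule mass_estimate[OF u _ p]) auto
  have "mean_norm R v \<delta> \<rho> \<le> C powr (1 / \<delta>) * (R / (\<rho>' - \<rho>)) powr (p / \<delta>) * R powr (- (p / \<delta>)) * mean_norm R u p \<rho>' powr ((p - 1) / \<delta>)"
    if R: "0 < R" "R \<le> \<rho>" "\<rho> < \<rho>'" "\<rho>' \<le> 2 * R" for R \<rho> \<rho>'
  proof -
    define j where "j = ball_int u p \<rho>' / R powr ?N"
    have j: "ball_int u p \<rho>' = R powr ?N * j" "j \<ge> 0" using ball_int_eq_scaled[OF R(1), of u p \<rho>'] by (auto simp: j_def)
    have "ball_int v \<delta> \<rho> / R powr ?N \<le> C * (\<rho>' - \<rho>) powr (- p) * R powr (?N / p) * (R powr ?N * j) powr ((p - 1) / p) / R powr ?N"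
      using C(2)[OF R] unfolding j(1) by (intro divide_right_mono) (auto simp: ball_int_def)
    also have "\<dots> = C * (\<rho>' - \<rho>) powr (- p) * ((R powr (?N / p) * R powr (?N * ((p - 1) / p))) / R powr ?N) * j powr ((p - 1) / p)"
      using R j(2) by (simp add: powr_mult powr_powr)
    also have "R powr (?N / p) * R powr (?N * ((p - 1) / p)) = R powr ?N"
    proof -
      have "?N / p + ?N * ((p - 1) / p) = ?N" using p by (simp add: field_simps)
      then show ?thesis using R by (simp flip: powr_add)
    qed
    finally have "ball_int v \<delta> \<rho> / R powr ?N \<le> C * (\<rho>' - \<rho>) powr (- p) * j powr ((p - 1) / p)" using R by simp
    then have "mean_norm R v \<delta> \<rho> \<le> (C * (\<rho>' - \<rho>) powr (- p) * j powr ((p - 1) / p)) powr (1 / \<delta>)"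
      unfolding mean_norm_def using \<delta> ball_int_nonneg[of v \<delta> \<rho>] by (intro powr_mono2) auto
    also have "\<dots> = C powr (1 / \<delta>) * (\<rho>' - \<rho>) powr (- (p / \<delta>)) * (j powr (1 / p)) powr ((p - 1) / \<delta>)"
      using C(1) R j(2) by (simp add: powr_mult powr_powr)
    also have "(\<rho>' - \<rho>) powr (- (p / \<delta>)) = (R / (\<rho>' - \<rho>)) powr (p / \<delta>) * R powr (- (p / \<delta>))"
      using R by (simp add: powr_divide powr_minus_divide)
    finally show ?thesis by (simp add: mean_norm_def j_def mult_ac)
  qed
  moreover have "C powr (1 / \<delta>) > 0" "p / \<delta> > 0" using C p \<delta> by auto
  ultimately show ?thesis unfolding controls_def by blast
qed

text \<open>Decay and exponent are those of \<open>controls_mass\<close>, with no trace of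
  \<open>\<theta>\<close>: raising to the power 1/(theta mu) undoes the interpolation. Hence both
  systems can share one conclusion.\<close>

lemma controls_supersolution:
  fixes u v :: "'a::euclidean_space \<Rightarrow> real"
  assumes v: "regularized_sol p K1 K2 v (\<lambda>x. u x powr \<mu>)" and u: "continuous_on UNIV u" "\<And>x. 0 \<le> u x"
    and p: "1 < p" and \<mu>: "0 < \<mu>" and \<theta>: "0 < \<theta>" "\<theta> < 1"
  shows "controls u (\<theta> * \<mu>) v (\<theta> * (p - 1)) (p / \<mu>) ((p - 1) / \<mu>)"
proof -
  let ?N = "real DIM('a)" and ?s = "\<theta> * (p - 1)"
  obtain C where C: "C > 0"
    "\<And>\<rho> \<rho>'. 0 < \<rho> \<Longrightarrow> \<rho> < \<rho>' \<Longrightarrow> ball_int u (\<theta> * \<mu>) \<rho> \<le> C * (\<rho>' - \<rho>) powr (- (p * \<theta>)) * ball_int v ?s \<rho>'"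
    by (rule supersolution_estimate[OF v u p \<mu> \<theta>]) blast
  have "mean_norm R u (\<theta> * \<mu>) \<rho> \<le> C powr (1 / (\<theta> * \<mu>)) * (R / (\<rho>' - \<rho>)) powr (p / \<mu>) * R powr (- (p / \<mu>)) * mean_norm R v ?s \<rho>' powr ((p - 1) / \<mu>)"
    if R: "0 < R" "R \<le> \<rho>" "\<rho> < \<rho>'" "\<rho>' \<le> 2 * R" for R \<rho> \<rho>'
  proof -
    define j where "j = ball_int v ?s \<rho>' / R powr ?N"
    have j: "j \<ge> 0" using ball_int_eq_scaled(2)[OF R(1), of v ?s \<rho>'] by (auto simp: j_def)
    have "ball_int u (\<theta> * \<mu>) \<rho> / R powr ?N \<le> C * (\<rho>' - \<rho>) powr (- (p * \<theta>)) * ball_int v ?s \<rho>' / R powr ?N"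
      using C(2)[of \<rho> \<rho>'] R by (intro divide_right_mono) auto
    also have "\<dots> = C * (\<rho>' - \<rho>) powr (- (p * \<theta>)) * j" by (simp add: j_def)
    finally have "mean_norm R u (\<theta> * \<mu>) \<rho> \<le> (C * (\<rho>' - \<rho>) powr (- (p * \<theta>)) * j) powr (1 / (\<theta> * \<mu>))"
      unfolding mean_norm_def using \<theta> \<mu> ball_int_nonneg[of u "\<theta> * \<mu>" \<rho>] by (intro powr_mono2) auto
    also have "\<dots> = C powr (1 / (\<theta> * \<mu>)) * (\<rho>' - \<rho>) powr (- (p / \<mu>)) * (j powr (1 / ?s)) powr ((p - 1) / \<mu>)"
      using C(1) R j \<theta> \<mu> p by (simp add: powr_mult powr_powr)
    also have "(\<rho>' - \<rho>) powr (- (p / \<mu>)) = (R / (\<rho>' - \<rho>)) powr (p / \<mu>) * R powr (- (p / \<mu>))"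
      using R by (simp add: powr_divide powr_minus_divide)
    finally show ?thesis by (simp add: mean_norm_def j_def mult_ac)
  qed
  moreover have "C powr (1 / (\<theta> * \<mu>)) > 0" "p / \<mu> > 0" using C p \<mu> by auto
  ultimately show ?thesis unfolding controls_def by blast
qed

lemma ball_int_mono:
  fixes u :: "'a::euclidean_space \<Rightarrow> real"
  assumes u: "continuous_on UNIV u" "\<And>x. 0 \<le> u x" and k: "0 < k" and "\<rho> \<le> \<rho>'"
  shows "ball_int u k \<rho> \<le> ball_int u k \<rho>'"
  unfolding ball_int_def using assms(4) ball_int_integrable[OF u k]
  by (intro integral_mono) (auto simp: indicator_def)

lemma mean_norm_mono:
  fixes u :: "'a::euclidean_space \<Rightarrow> real"
  assumes u: "continuous_on UNIV u" "\<And>x. 0 \<le> u x" and k: "0 < k" and "\<rho> \<le> \<rho>'"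
  shows "mean_norm R u k \<rho> \<le> mean_norm R u k \<rho>'"
  unfolding mean_norm_def using k ball_int_mono[OF assms] ball_int_nonneg[of u k \<rho>]
  by (intro powr_mono2 divide_right_mono) auto

lemma controls_Jensen:
  fixes u :: "'a::euclidean_space \<Rightarrow> real"
  assumes u: "continuous_on UNIV u" "\<And>x. 0 \<le> u x" and st: "0 < s" "s \<le> t"
  shows "controls u s u t 0 1"
proof -
  let ?N = "real DIM('a)"
  define \<omega> where "\<omega> = measure lborel (cball (0::'a) 1)"
  have \<omega>: "\<omega> > 0" unfolding \<omega>_def by (rule ball_measure_unit_pos)
  define C where "C = ((\<omega> * 2 powr ?N) powr (1 - s / t)) powr (1 / s)"
  have "mean_norm R u s \<rho> \<le> C * (R / (\<rho>' - \<rho>)) powr 1 * R powr (- 0) * mean_norm R u t \<rho>' powr 1"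
    if R: "0 < R" "R \<le> \<rho>" "\<rho> < \<rho>'" "\<rho>' \<le> 2 * R" for R \<rho> \<rho>'
  proof -
    have \<rho>: "0 < \<rho>" using R by simp
    define j where "j = ball_int u t \<rho> / R powr ?N"
    have j: "ball_int u t \<rho> = R powr ?N * j" "j \<ge> 0" using ball_int_eq_scaled[OF R(1), of u t \<rho>] by (auto simp: j_def)
    have "ball_int u s \<rho> \<le> (R powr ?N * j) powr (s / t) * measure lborel (cball (0::'a) \<rho>) powr (1 - s / t)"
      using ball_int_Jensen[OF u st \<rho>] unfolding j(1) .
    also have "\<dots> \<le> (R powr ?N * j) powr (s / t) * (\<omega> * (2 * R) powr ?N) powr (1 - s / t)"
      unfolding measure_cball_powr[OF \<rho>] \<omega>_def[symmetric] using \<omega> R st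
      by (intro mult_left_mono powr_mono2) auto
    also have "\<dots> = (\<omega> * 2 powr ?N) powr (1 - s / t) * (R powr (?N * (s / t)) * R powr (?N * (1 - s / t))) * j powr (s / t)"
      using \<omega> R j(2) by (simp add: powr_mult powr_powr mult_ac)
    also have "R powr (?N * (s / t)) * R powr (?N * (1 - s / t)) = R powr ?N"
      using R by (simp add: algebra_simps flip: powr_add)
    finally have "ball_int u s \<rho> / R powr ?N \<le> (\<omega> * 2 powr ?N) powr (1 - s / t) * j powr (s / t)"
      using R by (simp add: field_simps)
    then have "mean_norm R u s \<rho> \<le> ((\<omega> * 2 powr ?N) powr (1 - s / t) * j powr (s / t)) powr (1 / s)"
      unfolding mean_norm_def using st ball_int_nonneg[of u s \<rho>] by (intro powr_mono2) auto
    also have "\<dots> = C * mean_norm R u t \<rho>"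
      using st j(2) unfolding C_def mean_norm_def j_def[symmetric] by (subst powr_mult) (auto simp: powr_powr)
    also have "\<dots> \<le> C * (R / (\<rho>' - \<rho>) * mean_norm R u t \<rho>')"
    proof (rule mult_left_mono)
      \<comment> \<open>Jensen's inequality needs no larger radius; a gap factor, never below 1
        because the gap is at most R, is inserted only to fit the positive power that
        \<open>controls\<close> asks for.\<close>
      have "1 \<le> R / (\<rho>' - \<rho>)" using R by (simp add: field_simps)
      then have "1 * mean_norm R u t \<rho> \<le> R / (\<rho>' - \<rho>) * mean_norm R u t \<rho>'"
        using mean_norm_mono[OF u, of t \<rho> \<rho>' R] st R mean_norm_nonneg[of R u t \<rho>] by (intro mult_mono) auto
      then show "mean_norm R u t \<rho> \<le> R / (\<rho>' - \<rho>) * mean_norm R u t \<rho>'" by simp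
    qed (simp add: C_def)
    finally show ?thesis using R mean_norm_nonneg[of R u t \<rho>'] by simp
  qed
  moreover have "C > 0" using \<omega> by (simp add: C_def)
  ultimately show ?thesis unfolding controls_def by (metis zero_less_one)
qed

section \<open>From decay of the means to vanishing\<close>

lemma ball_int_eq_0_imp:
  fixes u :: "'a::euclidean_space \<Rightarrow> real"
  assumes u: "continuous_on UNIV u" "\<And>x. 0 \<le> u x" and k: "0 < k" and z: "ball_int u k \<rho> = 0" and x: "norm x < \<rho>"
  shows "u x = 0"
proof (rule ccontr)
  assume "u x \<noteq> 0"
  define S where "S = ball 0 \<rho> \<inter> {x. u x \<noteq> 0}"
  have "open S"
    unfolding S_def using u(1) by (intro open_Int open_ball open_Collect_neq continuous_on_const)
  have "AE x in lebesgue. indicator (cball 0 \<rho>) x * u x powr k = 0"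
    using z integral_nonneg_eq_0_iff_AE[OF ball_int_integrable[OF u k, of \<rho>]] by (simp add: ball_int_def)
  then have "AE x in lebesgue. x \<notin> S"
    by eventually_elim (auto simp: S_def indicator_def split: if_splits)
  then have "negligible S"
    using \<open>open S\<close> by (subst negligible_iff_null_sets, subst AE_iff_null_sets) auto
  moreover have "x \<in> S" using x \<open>u x \<noteq> 0\<close> by (simp add: S_def)
  ultimately show False using open_not_negligible[OF \<open>open S\<close>] by blast
qed

text \<open>The rate of decay of the normalised norm is the same for all k, whereas the k-th power
  multiplies it by k. A large k therefore beats the volume R^N lost in removing the
  normalisation.\<close>

lemma controls_self_imp_zero:
  fixes u :: "'a::euclidean_space \<Rightarrow> real"
  assumes u: "continuous_on UNIV u" "\<And>x. 0 \<le> u x" and \<gamma>: "0 < \<gamma>" and \<sigma>: "0 < \<sigma>" "\<sigma> < 1"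
    and ctrl: "\<And>k. p \<le> k \<Longrightarrow> controls u k u k \<gamma> \<sigma>"
  shows "u x = 0"
proof -
  let ?N = "real DIM('a)"
  \<comment> \<open>The threshold N(1-sigma)/gamma is where k gamma/(1-sigma) equals N; adding 1
    makes the inequality strict.\<close>
  define k where "k = max p (?N * (1 - \<sigma>) / \<gamma> + 1)"
  have "0 \<le> ?N * (1 - \<sigma>) / \<gamma>" using \<gamma> \<sigma> by simp
  then have k: "k > 0" "p \<le> k" "?N * (1 - \<sigma>) / \<gamma> < k" by (auto simp: k_def)
  define e where "e = k * \<gamma> / (1 - \<sigma>) - ?N"
  have e: "e > 0" using k(3) \<gamma> \<sigma> by (simp add: e_def field_simps)
  obtain C M where C: "C > 0" "M > 0" "\<And>R \<rho> \<rho>'. 0 < R \<Longrightarrow> R \<le> \<rho> \<Longrightarrow> \<rho> < \<rho>' \<Longrightarrow> \<rho>' \<le> 2 * R \<Longrightarrow>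
     mean_norm R u k \<rho> \<le> C * (R / (\<rho>' - \<rho>)) powr M * R powr (- \<gamma>) * mean_norm R u k \<rho>' powr \<sigma>"
    using ctrl[OF k(2)] unfolding controls_def by blast
  define K where "K = (2 powr (M / (1 - \<sigma>)) * C) powr (1 / (1 - \<sigma>))"
  have bound: "ball_int u k R \<le> K powr k * R powr (- e)" if R: "0 < R" for R
  proof -
    have "mean_norm R u k R \<le> K * R powr (- \<gamma> / (1 - \<sigma>))"
      unfolding K_def
      by (rule radius_iteration_power[where B = "mean_norm R u k (2 * R)", OF R C(2,1) \<sigma>])
        (use C(3)[OF R] mean_norm_nonneg mean_norm_mono[OF u k(1)] in auto)
    then have "mean_norm R u k R powr k \<le> (K * R powr (- \<gamma> / (1 - \<sigma>))) powr k"
      using k mean_norm_nonneg by (intro powr_mono2) auto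
    also have "mean_norm R u k R powr k = ball_int u k R / R powr ?N"
      using k ball_int_nonneg[of u k R] by (simp add: mean_norm_def powr_powr)
    also have "(K * R powr (- \<gamma> / (1 - \<sigma>))) powr k = K powr k * R powr (- \<gamma> / (1 - \<sigma>) * k)"
      by (simp add: powr_mult powr_powr K_def)
    finally have "ball_int u k R \<le> K powr k * (R powr (- \<gamma> / (1 - \<sigma>) * k) * R powr ?N)"
      using R by (simp add: field_simps)
    also have "R powr (- \<gamma> / (1 - \<sigma>) * k) * R powr ?N = R powr (- e)"
      using R by (simp add: e_def mult.commute flip: powr_add)
    finally show ?thesis .
  qed
  have "ball_int u k \<rho> \<le> 0" for \<rho>
  proof (rule tendsto_lowerbound)
    have "((\<lambda>R. K powr k * R powr (- e)) \<longlongrightarrow> K powr k * 0) at_top"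
      using e by (intro tendsto_mult tendsto_const tendsto_neg_powr filterlim_ident) auto
    then show "((\<lambda>R. K powr k * R powr (- e)) \<longlongrightarrow> 0) at_top" by simp
    show "\<forall>\<^sub>F R in at_top. ball_int u k \<rho> \<le> K powr k * R powr (- e)"
      using eventually_gt_at_top[of "max 0 \<rho>"]
    proof eventually_elim
      fix R :: real assume "max 0 \<rho> < R"
      then have "ball_int u k \<rho> \<le> ball_int u k R" "ball_int u k R \<le> K powr k * R powr (- e)"
        by (auto intro!: ball_int_mono[OF u k(1)] bound)
      then show "ball_int u k \<rho> \<le> K powr k * R powr (- e)" by (rule order_trans)
    qed
  qed simp
  then have "ball_int u k (norm x + 1) = 0" using ball_int_nonneg[of u k] by (simp add: antisym)
  then show ?thesis by (rule ball_int_eq_0_imp[OF u k(1)]) simp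
qed

lemma controls_zero:
  fixes u v :: "'a::euclidean_space \<Rightarrow> real"
  assumes v: "continuous_on UNIV v" "\<And>x. 0 \<le> v x" and \<delta>: "0 < \<delta>" and u: "\<And>x. u x = 0" and c: "controls v \<delta> u b \<gamma> \<sigma>"
  shows "v x = 0"
proof -
  define R where "R = norm x + 1"
  have "0 < R" using norm_ge_zero[of x] unfolding R_def by linarith
  then have R: "0 < R" "R \<le> R" "R < 2 * R" "2 * R \<le> 2 * R" by auto
  obtain C M where "C > 0" "M > 0" "mean_norm R v \<delta> R \<le> C * (R / (2 * R - R)) powr M * R powr (- \<gamma>) * mean_norm R u b (2 * R) powr \<sigma>"
    using c R unfolding controls_def by blast
  \<comment> \<open>Since \<open>0 powr\<close> anything is 0, the right side of the control
    vanishes for every \<open>b\<close> and \<open>\<sigma>\<close>.\<close>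
  moreover have "mean_norm R u b (2 * R) = 0" by (simp add: mean_norm_def ball_int_def u)
  ultimately have "mean_norm R v \<delta> R = 0" using mean_norm_nonneg[of R v \<delta> R] by simp
  then have "ball_int v \<delta> R = 0" using R by (simp add: mean_norm_def)
  then show ?thesis by (rule ball_int_eq_0_imp[OF v \<delta>]) (simp add: R_def)
qed

section \<open>From weak solutions to shifted solutions\<close>

lemma has_weak_gradient_add_const:
  fixes u :: "'a::euclidean_space \<Rightarrow> real"
  assumes u: "continuous_on UNIV u" and G: "has_weak_gradient u G"
  shows "has_weak_gradient (\<lambda>x. u x + c) G"
  unfolding has_weak_gradient_def
proof (intro conjI allI impI ballI)
  show "L_loc 1 (\<lambda>x. u x + c)" using u by (intro L_loc_continuous continuous_on_add continuous_on_const) auto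
  show "L_loc 1 G" using G by (simp add: has_weak_gradient_def)
  fix \<phi> :: "'a \<Rightarrow> real" and i :: 'a assume \<phi>: "Cc_infty \<phi>" and i: "i \<in> Basis"
  obtain D r where D: "C1_grad \<phi> D" "\<And>x i. i \<in> Basis \<Longrightarrow> frechet_derivative \<phi> (at x) i = D x \<bullet> i"
    "\<And>x. r < norm x \<Longrightarrow> \<phi> x = 0" using Cc_inftyD[OF \<phi>] by metis
  have D0: "D x = 0" if "r < norm x" for x using C1_grad_support[OF D(1) _ that] D(3) by simp
  have 1: "integrable lborel (\<lambda>x. D x \<bullet> i)" "integrable lborel (\<lambda>x. u x * (D x \<bullet> i))"
    using C1_gradD(2)[OF D(1)] u D0 by (auto intro!: integrable_continuous_compact_support[of _ r] continuous_intros)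
  then have 2: "integrable lebesgue (\<lambda>x. D x \<bullet> i)" "integrable lebesgue (\<lambda>x. u x * (D x \<bullet> i))"
    by (auto simp: integrable_completion dest: borel_measurable_integrable)
  have "(\<integral>x. D x \<bullet> i \<partial>lebesgue) = 0"
    using C1_compact_integral_grad_eq_0[OF D(1,3)] 1 by (subst integral_completion) auto
  then have "(LINT x|lebesgue. (u x + c) * (D x \<bullet> i)) = (LINT x|lebesgue. u x * (D x \<bullet> i))"
    using 2 by (simp add: distrib_right)
  also have "\<dots> = - (LINT x|lebesgue. (G x \<bullet> i) * \<phi> x)"
  proof -
    have "(LINT x|lebesgue. u x * frechet_derivative \<phi> (at x) i) = - (LINT x|lebesgue. (G x \<bullet> i) * \<phi> x)"
      using G \<phi> i unfolding has_weak_gradient_def by blast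
    then show ?thesis by (simp add: D(2)[OF i])
  qed
  finally show "(LINT x|lebesgue. (u x + c) * frechet_derivative \<phi> (at x) i) = - (LINT x|lebesgue. (G x \<bullet> i) * \<phi> x)"
    using D(2)[OF i] by simp
qed

lemma L_infty_continuous_compact_support:
  fixes f :: "'a::euclidean_space \<Rightarrow> 'b::euclidean_space"
  assumes "continuous_on UNIV f" "\<And>x. r < norm x \<Longrightarrow> f x = 0"
  shows "L_infty f"
proof -
  obtain M where "\<And>x. norm (f x) \<le> M" using continuous_compact_support_bounded[OF assms] by metis
  moreover have "f \<in> borel_measurable lebesgue"
    using assms(1) by (intro borel_measurable_imp_lebesgue borel_measurable_continuous_onI)
  ultimately show ?thesis unfolding L_infty_def by blast
qed

text \<open>The flux stays A(x, u, G), evaluated at the unshifted u, so the equation is literally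
  unchanged, and coercivity is invoked only at nonnegative values of u. The C1 multipliers with
  bounded support are particular W^(1,\<infinity>) test functions.\<close>

lemma weak_solution_regularized:
  fixes u :: "'a::euclidean_space \<Rightarrow> real"
  assumes s: "weak_solution p A u g" and p: "1 < p" and K: "0 < K1" "0 < K2"
    and c: "\<And>x u \<eta>. 0 \<le> u \<Longrightarrow> A x u \<eta> \<bullet> \<eta> \<ge> K1 * norm \<eta> powr p"
      "\<And>x u \<eta>. 0 \<le> u \<Longrightarrow> K1 * norm \<eta> powr p \<ge> K2 * norm (A x u \<eta>) powr (p / (p - 1))"
    and u: "continuous_on UNIV u" "\<And>x. 0 \<le> u x" and g: "continuous_on UNIV g"
  shows "regularized_sol p K1 K2 u g"
proof -
  obtain G where G: "has_weak_gradient u G" "L_loc p G" "L_loc (p / (p - 1)) (\<lambda>x. A x (u x) (G x))"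
    and eq: "\<And>\<phi> H. L_infty \<phi> \<Longrightarrow> has_weak_gradient \<phi> H \<Longrightarrow> L_infty H \<Longrightarrow>
           (AE x in lebesgue. 0 \<le> \<phi> x) \<Longrightarrow>
           (\<exists>K. compact K \<and> (AE x in lebesgue. x \<notin> K \<longrightarrow> \<phi> x = 0)) \<Longrightarrow>
           (LINT x|lebesgue. A x (u x) (G x) \<bullet> H x) = (LINT x|lebesgue. g x * \<phi> x)"
    using s unfolding weak_solution_def by blast
  have "weak_sol p K1 K2 \<epsilon> (\<lambda>x. u x + \<epsilon>) G (\<lambda>x. A x (u x) (G x)) g" if \<epsilon>: "\<epsilon> > 0" for \<epsilon>
  proof
    show "1 < p" "0 < K1" "0 < K2" "0 < \<epsilon>" by fact+
    show "\<epsilon> \<le> u x + \<epsilon>" for x using u by simp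
    show "continuous_on UNIV (\<lambda>x. u x + \<epsilon>)" using u by (intro continuous_on_add continuous_on_const) auto
    show "continuous_on UNIV g" by fact
    show "has_weak_gradient (\<lambda>x. u x + \<epsilon>) G" using u(1) G(1) by (rule has_weak_gradient_add_const)
    show "L_loc p G" "L_loc (p / (p - 1)) (\<lambda>x. A x (u x) (G x))" by fact+
    show "K1 * norm (G x) powr p \<le> A x (u x) (G x) \<bullet> G x" for x using c(1) u(2) by blast
    show "K2 * norm (A x (u x) (G x)) powr (p / (p - 1)) \<le> K1 * norm (G x) powr p" for x using c(2) u(2) by blast
    fix \<phi> :: "'a \<Rightarrow> real" and H :: "'a \<Rightarrow> 'a" and r assume \<phi>: "C1_grad \<phi> H" "\<And>x. 0 \<le> \<phi> x" "\<And>x. r < norm x \<Longrightarrow> \<phi> x = 0"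
    have H0: "H x = 0" if "r < norm x" for x using C1_grad_support[OF \<phi>(1) _ that] \<phi>(3) by simp
    show "(LINT x|lebesgue. A x (u x) (G x) \<bullet> H x) = (LINT x|lebesgue. g x * \<phi> x)"
    proof (rule eq)
      show "L_infty \<phi>" using C1_gradD(3)[OF \<phi>(1)] \<phi>(3) by (rule L_infty_continuous_compact_support)
      show "L_infty H" using C1_gradD(2)[OF \<phi>(1)] H0 by (rule L_infty_continuous_compact_support)
      show "has_weak_gradient \<phi> H" using \<phi>(1) by (rule C1_grad_has_weak_gradient)
      show "AE x in lebesgue. 0 \<le> \<phi> x" using \<phi>(2) by simp
      have "AE x in lebesgue. x \<notin> cball 0 r \<longrightarrow> \<phi> x = 0" using \<phi>(3) by simp
      then show "\<exists>K. compact K \<and> (AE x in lebesgue. x \<notin> K \<longrightarrow> \<phi> x = 0)" using compact_cball by blast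
    qed
  qed
  then show ?thesis unfolding regularized_sol_def using u by blast
qed

section \<open>Closing the loop between the two equations\<close>

text \<open>Both systems enter through the single hypothesis \<open>uv\<close>, in which the order
  \<open>m\<close> of the mean of u is arbitrary. The first equation leads back from v to u, and D >
  0 is exactly the condition that the composed exponent \<open>\<sigma>\<close> is below 1.\<close>

lemma system_zero:
  fixes u v :: "'a::euclidean_space \<Rightarrow> real"
  assumes p: "1 < p" and q: "1 < q" and \<delta>: "0 < \<delta>" and \<mu>: "0 < \<mu>" and D: "(p - 1) * (q - 1) < \<delta> * \<mu>"
    and u: "regularized_sol p K1 K2 u (\<lambda>x. - (v x powr \<delta>))" and vc: "continuous_on UNIV v" "\<And>x. 0 \<le> v x"
    and m: "0 < m" and uv: "controls u m v \<delta> (q / \<mu>) ((q - 1) / \<mu>)"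
  shows "u x = 0" "v x = 0"
proof -
  have uc: "continuous_on UNIV u" "\<And>x. 0 \<le> u x" using u by (auto simp: regularized_sol_def)
  define \<sigma> where "\<sigma> = (q - 1) / \<mu> * ((p - 1) / \<delta>)"
  have "\<sigma> = (p - 1) * (q - 1) / (\<delta> * \<mu>)" by (simp add: \<sigma>_def mult.commute)
  then have \<sigma>: "0 < \<sigma>" "\<sigma> < 1" using p q \<delta> \<mu> D by simp_all
  define \<gamma> where "\<gamma> = q / \<mu> + (q - 1) / \<mu> * (p / \<delta>)"
  have \<gamma>: "0 < \<gamma>" using p q \<delta> \<mu> by (auto simp: \<gamma>_def intro!: add_pos_pos)
  note mass = controls_mass[OF u p \<delta>]
  \<comment> \<open>The loop runs from u of order k to u of order m (reverse Hoelder), to v of order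
    delta (\<open>uv\<close>), to u of order p (mass) and back to order k (Jensen). The first and
    last links change neither decay nor exponent.\<close>
  have ctrl: "controls u k u k \<gamma> \<sigma>" if k: "p \<le> k" for k
  proof -
    have 1: "controls u k u m 0 1" using controls_reverse_Holder[OF u _ p k m] by simp
    have 2: "controls u p u k 0 1" using controls_Jensen[OF uc _ k] p by simp
    have 3: "controls v \<delta> u k (p / \<delta>) ((p - 1) / \<delta>)" using controls_trans[OF mass 2] p \<delta> by simp
    have 4: "controls u m u k \<gamma> \<sigma>" using controls_trans[OF uv 3] q \<mu> by (simp add: \<gamma>_def \<sigma>_def)
    show ?thesis using controls_trans[OF 1 4] by simp
  qed
  have u0: "u y = 0" for y by (rule controls_self_imp_zero[OF uc \<gamma> \<sigma> ctrl])
  show "u x = 0" by (rule u0)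
  show "v x = 0" by (rule controls_zero[OF vc \<delta> u0 mass])
qed

theorem corollary1p3:
  fixes Ap Aq :: "real ^ 'n \<Rightarrow> real \<Rightarrow> real ^ 'n \<Rightarrow> real ^ 'n"
    and p q \<delta> \<mu> :: real
  assumes "1 < p" "p < real CARD('n)" "1 < q" "q < real CARD('n)"
    and "\<delta> > 0" "\<mu> > 0"
    and "\<delta> * \<mu> - (p - 1) * (q - 1) > 0"
    and "caratheodory Ap" "strongly_coercive p Ap"
    and "caratheodory Aq" "strongly_coercive q Aq"
  shows
    "(\<nexists>u v. (\<forall>x. 0 \<le> u x) \<and> (\<forall>x. 0 \<le> v x) \<and>
        W1_loc p u \<and> continuous_on UNIV u \<and> W1_loc q v \<and> continuous_on UNIV v \<and>
        weak_solution p Ap u (\<lambda>x. - (v x powr \<delta>)) \<and>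
        weak_solution q Aq v (\<lambda>x. - (u x powr \<mu>)) \<and>
        \<not> ((\<forall>x. u x = 0) \<and> (\<forall>x. v x = 0))) \<and>
     (\<nexists>u v. (\<forall>x. 0 \<le> u x) \<and> (\<forall>x. 0 \<le> v x) \<and>
        W1_loc p u \<and> continuous_on UNIV u \<and> W1_loc q v \<and> continuous_on UNIV v \<and>
        weak_solution p Ap u (\<lambda>x. - (v x powr \<delta>)) \<and>
        weak_solution q Aq v (\<lambda>x. u x powr \<mu>) \<and>
        \<not> ((\<forall>x. u x = 0) \<and> (\<forall>x. v x = 0)))"
proof -
  have D: "(p - 1) * (q - 1) < \<delta> * \<mu>" using assms(7) by simp
  obtain K1 K2 where K: "K1 > 0" "K2 > 0"
    "\<And>x u \<eta>. 0 \<le> u \<Longrightarrow> Ap x u \<eta> \<bullet> \<eta> \<ge> K1 * norm \<eta> powr p"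
    "\<And>x u \<eta>. 0 \<le> u \<Longrightarrow> K1 * norm \<eta> powr p \<ge> K2 * norm (Ap x u \<eta>) powr (p / (p - 1))"
    using assms(9) unfolding strongly_coercive_def by blast
  obtain L1 L2 where L: "L1 > 0" "L2 > 0"
    "\<And>x u \<eta>. 0 \<le> u \<Longrightarrow> Aq x u \<eta> \<bullet> \<eta> \<ge> L1 * norm \<eta> powr q"
    "\<And>x u \<eta>. 0 \<le> u \<Longrightarrow> L1 * norm \<eta> powr q \<ge> L2 * norm (Aq x u \<eta>) powr (q / (q - 1))"
    using assms(11) unfolding strongly_coercive_def by blast
  have powr_cont: "continuous_on UNIV (\<lambda>x. w x powr a)" if "continuous_on UNIV w" "\<forall>x. 0 \<le> w x" "0 < a" for w :: "real ^ 'n \<Rightarrow> real" and a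
    using that by (intro continuous_on_powr' continuous_on_const) auto
  have sub: "(\<forall>x. u x = 0) \<and> (\<forall>x. v x = 0)"
    if nn: "\<forall>x. 0 \<le> u x" "\<forall>x. 0 \<le> v x" and c: "continuous_on UNIV u" "continuous_on UNIV v"
      and su: "weak_solution p Ap u (\<lambda>x. - (v x powr \<delta>))" and sv: "weak_solution q Aq v (\<lambda>x. - (u x powr \<mu>))" for u v
  proof -
    have u: "regularized_sol p K1 K2 u (\<lambda>x. - (v x powr \<delta>))"
      using nn c assms(5) by (intro weak_solution_regularized[OF su assms(1) K] continuous_on_minus powr_cont) auto
    have v: "regularized_sol q L1 L2 v (\<lambda>x. - (u x powr \<mu>))"
      using nn c assms(6) by (intro weak_solution_regularized[OF sv assms(3) L] continuous_on_minus powr_cont) auto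
    \<comment> \<open>The mass estimate for the second equation involves the mean of v of order q;
      the reverse Hoelder inequality for the subsolution v brings it down or up to order delta,
      whichever is needed.\<close>
    have "controls v q v \<delta> 0 1"
      using controls_reverse_Holder[OF v _ assms(3) order_refl assms(5)] by simp
    from controls_trans[OF controls_mass[OF v assms(3,6)] this]
    have "controls u \<mu> v \<delta> (q / \<mu>) ((q - 1) / \<mu>)" using assms(3,6) by simp
    from system_zero[OF assms(1,3,5,6) D u c(2) _ assms(6) this] nn show ?thesis by auto
  qed
  have super: "(\<forall>x. u x = 0) \<and> (\<forall>x. v x = 0)"
    if nn: "\<forall>x. 0 \<le> u x" "\<forall>x. 0 \<le> v x" and c: "continuous_on UNIV u" "continuous_on UNIV v"
      and su: "weak_solution p Ap u (\<lambda>x. - (v x powr \<delta>))" and sv: "weak_solution q Aq v (\<lambda>x. u x powr \<mu>)" for u v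
  proof -
    have u: "regularized_sol p K1 K2 u (\<lambda>x. - (v x powr \<delta>))"
      using nn c assms(5) by (intro weak_solution_regularized[OF su assms(1) K] continuous_on_minus powr_cont) auto
    have v: "regularized_sol q L1 L2 v (\<lambda>x. u x powr \<mu>)"
      using nn c assms(6) by (intro weak_solution_regularized[OF sv assms(3) L] powr_cont) auto
    \<comment> \<open>The bound delta/(q-1) ensures theta (q-1) \<le> delta, so that Jensen's
      inequality reaches the mean of order delta; 1/2 ensures theta < 1.\<close>
    define \<theta> where "\<theta> = min (1 / 2) (\<delta> / (q - 1))"
    have \<theta>: "0 < \<theta>" "\<theta> < 1" "\<theta> * (q - 1) \<le> \<delta>" "0 < \<theta> * (q - 1)"
    proof -
      have q: "q - 1 > 0" using assms(3) by simp
      show "0 < \<theta>" using q assms(5) by (simp add: \<theta>_def)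
      show "\<theta> < 1" by (simp add: \<theta>_def)
      have "\<theta> * (q - 1) \<le> \<delta> / (q - 1) * (q - 1)" using q by (intro mult_right_mono) (auto simp: \<theta>_def)
      then show "\<theta> * (q - 1) \<le> \<delta>" using q by simp
      show "0 < \<theta> * (q - 1)" using q \<open>0 < \<theta>\<close> by simp
    qed
    have "controls v (\<theta> * (q - 1)) v \<delta> 0 1"
      using nn by (intro controls_Jensen c \<theta>) auto
    from controls_trans[OF controls_supersolution[OF v c(1) _ assms(3,6) \<theta>(1,2)] this]
    have "controls u (\<theta> * \<mu>) v \<delta> (q / \<mu>) ((q - 1) / \<mu>)" using assms(3,6) nn by simp
    moreover have "0 < \<theta> * \<mu>" using \<theta> assms(6) by simp
    ultimately show ?thesis
      using system_zero[OF assms(1,3,5,6) D u c(2), of "\<theta> * \<mu>"] nn by auto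
  qed
  show ?thesis using sub super by blast
qed

end
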